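(* Let $L>1$. Let $(a_n)_{n\ge0}$ be a sequence of positive numbers with $a_0=1$, and suppose there are constants $0<c_1\le C_1<\infty$ with $c_1 n^{\frac12(L-1)}\le a_n\le C_1 n^{\frac12(L-1)}$ for all $n\ge1$. Let $F(z)=\sum_{n\ge0}\zeta_n a_n z^n$, and for $0<r<1$ let $\mathrm{Hole}(r)=\{F\ne0\text{ on }\{|z|\le r\}\}$. Then, as $r\to1^-$, $$-\log\mathbb P[\mathrm{Hole}(r)]=\frac{(L-1)^2+o(1)}{4}\,\frac1{1-r}\,\log^2\frac1{1-r},$$ where $o(1)$ denotes a quantity tending to $0$ as $r\to1^-$.
   Context: $(\zeta_n)_{n\ge0}$ is a sequence of independent standard complex Gaussian random variables: each has density $\frac1\pi e^{-|z|^2}$ with respect to planar Lebesgue measure on $\mathbb C$. The series almost surely has radius of convergence $1$. $\log^2x$ means $(\log x)^2$. *)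

theory Defs
  imports "HOL-Probability.Probability"
begin

definition std_complex_gaussian :: "'w measure \<Rightarrow> ('w \<Rightarrow> complex) \<Rightarrow> bool" where
  "std_complex_gaussian M X \<longleftrightarrow>
     distributed M lborel X (\<lambda>z. ennreal (1 / pi * exp (- (cmod z)\<^sup>2)))"

definition gaussian_series ::
    "(nat \<Rightarrow> 'w \<Rightarrow> complex) \<Rightarrow> (nat \<Rightarrow> real) \<Rightarrow> 'w \<Rightarrow> complex \<Rightarrow> complex" where
  "gaussian_series \<zeta> a \<omega> z = (\<Sum>n. \<zeta> n \<omega> * of_real (a n) * z ^ n)"

(* The sum is meaningful on the whole unit disc only on the almost sure event that the radius
   of convergence is at least 1; elsewhere suminf takes an arbitrary value. The hole event is
   taken inside that event. This does not affect its probability, and it keeps the event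
   measurable (M is not assumed to be complete). *)
definition Hole ::
    "'w measure \<Rightarrow> (nat \<Rightarrow> 'w \<Rightarrow> complex) \<Rightarrow> (nat \<Rightarrow> real) \<Rightarrow> real \<Rightarrow> 'w set" where
  "Hole M \<zeta> a r =
     {\<omega> \<in> space M. conv_radius (\<lambda>n. \<zeta> n \<omega> * of_real (a n)) \<ge> 1 \<and>
        (\<forall>z. cmod z \<le> r \<longrightarrow> gaussian_series \<zeta> a \<omega> z \<noteq> 0)}"

end

theory Submission
  imports Defs "HOL-Complex_Analysis.Complex_Analysis" "HOL-Real_Asymp.Real_Asymp"
begin

text \<open>
  Write \<open>\<delta> = 1 - r\<close>, \<open>\<Lambda> = ln (1 / \<delta>)\<close> and \<open>\<beta> = (L - 1) / 2\<close>. The cost of a hole is that of pushing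
  the coefficients \<open>\<zeta> n * a n * r ^ n\<close> below \<open>1\<close>, that is, the sum over \<open>n\<close> of the positive part of
  \<open>2 * ln (a n * r ^ n)\<close>, which is about \<open>\<beta>\<^sup>2 * \<Lambda>\<^sup>2 / \<delta>\<close>.

  For the lower bound, take \<open>cmod (\<zeta> 0) \<ge> \<delta> powr (-1/2)\<close>, which is cheap, and all
  \<open>cmod (\<zeta> n * a n * r ^ n) \<le> \<delta> powr \<eta>\<close> for \<open>n\<close> up to a multiple of \<open>\<Lambda> / \<delta>\<close>. Given this, the terms still
  have independent symmetric phases, so by a Chernoff bound on a net their sum is smaller than \<open>\<zeta> 0\<close>
  on the whole circle.

  For the upper bound, put \<open>N = \<beta> * \<Lambda> / \<delta>\<close> equally spaced points on a circle of radius slightly less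
  than \<open>r\<close>. If \<open>F\<close> has no zeros, the mean of the harmonic function \<open>ln (cmod F)\<close> over these points
  is almost \<open>ln (cmod (F 0))\<close>, and \<open>cmod (F 0) \<le> \<delta> powr (-1/2 - \<eta>)\<close> up to a negligible event. So the product
  of the values of \<open>F\<close> at the points is at most about \<open>\<delta> powr (- N / 2)\<close>. The probability of that is estimated
  by passing from the first \<open>N\<close> coefficients to the values, a linear change of variables with squared
  Jacobian modulus \<open>N ^ N * (\<Prod>n<N. (a n * \<rho> ^ n)\<^sup>2)\<close>.
\<close>

section \<open>Averages over roots of unity\<close>

text \<open>Both bounds hinge on the scale \<open>\<delta> powr (-1/2)\<close>. A constant term of
  size \<open>K\<close> costs about \<open>K\<^sup>2\<close> in the exponent, which is negligible
  against \<open>\<Lambda>\<^sup>2 / \<delta>\<close> up to about that size and not much further.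
  The other terms, of order \<open>\<Lambda> / \<delta>\<close> in number, must then sum to less
  than \<open>K\<close>. The triangle inequality would force each below about
  \<open>\<delta> powr (1/2)\<close> and raise the constant from \<open>\<beta>\<^sup>2\<close> to
  \<open>(\<beta> + 1/2)\<^sup>2\<close>; random phases gain a square root and allow terms of size
  nearly one. In the other direction, the square of the product of values is about
  \<open>exp (N * \<Lambda>)\<close>, and the Jacobian factor \<open>N ^ N\<close> cancels it to
  leading order because \<open>ln N\<close> is close to \<Lambda>. What remains of the exponent is
  \<open>2 * \<beta> * N * \<Lambda> - N\<^sup>2 * \<delta>\<close>, maximal at the chosen
  \<open>N\<close>. Harnack's inequality between radii that differ by a small multiple of \<delta>
  would be useless at a single point; averaging raises the ratio of the radii to the power
  \<open>N\<close>, which makes it small.\<close>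

definition unity_root :: "nat \<Rightarrow> nat \<Rightarrow> complex" where
  "unity_root N j = cis (2 * pi * real j / real N)"

lemma norm_unity_root [simp]: "cmod (unity_root N j) = 1"
  by (simp add: unity_root_def)

lemma unity_root_nonzero [simp]: "unity_root N j \<noteq> 0"
  by (simp add: unity_root_def)

lemma unity_root_power_N: "N > 0 \<Longrightarrow> unity_root N j ^ N = 1"
  unfolding unity_root_def Complex.DeMoivre using cis_multiple_2pi[of "real j"] by (simp add: mult_ac)

lemma unity_root_powers: "bij_betw (unity_root N) {..<N} {z. z ^ N = 1}" if "N > 0"
  using Complex.bij_betw_roots_unity[OF that] by (simp add: unity_root_def[abs_def])

lemma unity_root_power_swap: "unity_root N j ^ k = unity_root N k ^ j"
  unfolding unity_root_def Complex.DeMoivre by (rule arg_cong[of _ _ cis]) simp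

lemma unity_root_eq_1_iff:
  assumes "N > 0" shows "unity_root N k = 1 \<longleftrightarrow> N dvd k"
proof
  assume "unity_root N k = 1"
  then have "cos (2 * pi * real k / real N) = 1"
    unfolding unity_root_def by (metis cis.simps(1) one_complex.sel(1))
  then obtain x :: int where "2 * pi * real k / real N = of_int x * 2 * pi"
    using cos_one_2pi_int by auto
  then have "real k = of_int x * real N" using assms by (simp add: field_simps)
  then have "int k = x * int N" by (metis of_int_eq_iff of_int_mult of_int_of_nat_eq)
  then have "int N dvd int k" by simp
  then show "N dvd k" by simp
next
  assume "N dvd k"
  then obtain m where "k = N * m" by blast
  then show "unity_root N k = 1" using assms
    using cis_multiple_2pi[of "real m"] by (simp add: unity_root_def mult_ac)
qed

lemma sum_unity_root_powers:
  assumes "N > 0"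
  shows "(\<Sum>j<N. unity_root N j ^ k) = (if N dvd k then of_nat N else 0)"
proof (cases "N dvd k")
  case True
  then have "unity_root N k = 1" using unity_root_eq_1_iff[OF assms] by simp
  then have "unity_root N j ^ k = 1" for j
    by (simp add: unity_root_power_swap[of N j k])
  then show ?thesis using True by simp
next
  case False
  have "(\<Sum>j<N. unity_root N k ^ j) = 0"
    using False assms unity_root_eq_1_iff[OF assms] unity_root_power_N[OF assms]
    by (simp add: geometric_sum)
  then show ?thesis using False by (simp add: unity_root_power_swap)
qed

text \<open>Averaging over the rotations keeps only the powers of \<open>z ^ N\<close>, so the average is
  a function of positive real part in the variable \<open>z ^ N\<close>; the Schwarz lemma for its Cayley
  transform is Harnack's inequality with the ratio \<open>(\<rho> / R) ^ N\<close>.\<close>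

lemma harnack_unity_roots:
  fixes u :: "complex \<Rightarrow> complex"
  assumes hol: "u holomorphic_on ball 0 R"
    and pos: "\<And>z. z \<in> ball 0 R \<Longrightarrow> 0 < Re (u z)"
    and N: "N > 0" and \<rho>: "0 \<le> \<rho>" "\<rho> < R"
    and q: "q = (\<rho> / R) ^ N"
  shows "real N * ((1 - q) / (1 + q)) * Re (u 0) \<le> (\<Sum>j<N. Re (u (of_real \<rho> * unity_root N j)))"
proof -
  have R: "R > 0" using \<rho> by simp
  define c where "c k = (deriv ^^ k) u 0 / fact k" for k
  have S: "(\<lambda>k. c k * z ^ k) sums u z" if "z \<in> ball 0 R" for z
    using holomorphic_power_series[OF hol that] by (simp add: c_def)
  have U: "(\<lambda>m. (of_nat N * c (N * m)) * (z ^ N) ^ m) sums (\<Sum>j<N. u (z * unity_root N j))"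
    if z: "z \<in> ball 0 R" for z
  proof -
    have "(\<lambda>k. \<Sum>j<N. c k * (z * unity_root N j) ^ k) sums (\<Sum>j<N. u (z * unity_root N j))"
      by (intro sums_sum S) (use z in \<open>auto simp: norm_mult\<close>)
    moreover have "(\<Sum>j<N. c k * (z * unity_root N j) ^ k) =
        c k * z ^ k * (if N dvd k then of_nat N else 0)" for k
      by (simp only: sum_unity_root_powers[OF N, symmetric])
         (simp add: power_mult_distrib sum_distrib_left mult_ac)
    ultimately have *: "(\<lambda>k. c k * z ^ k * (if N dvd k then of_nat N else 0)) sums
        (\<Sum>j<N. u (z * unity_root N j))" by simp
    have "strict_mono (\<lambda>m. N * m)" using N by (simp add: strict_mono_def)
    from sums_mono_reindex[OF this, of "\<lambda>k. c k * z ^ k * (if N dvd k then of_nat N else 0)"] *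
    have "(\<lambda>m. c (N * m) * z ^ (N * m) * of_nat N) sums (\<Sum>j<N. u (z * unity_root N j))"
      by (auto simp: dvd_def image_iff)
    then show ?thesis by (simp add: power_mult mult.commute[of _ "of_nat N"] mult.assoc)
  qed
  \<comment> \<open>The rotation sum as a function of \<open>z ^ N\<close>. It is given by its power
    series because \<open>z ^ N\<close> has no single-valued inverse; every point of the larger disc
    has an \<open>N\<close>-th root in \<open>ball 0 R\<close>, which transfers convergence and
    positivity to \<open>V\<close>.\<close>
  define V where "V w = (\<Sum>m. (of_nat N * c (N * m)) * w ^ m)" for w
  have VU: "V (z ^ N) = (\<Sum>j<N. u (z * unity_root N j))" if "z \<in> ball 0 R" for z
    using sums_unique[OF U[OF that]] by (simp add: V_def)
  have root: "\<exists>z \<in> ball 0 R. z ^ N = w" if w: "w \<in> ball 0 (R ^ N)" for w :: complex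
  proof (cases "w = 0")
    case True
    then show ?thesis using R N by (intro bexI[of _ 0]) auto
  next
    case False
    define z where "z = exp (Ln w / of_nat N)"
    have "z ^ N = w" using False N by (simp add: z_def exp_of_nat_mult[symmetric])
    moreover from this have "cmod z ^ N < R ^ N" using w by (auto simp: norm_power[symmetric])
    then have "cmod z < R" using R by (meson power_less_imp_less_base less_eq_real_def)
    ultimately show ?thesis by auto
  qed
  have V: "(\<lambda>m. (of_nat N * c (N * m)) * w ^ m) sums V w" if "w \<in> ball 0 (R ^ N)" for w
    using root[OF that] U VU by metis
  have holV: "V holomorphic_on ball 0 (R ^ N)"
    by (rule power_series_holomorphic[where a = "\<lambda>m. of_nat N * c (N * m)"]) (use V in simp)
  have posV: "Re (V w) > 0" if w: "w \<in> ball 0 (R ^ N)" for w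
  proof -
    obtain z where z: "z \<in> ball 0 R" "z ^ N = w" using root[OF w] by blast
    have "(\<Sum>j<N. Re (u (z * unity_root N j))) > 0"
      by (intro sum_pos pos) (use z N in \<open>auto simp: norm_mult lessThan_empty_iff\<close>)
    then show ?thesis using VU[OF z(1)] z(2) by simp
  qed
  have V0: "V 0 = of_nat N * u 0" using VU[of 0] R N by (simp add: zero_power)
  have den: "V w + cnj (V 0) \<noteq> 0" if "w \<in> ball 0 (R ^ N)" for w
    using posV[OF that] posV[of 0] R by (metis Re_complex_of_real add.right_neutral add_pos_pos
        cnj.simps(1) mem_ball_0 norm_zero of_real_0 plus_complex.simps(1) zero_less_power less_irrefl)
  define \<phi> where "\<phi> x = (V (of_real (R ^ N) * x) - V 0) / (V (of_real (R ^ N) * x) + cnj (V 0))" for x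
  have scale: "of_real (R ^ N) * x \<in> ball 0 (R ^ N)" if "x \<in> ball 0 1" for x :: complex
    using that R by (simp add: norm_mult norm_power)
  have le: "cmod (\<phi> ((of_real (\<rho> / R)) ^ N)) \<le> cmod ((of_real (\<rho> / R)) ^ N)"
  proof (rule Schwarz_Lemma)
    have "(\<lambda>x. V (of_real (R ^ N) * x)) holomorphic_on ball 0 1"
      using holomorphic_on_compose_gen[OF _ holV, unfolded o_def, of "\<lambda>x. of_real (R ^ N) * x" "ball 0 1"]
        scale by (simp add: image_subset_iff holomorphic_intros)
    then show "\<phi> holomorphic_on ball 0 1" unfolding \<phi>_def
      using den scale by (auto intro!: holomorphic_intros simp del: mem_ball_0)
    show "\<phi> 0 = 0" by (simp add: \<phi>_def)
    show "cmod (\<phi> z) < 1" if "cmod z < 1" for z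
    proof -
      define v where "v = V (of_real (R ^ N) * z)"
      have v: "Re v > 0" "Re (V 0) > 0" using posV[OF scale[of z]] that posV[of 0] R by (auto simp: v_def)
      have "(cmod (v - V 0))\<^sup>2 < (cmod (v + cnj (V 0)))\<^sup>2"
        using mult_pos_pos[OF v] unfolding cmod_power2 by (simp add: power2_eq_square algebra_simps)
      then have "cmod (v - V 0) < cmod (v + cnj (V 0))" by (rule power2_less_imp_less) simp
      then show ?thesis unfolding \<phi>_def v_def[symmetric] by (simp add: norm_divide divide_less_eq)
    qed
    show "cmod ((of_real (\<rho> / R)) ^ N) < 1"
      using \<rho> R N by (auto simp: norm_power power_less_one_iff norm_divide)
  qed
  have q01: "0 \<le> q" "q < 1" using \<rho> R N by (auto simp: q power_less_one_iff)
  define v where "v = V (of_real \<rho> ^ N)"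
  have mem: "of_real \<rho> \<in> ball (0::complex) R" using \<rho> by simp
  have mem': "of_real \<rho> ^ N \<in> ball (0::complex) (R ^ N)"
    using \<rho> N by (auto simp: norm_power intro!: power_strict_mono)
  have "of_real (R ^ N) * (of_real (\<rho> / R)) ^ N = (of_real \<rho> ^ N :: complex)"
    using R by (simp add: power_divide)
  then have "cmod ((v - V 0) / (v + cnj (V 0))) \<le> q"
    using le \<rho> R by (simp add: \<phi>_def v_def q norm_power norm_divide)
  then have A: "cmod (v - V 0) \<le> q * cmod (v + cnj (V 0))"
    using den[OF mem'] by (simp add: norm_divide divide_le_eq v_def[symmetric])
  define a a0 where "a = Re v" and "a0 = Re (V 0)"
  have pos': "a > 0" "a0 > 0" using posV[OF mem'] posV[of 0] R by (auto simp: a_def a0_def v_def)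
  define b where "b = Im v - Im (V 0)"
  have "(cmod (v - V 0))\<^sup>2 \<le> q\<^sup>2 * (cmod (v + cnj (V 0)))\<^sup>2"
    using power_mono[OF A, of 2] by (simp add: power_mult_distrib)
  then have "(a - a0)\<^sup>2 + b\<^sup>2 \<le> q\<^sup>2 * ((a + a0)\<^sup>2 + b\<^sup>2)"
    by (simp add: cmod_power2 a_def a0_def b_def)
  moreover have "q\<^sup>2 * b\<^sup>2 \<le> 1 * b\<^sup>2"
    using q01 by (intro mult_right_mono) (auto simp: power_le_one)
  ultimately have "(a - a0)\<^sup>2 \<le> q\<^sup>2 * (a + a0)\<^sup>2" by (simp add: distrib_left)
  then have "(a - a0)\<^sup>2 \<le> (q * (a + a0))\<^sup>2" by (simp only: power_mult_distrib)
  then have "\<bar>a - a0\<bar> \<le> q * (a + a0)" using q01 pos' by (simp add: abs_le_square_iff[symmetric])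
  then have "a0 * (1 - q) \<le> a * (1 + q)" by (simp add: algebra_simps abs_le_iff)
  then have "((1 - q) / (1 + q)) * a0 \<le> a" using q01 by (simp add: field_simps)
  then show ?thesis using VU[OF mem] V0 by (simp add: a_def a0_def v_def mult_ac)
qed

text \<open>A function without zeros on the disc has a holomorphic logarithm, so
  \<open>ln S - ln (cmod (f z))\<close> is the positive real part of a holomorphic function and
  Harnack applies. As \<open>q\<close> tends to 0 the bound becomes the mean value property at
  \<open>N\<close> points; \<open>ln S\<close> enters only with the small weight
  \<open>2 * q / (1 + q)\<close>.\<close>

lemma sum_ln_unity_roots_le:
  assumes hol: "f holomorphic_on ball 0 R"
    and nz: "\<And>z. z \<in> ball 0 R \<Longrightarrow> f z \<noteq> 0"
    and bd: "\<And>z. z \<in> ball 0 R \<Longrightarrow> cmod (f z) < S"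
    and N: "N > 0" and \<rho>: "0 \<le> \<rho>" "\<rho> < R"
    and q: "q = (\<rho> / R) ^ N"
  shows "(\<Sum>j<N. ln (cmod (f (of_real \<rho> * unity_root N j))))
     \<le> real N * (2 * q / (1 + q) * ln S + (1 - q) / (1 + q) * ln (cmod (f 0)))"
proof -
  have R: "R > 0" using \<rho> by simp
  have S: "S > 0" using bd[of 0] R by (simp add: le_less_trans[OF norm_ge_zero])
  obtain g where g: "g holomorphic_on ball 0 R" "\<And>x. x \<in> ball 0 R \<Longrightarrow> exp (g x) = f x"
    using holomorphic_logarithm_exists[of "ball 0 R" f 0] hol nz R by auto
  have Reg: "Re (g z) = ln (cmod (f z))" if "z \<in> ball 0 R" for z
    using g(2)[OF that] by (metis ln_exp norm_exp_eq_Re)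
  have "real N * ((1 - q) / (1 + q)) * Re (of_real (ln S) - g 0)
     \<le> (\<Sum>j<N. Re (of_real (ln S) - g (of_real \<rho> * unity_root N j)))"
  proof (rule harnack_unity_roots[where u = "\<lambda>z. of_real (ln S) - g z", OF _ _ N \<rho> q])
    show "(\<lambda>z. of_real (ln S) - g z) holomorphic_on ball 0 R" by (intro holomorphic_intros g)
    show "0 < Re (of_real (ln S) - g z)" if "z \<in> ball 0 R" for z
      using bd[OF that] nz[OF that] S by (simp add: Reg[OF that])
  qed
  also have "Re (g 0) = ln (cmod (f 0))" using Reg[of 0] R by simp
  then have "Re (of_real (ln S) - g 0) = ln S - ln (cmod (f 0))" by simp
  also have "(\<Sum>j<N. Re (of_real (ln S) - g (of_real \<rho> * unity_root N j))) =
      real N * ln S - (\<Sum>j<N. ln (cmod (f (of_real \<rho> * unity_root N j))))"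
    using \<rho> by (simp add: Reg norm_mult sum_subtractf)
  finally have "(\<Sum>j<N. ln (cmod (f (of_real \<rho> * unity_root N j))))
     \<le> real N * ln S - real N * ((1 - q) / (1 + q)) * (ln S - ln (cmod (f 0)))" by simp
  also have "\<dots> = real N * (2 * q / (1 + q) * ln S + (1 - q) / (1 + q) * ln (cmod (f 0)))"
  proof -
    have q1: "1 + q > 0" using \<rho> R by (simp add: q add_pos_nonneg)
    have *: "2 * q / (1 + q) = 1 - (1 - q) / (1 + q)" using q1 by (simp add: field_simps)
    show ?thesis unfolding * by (simp only: algebra_simps)
  qed
  finally show ?thesis .
qed

text \<open>The product is the modulus of the derivative of \<open>X ^ N - 1\<close> at one of its
  roots, that is, of \<open>N\<close> times a number of modulus 1.\<close>

lemma prod_cmod_unity_root_diff: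
  assumes N: "N > 0" and i: "i < N"
  shows "(\<Prod>j\<in>{..<N} - {i}. cmod (unity_root N i - unity_root N j)) = real N"
proof -
  let ?w = "unity_root N"
  define p where "p = (\<Prod>j<N. [:- ?w j, 1:])"
  define m where "m = monom 1 N - (1 :: complex poly)"
  have inj: "inj_on ?w {..<N}" and im: "?w ` {..<N} = {z. z ^ N = 1}"
    using unity_root_powers[OF N] by (auto simp: bij_betw_def)
  have "p = m"
  proof (rule ccontr)
    assume "p \<noteq> m"
    have "lead_coeff p = 1" unfolding p_def by (subst lead_coeff_prod) simp
    moreover have "degree p = N" by (simp add: p_def degree_prod_eq_sum_degree)
    ultimately have dp: "degree p = N" "coeff p N = 1" by auto
    have dm: "degree m = N" "coeff m N = 1"
    proof -
      show "coeff m N = 1" using N by (simp add: m_def)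
      have "degree (- (1::complex poly)) < degree (monom (1::complex) N)" using N by (simp add: degree_monom_eq)
      from degree_add_eq_left[OF this] show "degree m = N" by (simp add: m_def degree_monom_eq)
    qed
    \<comment> \<open>Both polynomials are monic of degree \<open>N\<close>, so the leading terms
      cancel. A nonzero difference of smaller degree could not vanish at all \<open>N\<close> roots
      of unity.\<close>
    have "degree (p - m) < N"
    proof (rule ccontr)
      assume "\<not> degree (p - m) < N"
      moreover have "degree (p - m) \<le> N" using dp dm by (intro degree_diff_le) auto
      ultimately have "degree (p - m) = N" by simp
      then have "lead_coeff (p - m) = 0" using dp dm by simp
      then have "p - m = 0" by (simp only: leading_coeff_0_iff)
      then show False using \<open>p \<noteq> m\<close> by simp
    qed
    moreover have "N \<le> card {z. poly (p - m) z = 0}"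
    proof -
      have "{z. z ^ N = 1} \<subseteq> {z. poly (p - m) z = 0}"
        unfolding im[symmetric] using unity_root_power_N[OF N]
        by (auto simp: p_def m_def poly_prod poly_monom)
      then show ?thesis
        using card_mono[of "{z. poly (p - m) z = 0}" "?w ` {..<N}"] poly_roots_finite[of "p - m"]
          \<open>p \<noteq> m\<close> im card_image[OF inj] by auto
    qed
    moreover have "card {z. poly (p - m) z = 0} \<le> degree (p - m)"
      using \<open>p \<noteq> m\<close> by (intro card_poly_roots_bound) simp
    ultimately show False by simp
  qed
  then have "poly (pderiv p) (?w i) = of_nat N * ?w i ^ (N - 1)"
    by (simp add: m_def pderiv_diff pderiv_monom poly_monom)
  moreover have "poly (pderiv p) (?w i) = (\<Prod>j\<in>{..<N} - {i}. ?w i - ?w j)"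
  proof -
    define s where "s = (\<Prod>j\<in>{..<N} - {i}. [:- ?w j, 1:])"
    have p: "p = [:- ?w i, 1:] * s"
      unfolding p_def s_def using i by (subst prod.remove[of _ i]) auto
    have "poly (pderiv p) (?w i) = poly (\<Prod>j\<in>{..<N} - {i}. [:- ?w j, 1:]) (?w i)"
      unfolding p pderiv_mult by (simp add: pderiv_pCons s_def)
    then show ?thesis by (simp add: poly_prod)
  qed
  ultimately have "cmod (\<Prod>j\<in>{..<N} - {i}. ?w i - ?w j) = real N"
    by (simp add: norm_mult norm_power)
  then show ?thesis by (simp add: prod_norm)
qed

section \<open>Change of variables from coefficients to values\<close>

text \<open>Lebesgue measure is determined by its values on boxes, and a complex box is a product of
  two intervals. This opens complex integrals to Fubini.\<close>

lemma lborel_complex_eq_distr: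
  "(lborel :: complex measure) = distr (lborel \<Otimes>\<^sub>M lborel) borel (\<lambda>(x, y). Complex x y)"
proof (rule lborel_eqI)
  have [measurable]: "(\<lambda>(x, y). Complex x y) \<in> borel_measurable (lborel \<Otimes>\<^sub>M lborel)"
    unfolding Complex_eq by measurable
  fix l u :: complex
  assume "\<And>b. b \<in> Basis \<Longrightarrow> l \<bullet> b \<le> u \<bullet> b"
  then have le: "Re l \<le> Re u" "Im l \<le> Im u" by (force simp: Basis_complex_def inner_complex_def)+
  have "(\<lambda>(x, y). Complex x y) -` box l u \<inter> space (lborel \<Otimes>\<^sub>M lborel) = {Re l<..<Re u} \<times> {Im l<..<Im u}"
    by (auto simp: space_pair_measure in_box_complex_iff)
  then show "emeasure (distr (lborel \<Otimes>\<^sub>M lborel) borel (\<lambda>(x, y). Complex x y)) (box l u) =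
      ennreal (\<Prod>b\<in>Basis. (u - l) \<bullet> b)"
    using le by (simp add: emeasure_distr lborel_pair.emeasure_pair_measure_Times
        lborel.emeasure_pair_measure_Times Basis_complex_def inner_complex_def ennreal_mult)
qed simp

lemma nn_integral_lborel_complex:
  assumes [measurable]: "f \<in> borel_measurable (borel :: complex measure)"
  shows "(\<integral>\<^sup>+w. f w \<partial>lborel) = (\<integral>\<^sup>+x. \<integral>\<^sup>+y. f (Complex x y) \<partial>lborel \<partial>lborel)"
proof -
  have [measurable]: "(\<lambda>(x, y). Complex x y) \<in> borel_measurable (lborel \<Otimes>\<^sub>M lborel)"
    unfolding Complex_eq by measurable
  have "(\<integral>\<^sup>+w. f w \<partial>lborel) = (\<integral>\<^sup>+p. f (case p of (x, y) \<Rightarrow> Complex x y) \<partial>(lborel \<Otimes>\<^sub>M lborel))"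
    by (subst lborel_complex_eq_distr) (simp add: nn_integral_distr)
  also have "\<dots> = (\<integral>\<^sup>+x. \<integral>\<^sup>+y. f (Complex x y) \<partial>lborel \<partial>lborel)"
    by (subst lborel.nn_integral_fst[symmetric]) auto
  finally show ?thesis .
qed

lemma nn_integral_lborel_translate:
  fixes t :: "'a :: euclidean_space"
  assumes [measurable]: "f \<in> borel_measurable borel"
  shows "(\<integral>\<^sup>+w. f (t + w) \<partial>lborel) = (\<integral>\<^sup>+w. f w \<partial>lborel)"
  by (subst (2) lborel_distr_plus[of t, symmetric]) (simp add: nn_integral_distr)

text \<open>A complex multiplication factors into real affine substitutions in single coordinates.\<close>

lemma nn_integral_lborel_complex_mult:
  assumes [measurable]: "f \<in> borel_measurable (borel :: complex measure)" and c: "c \<noteq> 0"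
  shows "ennreal ((cmod c)\<^sup>2) * (\<integral>\<^sup>+w. f (c * w) \<partial>lborel) = (\<integral>\<^sup>+w. f w \<partial>lborel)"
proof -
  define a b where "a = Re c" and "b = Im c"
  have [measurable]: "(\<lambda>p. Complex (g p) (h p)) \<in> borel_measurable M"
    if "g \<in> borel_measurable M" "h \<in> borel_measurable M" for g h and M :: "'b measure"
    unfolding Complex_eq using that by measurable
  have n: "(cmod c)\<^sup>2 = a\<^sup>2 + b\<^sup>2" by (simp add: cmod_power2 a_def b_def)
  have mult: "c * Complex x y = Complex (a * x - b * y) (b * x + a * y)" for x y
    by (simp add: complex_eq_iff a_def b_def)
  have I: "(\<integral>\<^sup>+w. f (c * w) \<partial>lborel) =
      (\<integral>\<^sup>+x. \<integral>\<^sup>+y. f (Complex (a * x - b * y) (b * x + a * y)) \<partial>lborel \<partial>lborel)"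
    by (subst nn_integral_lborel_complex) (simp_all add: mult)
  show ?thesis
  proof (cases "a = 0")
    case False
    \<comment> \<open>With \<open>x' = a * x - b * y\<close> the second coordinate of the product is
      \<open>b / a * x' + (a\<^sup>2 + b\<^sup>2) / a * y\<close>. So the multiplication is a change
      of the first coordinate with factor \<open>a\<close> and one of the second with factor
      \<open>(a\<^sup>2 + b\<^sup>2) / a\<close>. This needs a nonzero \<open>a\<close>; otherwise
      the multiplication is a swap with scalings.\<close>
    have *: "(\<integral>\<^sup>+x. f (Complex x (b / a * x + (a\<^sup>2 + b\<^sup>2) / a * y)) \<partial>lborel) =
        \<bar>a\<bar> * (\<integral>\<^sup>+x. f (Complex (a * x - b * y) (b * x + a * y)) \<partial>lborel)" for y
    proof -
      have "- (b * y) + a * x = a * x - b * y" "b / a * (- (b * y) + a * x) + (a\<^sup>2 + b\<^sup>2) / a * y = b * x + a * y" for x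
        using False by (simp_all add: field_simps power2_eq_square)
      then show ?thesis by (subst nn_integral_real_affine[OF _ False, of _ "- (b * y)"]) simp_all
    qed
    have d: "(a\<^sup>2 + b\<^sup>2) / a \<noteq> 0" using False by (simp add: sum_power2_eq_zero_iff)
    have "(\<integral>\<^sup>+w. f w \<partial>lborel) = (\<integral>\<^sup>+x. \<integral>\<^sup>+y. f (Complex x y) \<partial>lborel \<partial>lborel)"
      by (rule nn_integral_lborel_complex) simp
    also have "\<dots> = (\<integral>\<^sup>+x. \<bar>(a\<^sup>2 + b\<^sup>2) / a\<bar> * (\<integral>\<^sup>+y. f (Complex x (b / a * x + (a\<^sup>2 + b\<^sup>2) / a * y)) \<partial>lborel) \<partial>lborel)"
      using nn_integral_real_affine[OF _ d, of "\<lambda>y. f (Complex _ y)"] by (intro nn_integral_cong) simp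
    also have "\<dots> = \<bar>(a\<^sup>2 + b\<^sup>2) / a\<bar> * (\<integral>\<^sup>+x. \<integral>\<^sup>+y. f (Complex x (b / a * x + (a\<^sup>2 + b\<^sup>2) / a * y)) \<partial>lborel \<partial>lborel)"
      by (rule nn_integral_cmult) simp
    also have "(\<integral>\<^sup>+x. \<integral>\<^sup>+y. f (Complex x (b / a * x + (a\<^sup>2 + b\<^sup>2) / a * y)) \<partial>lborel \<partial>lborel) =
       (\<integral>\<^sup>+y. \<integral>\<^sup>+x. f (Complex x (b / a * x + (a\<^sup>2 + b\<^sup>2) / a * y)) \<partial>lborel \<partial>lborel)"
      by (rule lborel_pair.Fubini') simp
    also have "\<dots> = \<bar>a\<bar> * (\<integral>\<^sup>+y. \<integral>\<^sup>+x. f (Complex (a * x - b * y) (b * x + a * y)) \<partial>lborel \<partial>lborel)"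
      unfolding * by (rule nn_integral_cmult) simp
    also have "(\<integral>\<^sup>+y. \<integral>\<^sup>+x. f (Complex (a * x - b * y) (b * x + a * y)) \<partial>lborel \<partial>lborel) =
        (\<integral>\<^sup>+w. f (c * w) \<partial>lborel)"
      unfolding I by (rule lborel_pair.Fubini') simp
    finally have "(\<integral>\<^sup>+w. f w \<partial>lborel) = ennreal (\<bar>(a\<^sup>2 + b\<^sup>2) / a\<bar> * \<bar>a\<bar>) * (\<integral>\<^sup>+w. f (c * w) \<partial>lborel)"
      by (simp only: ennreal_mult abs_ge_zero mult.assoc)
    also have "\<bar>(a\<^sup>2 + b\<^sup>2) / a\<bar> * \<bar>a\<bar> = (cmod c)\<^sup>2" using False by (simp add: n abs_divide)
    finally show ?thesis by (rule sym)
  next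
    case True
    then have b: "b \<noteq> 0" "- b \<noteq> 0" using c by (auto simp: a_def b_def complex_eq_iff)
    have "(\<integral>\<^sup>+w. f w \<partial>lborel) = (\<integral>\<^sup>+x. \<integral>\<^sup>+y. f (Complex x y) \<partial>lborel \<partial>lborel)"
      by (rule nn_integral_lborel_complex) simp
    also have "\<dots> = \<bar>b\<bar> * (\<integral>\<^sup>+x. \<integral>\<^sup>+y. f (Complex x (b * y)) \<partial>lborel \<partial>lborel)"
      by (subst nn_integral_real_affine[OF _ b(1), of _ 0]) (simp_all add: nn_integral_cmult)
    also have "\<dots> = \<bar>b\<bar> * (\<bar>- b\<bar> * (\<integral>\<^sup>+x. \<integral>\<^sup>+y. f (Complex (- b * x) (b * y)) \<partial>lborel \<partial>lborel))"
      by (subst nn_integral_real_affine[OF _ b(2), of _ 0]) (simp_all add: nn_integral_cmult)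
    also have "(\<integral>\<^sup>+x. \<integral>\<^sup>+y. f (Complex (- b * x) (b * y)) \<partial>lborel \<partial>lborel) = (\<integral>\<^sup>+w. f (c * w) \<partial>lborel)"
      unfolding I using True by (subst lborel_pair.Fubini') simp_all
    finally have "(\<integral>\<^sup>+w. f w \<partial>lborel) = ennreal (\<bar>b\<bar> * \<bar>b\<bar>) * (\<integral>\<^sup>+w. f (c * w) \<partial>lborel)"
      by (simp only: ennreal_mult abs_ge_zero abs_minus_cancel mult.assoc)
    also have "\<bar>b\<bar> * \<bar>b\<bar> = (cmod c)\<^sup>2" using True by (simp only: n) (simp add: power2_eq_square)
    finally show ?thesis by (rule sym)
  qed
qed

lemma nn_integral_lborel_complex_affine:
  assumes [measurable]: "f \<in> borel_measurable (borel :: complex measure)" and c: "c \<noteq> 0"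
  shows "ennreal ((cmod c)\<^sup>2) * (\<integral>\<^sup>+w. f (t + c * w) \<partial>lborel) = (\<integral>\<^sup>+w. f w \<partial>lborel)"
  using nn_integral_lborel_complex_mult[OF _ c, of "\<lambda>w. f (t + w)"]
  by (simp add: nn_integral_lborel_translate)

section \<open>Iterated substitutions in several complex variables\<close>

interpretation lborel_pow: product_sigma_finite "\<lambda>_ :: nat. lborel :: complex measure"
  by standard

abbreviation lborel_power :: "nat \<Rightarrow> (nat \<Rightarrow> complex) measure" where
  "lborel_power N \<equiv> Pi\<^sub>M {..<N} (\<lambda>_. lborel)"

lemma nn_integral_lborel_power_Suc:
  assumes "f \<in> borel_measurable (lborel_power (Suc N))"
  shows "(\<integral>\<^sup>+x. f x \<partial>lborel_power (Suc N)) = (\<integral>\<^sup>+x. \<integral>\<^sup>+y. f (x(N := y)) \<partial>lborel \<partial>lborel_power N)"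
    and "(\<integral>\<^sup>+x. f x \<partial>lborel_power (Suc N)) = (\<integral>\<^sup>+y. \<integral>\<^sup>+x. f (x(N := y)) \<partial>lborel_power N \<partial>lborel)"
  using lborel_pow.product_nn_integral_insert[of "{..<N}" N f]
    lborel_pow.product_nn_integral_insert_rev[of "{..<N}" N f] assms
  by (simp_all add: lessThan_Suc)

lemma measurable_lborel_power_upd:
  "(\<lambda>(x, y). x(N := y)) \<in> lborel_power N \<Otimes>\<^sub>M lborel \<rightarrow>\<^sub>M lborel_power (Suc N)"
  using measurable_add_dim[of N "{..<N}" "\<lambda>_. lborel"] by (simp add: lessThan_Suc)

text \<open>Since \<open>g k\<close> sees only coordinates below \<open>k\<close>, it is a constant
  translation when coordinate \<open>k\<close> is integrated out, last coordinate first. Only the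
  diagonal contributes to the Jacobian, and \<open>g k\<close> need be no more than
  measurable.\<close>

lemma nn_integral_triangular:
  fixes \<alpha> :: "nat \<Rightarrow> complex" and g :: "nat \<Rightarrow> (nat \<Rightarrow> complex) \<Rightarrow> complex"
  assumes "\<And>k. k < N \<Longrightarrow> \<alpha> k \<noteq> 0"
    and "\<And>k. k < N \<Longrightarrow> g k \<in> borel_measurable (lborel_power k)"
    and "\<Psi> \<in> borel_measurable (lborel_power N)"
  shows "(\<Prod>k<N. ennreal ((cmod (\<alpha> k))\<^sup>2)) *
      (\<integral>\<^sup>+x. \<Psi> (\<lambda>k\<in>{..<N}. g k (restrict x {..<k}) + \<alpha> k * x k) \<partial>lborel_power N) =
      (\<integral>\<^sup>+x. \<Psi> x \<partial>lborel_power N)"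
  using assms
proof (induction N arbitrary: \<Psi>)
  case 0
  then show ?case by (simp add: PiM_empty nn_integral_count_space_finite restrict_def)
next
  case (Suc N)
  note [measurable] = Suc.prems(3)
  have [measurable]: "g N \<in> borel_measurable (lborel_power N)" using Suc.prems(2) by simp
  define T where "T n x = (\<lambda>k\<in>{..<n}. g k (restrict x {..<k}) + \<alpha> k * x k)" for n x
  have T[measurable]: "T n \<in> lborel_power n \<rightarrow>\<^sub>M lborel_power n" if n: "n \<le> Suc N" for n
    unfolding T_def
  proof (rule measurable_restrict)
    fix k assume k: "k \<in> {..<n}"
    have "(\<lambda>x. restrict x {..<k}) \<in> lborel_power n \<rightarrow>\<^sub>M lborel_power k"
      using k by (intro measurable_restrict_subset) auto
    then have "(\<lambda>x. g k (restrict x {..<k})) \<in> borel_measurable (lborel_power n)"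
      using Suc.prems(2)[of k] k n by (auto intro: measurable_compose)
    moreover have "(\<lambda>x. x k) \<in> borel_measurable (lborel_power n)"
      using measurable_component_singleton[of k "{..<n}" "\<lambda>_. lborel"] k by simp
    ultimately show "(\<lambda>x. g k (restrict x {..<k}) + \<alpha> k * x k) \<in> lborel_power n \<rightarrow>\<^sub>M lborel"
      by simp
  qed
  note [measurable] = measurable_lborel_power_upd
  have TN: "T (Suc N) (x(N := y)) = (T N x)(N := g N (restrict x {..<N}) + \<alpha> N * y)" for x y
    by (auto simp: T_def fun_eq_iff restrict_def intro!: arg_cong2[where f = "(+)"] arg_cong[of _ _ "g _"])
  define \<Psi>' where "\<Psi>' x = (\<integral>\<^sup>+y. \<Psi> (x(N := y)) \<partial>lborel)" for x
  have M2: "(\<lambda>(x, y). \<Psi> (x(N := y))) \<in> borel_measurable (lborel_power N \<Otimes>\<^sub>M lborel)"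
    using measurable_compose[OF measurable_lborel_power_upd Suc.prems(3)] by (simp add: case_prod_unfold)
  have \<Psi>': "\<Psi>' \<in> borel_measurable (lborel_power N)"
    unfolding \<Psi>'_def using M2 by (rule lborel.borel_measurable_nn_integral)
  have inner: "ennreal ((cmod (\<alpha> N))\<^sup>2) * (\<integral>\<^sup>+y. \<Psi> (T (Suc N) (x(N := y))) \<partial>lborel) = \<Psi>' (T N x)"
    if x: "x \<in> space (lborel_power N)" for x
  proof -
    have "T N x \<in> space (lborel_power N)" using measurable_space[OF T x] by simp
    then have "(\<lambda>y. \<Psi> ((T N x)(N := y))) \<in> borel_measurable borel"
      using measurable_Pair2[OF M2, of "T N x"] by simp
    from nn_integral_lborel_complex_affine[OF this, of "\<alpha> N" "g N (restrict x {..<N})"]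
    show ?thesis using Suc.prems(1)[of N] by (simp add: \<Psi>'_def TN)
  qed
  have meas: "(\<lambda>x. \<Psi> (T (Suc N) x)) \<in> borel_measurable (lborel_power (Suc N))"
    using T[of "Suc N"] by simp
  have meas': "(\<lambda>x. \<integral>\<^sup>+y. \<Psi> (T (Suc N) (x(N := y))) \<partial>lborel) \<in> borel_measurable (lborel_power N)"
    using measurable_compose[OF measurable_lborel_power_upd meas]
    by (intro lborel.borel_measurable_nn_integral) (simp add: case_prod_unfold)
  have "(\<Prod>k<Suc N. ennreal ((cmod (\<alpha> k))\<^sup>2)) * (\<integral>\<^sup>+x. \<Psi> (T (Suc N) x) \<partial>lborel_power (Suc N)) =
     (\<Prod>k<N. ennreal ((cmod (\<alpha> k))\<^sup>2)) * (\<integral>\<^sup>+x. ennreal ((cmod (\<alpha> N))\<^sup>2) *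
        (\<integral>\<^sup>+y. \<Psi> (T (Suc N) (x(N := y))) \<partial>lborel) \<partial>lborel_power N)"
    unfolding nn_integral_cmult[OF meas'] by (subst nn_integral_lborel_power_Suc(1)[OF meas]) (simp add: mult.assoc)
  also have "\<dots> = (\<Prod>k<N. ennreal ((cmod (\<alpha> k))\<^sup>2)) * (\<integral>\<^sup>+x. \<Psi>' (T N x) \<partial>lborel_power N)"
    by (simp cong: nn_integral_cong_simp add: inner)
  also have "\<dots> = (\<integral>\<^sup>+x. \<Psi>' x \<partial>lborel_power N)"
    unfolding T_def by (rule Suc.IH) (use Suc.prems \<Psi>' in auto)
  also have "\<dots> = (\<integral>\<^sup>+x. \<Psi> x \<partial>lborel_power (Suc N))"
    unfolding \<Psi>'_def by (rule nn_integral_lborel_power_Suc(1)[symmetric]) simp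
  finally show ?case unfolding T_def .
qed


text \<open>Division of a polynomial by \<open>X - t\<close> with its value at \<open>t\<close> as
  remainder; the quotient has Horner's partial sums as coefficients. Coefficients are listed from
  the highest degree, so that the \<open>k\<close>-th quotient coefficient is \<open>c k\<close>
  plus a combination of earlier ones.\<close>

lemma horner_shift:
  fixes c :: "nat \<Rightarrow> complex"
  shows "(\<Sum>n<Suc N. c n * x ^ (N - n)) - (\<Sum>n<Suc N. c n * t ^ (N - n)) =
    (x - t) * (\<Sum>k<N. (\<Sum>i\<le>k. c i * t ^ (k - i)) * x ^ (N - 1 - k))"
proof -
  have *: "x ^ (N - n) - t ^ (N - n) = (x - t) * (\<Sum>k\<in>{n..<N}. t ^ (k - n) * x ^ (N - 1 - k))"
    if "n < N" for n
  proof -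
    have "(\<Sum>k\<in>{n..<N}. t ^ (k - n) * x ^ (N - 1 - k)) =
        (\<Sum>i<N - n. t ^ (N - n - Suc i) * x ^ i)"
      by (rule sum.reindex_bij_witness[of _ "\<lambda>i. N - 1 - i" "\<lambda>k. N - 1 - k"])
         (use that in \<open>auto simp: algebra_simps intro!: arg_cong2[where f = "(*)"] arg_cong[of _ _ "power _"]\<close>)
    then show ?thesis by (simp add: power_diff_sumr2)
  qed
  have "(\<Sum>n<Suc N. c n * x ^ (N - n)) - (\<Sum>n<Suc N. c n * t ^ (N - n)) =
      (\<Sum>n<N. c n * (x ^ (N - n) - t ^ (N - n)))"
    by (simp add: sum_subtractf right_diff_distrib)
  also have "\<dots> = (\<Sum>n<N. c n * ((x - t) * (\<Sum>k\<in>{n..<N}. t ^ (k - n) * x ^ (N - 1 - k))))"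
    by (intro sum.cong refl) (simp add: *)
  also have "\<dots> = (x - t) * (\<Sum>n<N. \<Sum>k\<in>{n..<N}. c n * t ^ (k - n) * x ^ (N - 1 - k))"
    by (simp add: sum_distrib_left mult_ac)
  also have "(\<Sum>n<N. \<Sum>k\<in>{n..<N}. c n * t ^ (k - n) * x ^ (N - 1 - k)) =
      (\<Sum>k<N. \<Sum>n\<le>k. c n * t ^ (k - n) * x ^ (N - 1 - k))"
    unfolding sum.Sigma[of "{..<N}" "\<lambda>n. {n..<N}", simplified] sum.Sigma[of "{..<N}" "\<lambda>n. {..n}", simplified]
    by (rule sum.reindex_bij_witness[of _ "\<lambda>(k, n). (n, k)" "\<lambda>(n, k). (k, n)"]) auto
  finally show ?thesis by (simp add: sum_distrib_right)
qed

lemma measurable_lborel_power_component: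
  "k < N \<Longrightarrow> (\<lambda>x. x k) \<in> borel_measurable (lborel_power N)"
  using measurable_component_singleton[of k "{..<N}" "\<lambda>_. lborel :: complex measure"] by simp

text \<open>Dividing the polynomial by \<open>X - x N\<close> is a unitriangular substitution of its coefficients, and the
  remainder is its value at \<open>x N\<close>; integrating out that value leaves one point less.\<close>

lemma nn_integral_vandermonde:
  assumes "inj_on x {..<N}"
    and "\<And>j. j < N \<Longrightarrow> \<phi> j \<in> borel_measurable (borel :: complex measure)"
  shows "(\<Prod>i<N. \<Prod>j<i. ennreal ((cmod (x j - x i))\<^sup>2)) *
      (\<integral>\<^sup>+c. (\<Prod>j<N. \<phi> j (\<Sum>n<N. c n * x j ^ (N - 1 - n))) \<partial>lborel_power N) =
      (\<Prod>j<N. \<integral>\<^sup>+w. \<phi> j w \<partial>lborel)"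
  using assms
proof (induction N arbitrary: \<phi>)
  case 0
  then show ?case by (simp add: PiM_empty nn_integral_count_space_finite)
next
  case (Suc N)
  note [measurable] = Suc.prems(2) measurable_lborel_power_component measurable_lborel_power_upd
  define Q where "Q j c = (\<Sum>k<N. (\<Sum>i\<le>k. c i * x N ^ (k - i)) * x j ^ (N - 1 - k))" for j and c :: "nat \<Rightarrow> complex"
  have Q: "Q j (c(N := y)) = Q j c" for j c y
    by (auto simp: Q_def intro!: sum.cong)
  have Qm[measurable]: "Q j \<in> borel_measurable (lborel_power n)" if "N \<le> n" for j n
    unfolding Q_def using that
    by (intro borel_measurable_sum borel_measurable_times measurable_lborel_power_component) auto
  have id: "(\<Sum>n<Suc N. c n * x j ^ (N - n)) = (\<Sum>n<Suc N. c n * x N ^ (N - n)) + (x j - x N) * Q j c" for j c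
    using horner_shift[where c = c and N = N and x = "x j" and t = "x N"] by (simp add: Q_def algebra_simps)
  let ?F = "\<lambda>c. \<Prod>j<Suc N. \<phi> j (\<Sum>n<Suc N. c n * x j ^ (Suc N - 1 - n))"
  let ?H = "\<lambda>c. \<Prod>j<Suc N. \<phi> j (c N + (x j - x N) * Q j c)"
  have Fm: "?F \<in> borel_measurable (lborel_power (Suc N))"
    by (intro borel_measurable_prod_ennreal measurable_compose[OF _ Suc.prems(2)]) auto
  have Hm: "?H \<in> borel_measurable (lborel_power (Suc N))"
    by (intro borel_measurable_prod_ennreal measurable_compose[OF _ Suc.prems(2)]) auto
  have "(\<integral>\<^sup>+c. ?F c \<partial>lborel_power (Suc N)) = (\<integral>\<^sup>+c. \<integral>\<^sup>+y. ?F (c(N := y)) \<partial>lborel \<partial>lborel_power N)"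
    by (rule nn_integral_lborel_power_Suc(1)[OF Fm])
  also have "\<dots> = (\<integral>\<^sup>+c. \<integral>\<^sup>+y. ?H (c(N := y)) \<partial>lborel \<partial>lborel_power N)"
  proof (rule nn_integral_cong)
    fix c
    define s where "s = (\<Sum>n<N. c n * x N ^ (N - n))"
    have "(\<integral>\<^sup>+y. ?F (c(N := y)) \<partial>lborel) = (\<integral>\<^sup>+y. (\<Prod>j<Suc N. \<phi> j (s + y + (x j - x N) * Q j c)) \<partial>lborel)"
    proof (rule nn_integral_cong, rule prod.cong[OF refl])
      fix y j
      have "(\<Sum>n<Suc N. (c(N := y)) n * x j ^ (Suc N - 1 - n)) = s + y + (x j - x N) * Q j c"
        using id[where c = "c(N := y)" and j = j] by (simp add: s_def Q)
      then show "\<phi> j (\<Sum>n<Suc N. (c(N := y)) n * x j ^ (Suc N - 1 - n)) = \<phi> j (s + y + (x j - x N) * Q j c)"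
        by (simp only:)
    qed
    \<comment> \<open>The constant coefficient \<open>y\<close> enters only through the value
      \<open>s + y\<close> at \<open>x N\<close>, so a translation makes that value the variable of
      integration.\<close>
    also have "\<dots> = (\<integral>\<^sup>+y. (\<Prod>j<Suc N. \<phi> j (y + (x j - x N) * Q j c)) \<partial>lborel)"
      by (rule nn_integral_lborel_translate[where f = "\<lambda>y. \<Prod>j<Suc N. \<phi> j (y + (x j - x N) * Q j c)"])
         (intro borel_measurable_prod_ennreal measurable_compose[OF _ Suc.prems(2)], auto)
    finally show "(\<integral>\<^sup>+y. ?F (c(N := y)) \<partial>lborel) = (\<integral>\<^sup>+y. ?H (c(N := y)) \<partial>lborel)" by (simp add: Q)
  qed
  also have "\<dots> = (\<integral>\<^sup>+y. \<integral>\<^sup>+c. ?H (c(N := y)) \<partial>lborel_power N \<partial>lborel)"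
    using nn_integral_lborel_power_Suc[OF Hm] by simp
  also have "\<dots> = (\<integral>\<^sup>+y. \<phi> N y * (\<integral>\<^sup>+c. (\<Prod>j<N. \<phi> j (y + (x j - x N) * (\<Sum>k<N. c k * x j ^ (N - 1 - k)))) \<partial>lborel_power N) \<partial>lborel)"
  proof (rule nn_integral_cong)
    fix y
    let ?\<Psi> = "\<lambda>c. \<Prod>j<N. \<phi> j (y + (x j - x N) * (\<Sum>k<N. c k * x j ^ (N - 1 - k)))"
    have \<Psi>: "?\<Psi> \<in> borel_measurable (lborel_power N)"
      by (intro borel_measurable_prod_ennreal measurable_compose[OF _ Suc.prems(2)]) auto
    have "(\<integral>\<^sup>+c. ?H (c(N := y)) \<partial>lborel_power N) =
        (\<integral>\<^sup>+c. \<phi> N y * (\<Prod>j<N. \<phi> j (y + (x j - x N) * Q j c)) \<partial>lborel_power N)"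
      by (simp add: Q mult.commute)
    also have "\<dots> = \<phi> N y * (\<integral>\<^sup>+c. (\<Prod>j<N. \<phi> j (y + (x j - x N) * Q j c)) \<partial>lborel_power N)"
      by (intro nn_integral_cmult borel_measurable_prod_ennreal measurable_compose[OF _ Suc.prems(2)]) auto
    \<comment> \<open>Passing from the coefficients to those of the quotient is unitriangular, hence
      preserves the integral.\<close>
    also have "(\<integral>\<^sup>+c. (\<Prod>j<N. \<phi> j (y + (x j - x N) * Q j c)) \<partial>lborel_power N) =
       (\<integral>\<^sup>+c. ?\<Psi> (\<lambda>k\<in>{..<N}. (\<Sum>i<k. restrict c {..<k} i * x N ^ (k - i)) + 1 * c k) \<partial>lborel_power N)"
      unfolding Q_def
      by (intro nn_integral_cong prod.cong refl arg_cong[of _ _ "\<phi> _"] arg_cong2[where f = "(+)"]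
          arg_cong2[where f = "(*)"] sum.cong)
         (auto simp: lessThan_Suc_atMost[symmetric] intro!: sum.cong)
    also have "\<dots> = (\<integral>\<^sup>+c. ?\<Psi> c \<partial>lborel_power N)"
      using nn_integral_triangular[of N "\<lambda>_. 1" "\<lambda>k c. \<Sum>i<k. c i * x N ^ (k - i)" ?\<Psi>] \<Psi> by simp
    finally show "(\<integral>\<^sup>+c. ?H (c(N := y)) \<partial>lborel_power N) = \<phi> N y * (\<integral>\<^sup>+c. ?\<Psi> c \<partial>lborel_power N)" .
  qed
  finally have eq: "(\<integral>\<^sup>+c. ?F c \<partial>lborel_power (Suc N)) =
     (\<integral>\<^sup>+y. \<phi> N y * (\<integral>\<^sup>+c. (\<Prod>j<N. \<phi> j (y + (x j - x N) * (\<Sum>k<N. c k * x j ^ (N - 1 - k)))) \<partial>lborel_power N) \<partial>lborel)" .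
  let ?V = "\<Prod>i<N. \<Prod>j<i. ennreal ((cmod (x j - x i))\<^sup>2)"
  let ?D = "\<Prod>j<N. ennreal ((cmod (x j - x N))\<^sup>2)"
  \<comment> \<open>By the induction hypothesis the quotient can be replaced by its values at the
    remaining points. Rescaling each of these by \<open>x j - x N\<close> supplies the new factors
    of the squared Vandermonde determinant.\<close>
  have inner: "?V * ?D * (\<integral>\<^sup>+c. (\<Prod>j<N. \<phi> j (y + (x j - x N) * (\<Sum>k<N. c k * x j ^ (N - 1 - k)))) \<partial>lborel_power N) =
      (\<Prod>j<N. \<integral>\<^sup>+w. \<phi> j w \<partial>lborel)" for y
  proof -
    have "?V * (\<integral>\<^sup>+c. (\<Prod>j<N. \<phi> j (y + (x j - x N) * (\<Sum>k<N. c k * x j ^ (N - 1 - k)))) \<partial>lborel_power N) =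
       (\<Prod>j<N. \<integral>\<^sup>+w. \<phi> j (y + (x j - x N) * w) \<partial>lborel)"
      by (rule Suc.IH) (use Suc.prems in \<open>auto intro: inj_on_subset intro!: measurable_compose[OF _ Suc.prems(2)]\<close>)
    then have "?D * (?V * (\<integral>\<^sup>+c. (\<Prod>j<N. \<phi> j (y + (x j - x N) * (\<Sum>k<N. c k * x j ^ (N - 1 - k)))) \<partial>lborel_power N)) =
       (\<Prod>j<N. ennreal ((cmod (x j - x N))\<^sup>2) * (\<integral>\<^sup>+w. \<phi> j (y + (x j - x N) * w) \<partial>lborel))"
      by (simp add: prod.distrib)
    also have "\<dots> = (\<Prod>j<N. \<integral>\<^sup>+w. \<phi> j w \<partial>lborel)"
    proof (rule prod.cong[OF refl], rule nn_integral_lborel_complex_affine)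
      fix j assume "j \<in> {..<N}"
      then show "x j - x N \<noteq> 0" "\<phi> j \<in> borel_measurable borel"
        using Suc.prems inj_onD[OF Suc.prems(1), of j N] by auto
    qed
    finally show ?thesis by (simp add: mult_ac)
  qed
  have "?V * ?D * (\<integral>\<^sup>+c. ?F c \<partial>lborel_power (Suc N)) =
     (\<integral>\<^sup>+y. ?V * ?D * (\<phi> N y * (\<integral>\<^sup>+c. (\<Prod>j<N. \<phi> j (y + (x j - x N) * (\<Sum>k<N. c k * x j ^ (N - 1 - k)))) \<partial>lborel_power N)) \<partial>lborel)"
    unfolding eq
  proof (rule nn_integral_cmult[symmetric])
    let ?K = "\<lambda>c. \<Prod>j<N. \<phi> j (c N + (x j - x N) * (\<Sum>k<N. c k * x j ^ (N - 1 - k)))"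
    have K: "?K \<in> borel_measurable (lborel_power (Suc N))"
      by (intro borel_measurable_prod_ennreal measurable_compose[OF _ Suc.prems(2)]) auto
    have swap: "(\<lambda>(y, c). c(N := y)) \<in> lborel \<Otimes>\<^sub>M lborel_power N \<rightarrow>\<^sub>M lborel_power (Suc N)"
      using measurable_compose[OF measurable_pair_swap' measurable_lborel_power_upd] by (simp add: case_prod_unfold)
    have "(\<lambda>y. \<integral>\<^sup>+c. ?K (c(N := y)) \<partial>lborel_power N) \<in> borel_measurable lborel"
      using measurable_compose[OF swap K]
      by (intro sigma_finite_measure.borel_measurable_nn_integral lborel_pow.sigma_finite) (simp_all add: case_prod_unfold)
    then show "(\<lambda>y. \<phi> N y * (\<integral>\<^sup>+c. (\<Prod>j<N. \<phi> j (y + (x j - x N) * (\<Sum>k<N. c k * x j ^ (N - 1 - k)))) \<partial>lborel_power N)) \<in> borel_measurable lborel"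
      by simp
  qed
  also have "\<dots> = (\<integral>\<^sup>+y. \<phi> N y * (\<Prod>j<N. \<integral>\<^sup>+w. \<phi> j w \<partial>lborel) \<partial>lborel)"
  proof (rule nn_integral_cong)
    fix y
    show "?V * ?D * (\<phi> N y * (\<integral>\<^sup>+c. (\<Prod>j<N. \<phi> j (y + (x j - x N) * (\<Sum>k<N. c k * x j ^ (N - 1 - k)))) \<partial>lborel_power N)) =
        \<phi> N y * (\<Prod>j<N. \<integral>\<^sup>+w. \<phi> j w \<partial>lborel)"
      using arg_cong[OF inner[of y], of "\<lambda>t. \<phi> N y * t"] by (simp only: mult_ac)
  qed
  also have "\<dots> = (\<integral>\<^sup>+y. \<phi> N y \<partial>lborel) * (\<Prod>j<N. \<integral>\<^sup>+w. \<phi> j w \<partial>lborel)"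
    by (rule nn_integral_multc) simp
  finally show ?case by (simp add: mult.commute)
qed

text \<open>Each unordered pair of indices occurs in both orders on the right. For roots of unity
  this turns the squared Vandermonde modulus into a product of \<open>N\<close> derivative
  values.\<close>

lemma prod_lower_triangle_square:
  fixes f :: "nat \<Rightarrow> nat \<Rightarrow> 'a :: comm_monoid_mult"
  assumes "\<And>i j. f i j = f j i"
  shows "(\<Prod>i<N. \<Prod>j<i. f i j * f i j) = (\<Prod>i<N. \<Prod>j\<in>{..<N} - {i}. f i j)"
proof (induction N)
  case (Suc N)
  have "(\<Prod>i<Suc N. \<Prod>j\<in>{..<Suc N} - {i}. f i j) =
      (\<Prod>i<N. \<Prod>j\<in>{..<Suc N} - {i}. f i j) * (\<Prod>j<N. f N j)"
    by (simp add: lessThan_Suc mult.commute)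
  also have "(\<Prod>i<N. \<Prod>j\<in>{..<Suc N} - {i}. f i j) = (\<Prod>i<N. f i N * (\<Prod>j\<in>{..<N} - {i}. f i j))"
  proof (rule prod.cong[OF refl])
    fix i assume "i \<in> {..<N}"
    then have "{..<Suc N} - {i} = insert N ({..<N} - {i})" by auto
    then show "(\<Prod>j\<in>{..<Suc N} - {i}. f i j) = f i N * (\<Prod>j\<in>{..<N} - {i}. f i j)" by simp
  qed
  also have "\<dots> = (\<Prod>i<N. f N i) * (\<Prod>i<N. \<Prod>j\<in>{..<N} - {i}. f i j)"
    by (simp only: prod.distrib assms[of _ N])
  finally show ?case unfolding Suc[symmetric] by (simp add: prod.distrib mult_ac)
qed simp

text \<open>The map from coefficients to values is a diagonal scaling by
  \<open>a n * \<rho> ^ n\<close> followed by a Vandermonde matrix in the roots of unity, whose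
  squared determinant has modulus \<open>N ^ N\<close> because each node contributes a factor
  \<open>N\<close>.\<close>

lemma nn_integral_unity_root_values:
  assumes N: "N > 0" and \<rho>: "\<rho> > 0" and a: "\<And>n. a n > 0"
    and \<phi>: "\<And>j. j < N \<Longrightarrow> \<phi> j \<in> borel_measurable (borel :: complex measure)"
  shows "ennreal (real N ^ N * (\<Prod>n<N. (a n * \<rho> ^ n)\<^sup>2)) *
     (\<integral>\<^sup>+c. (\<Prod>j<N. \<phi> j (\<Sum>n<N. c n * of_real (a n) * (of_real \<rho> * unity_root N j) ^ n)) \<partial>lborel_power N) =
     (\<Prod>j<N. \<integral>\<^sup>+w. \<phi> j w \<partial>lborel)"
proof -
  let ?w = "unity_root N"
  define \<alpha> where "\<alpha> n = complex_of_real (a n * \<rho> ^ n)" for n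
  have \<alpha>: "\<alpha> n \<noteq> 0" "cmod (\<alpha> n) = a n * \<rho> ^ n" for n
    using a[of n] \<rho> by (simp_all add: \<alpha>_def norm_mult norm_power)
  define \<Psi> where "\<Psi> c = (\<Prod>j<N. \<phi> j (\<Sum>n<N. c n * ?w j ^ n))" for c
  have \<Psi>: "\<Psi> \<in> borel_measurable (lborel_power N)"
    unfolding \<Psi>_def
    by (intro borel_measurable_prod_ennreal measurable_compose[OF _ \<phi>] borel_measurable_sum
        borel_measurable_times measurable_lborel_power_component) auto
  have 1: "(\<Prod>n<N. ennreal ((cmod (\<alpha> n))\<^sup>2)) *
     (\<integral>\<^sup>+c. (\<Prod>j<N. \<phi> j (\<Sum>n<N. c n * of_real (a n) * (of_real \<rho> * ?w j) ^ n)) \<partial>lborel_power N) =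
     (\<integral>\<^sup>+c. \<Psi> c \<partial>lborel_power N)"
  proof -
    have "(\<Prod>n<N. ennreal ((cmod (\<alpha> n))\<^sup>2)) *
        (\<integral>\<^sup>+c. \<Psi> (\<lambda>k\<in>{..<N}. 0 + \<alpha> k * c k) \<partial>lborel_power N) = (\<integral>\<^sup>+c. \<Psi> c \<partial>lborel_power N)"
      by (rule nn_integral_triangular[OF \<alpha>(1) _ \<Psi>]) simp
    moreover have "\<Psi> (\<lambda>k\<in>{..<N}. 0 + \<alpha> k * c k) =
        (\<Prod>j<N. \<phi> j (\<Sum>n<N. c n * of_real (a n) * (of_real \<rho> * ?w j) ^ n))" for c
      unfolding \<Psi>_def
      by (intro prod.cong refl arg_cong[of _ _ "\<phi> _"] sum.cong) (simp add: \<alpha>_def power_mult_distrib)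
    ultimately show ?thesis by simp
  qed
  have inj: "inj_on (\<lambda>j. cnj (?w j)) {..<N}"
    using unity_root_powers[OF N] by (auto simp: bij_betw_def inj_on_def)
  \<comment> \<open>The Vandermonde formula lists coefficients from the highest degree, here they
    run from the lowest. Passing to the conjugate nodes reverses the order at the cost of a factor
    of modulus 1, under which Lebesgue measure is invariant.\<close>
  have pw: "?w j ^ n = ?w j ^ (N - 1) * cnj (?w j) ^ (N - 1 - n)" if "n < N" for n j
  proof -
    have "?w j ^ (N - 1) = ?w j ^ n * ?w j ^ (N - 1 - n)"
      unfolding power_add[symmetric] using that by simp
    then have "?w j ^ (N - 1) * cnj (?w j) ^ (N - 1 - n) = ?w j ^ n * (?w j * cnj (?w j)) ^ (N - 1 - n)"
      by (simp only: power_mult_distrib mult.assoc)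
    also have "?w j * cnj (?w j) = 1" using complex_norm_square[of "?w j"] by simp
    finally show ?thesis by simp
  qed
  have "(\<Prod>i<N. \<Prod>j<i. ennreal ((cmod (cnj (?w j) - cnj (?w i)))\<^sup>2)) *
      (\<integral>\<^sup>+c. (\<Prod>j<N. \<phi> j (?w j ^ (N - 1) * (\<Sum>n<N. c n * cnj (?w j) ^ (N - 1 - n)))) \<partial>lborel_power N) =
      (\<Prod>j<N. \<integral>\<^sup>+u. \<phi> j (?w j ^ (N - 1) * u) \<partial>lborel)"
    by (rule nn_integral_vandermonde[OF inj, where \<phi> = "\<lambda>j u. \<phi> j (?w j ^ (N - 1) * u)"])
       (auto intro!: measurable_compose[OF _ \<phi>])
  also have "(\<Prod>j<N. \<integral>\<^sup>+u. \<phi> j (?w j ^ (N - 1) * u) \<partial>lborel) = (\<Prod>j<N. \<integral>\<^sup>+w. \<phi> j w \<partial>lborel)"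
  proof (rule prod.cong[OF refl])
    fix j assume "j \<in> {..<N}"
    then show "(\<integral>\<^sup>+u. \<phi> j (?w j ^ (N - 1) * u) \<partial>lborel) = (\<integral>\<^sup>+w. \<phi> j w \<partial>lborel)"
      using nn_integral_lborel_complex_mult[OF \<phi>, of j "?w j ^ (N - 1)"] by (simp add: norm_power)
  qed
  also have "(\<integral>\<^sup>+c. (\<Prod>j<N. \<phi> j (?w j ^ (N - 1) * (\<Sum>n<N. c n * cnj (?w j) ^ (N - 1 - n)))) \<partial>lborel_power N) =
     (\<integral>\<^sup>+c. \<Psi> c \<partial>lborel_power N)"
    unfolding \<Psi>_def sum_distrib_left
    by (intro nn_integral_cong prod.cong refl arg_cong[of _ _ "\<phi> _"] sum.cong)
       (metis lessThan_iff mult.left_commute pw)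
  also have "(\<Prod>i<N. \<Prod>j<i. ennreal ((cmod (cnj (?w j) - cnj (?w i)))\<^sup>2)) = ennreal (real N ^ N)"
  proof -
    have "(\<Prod>i<N. \<Prod>j<i. (cmod (cnj (?w j) - cnj (?w i)))\<^sup>2) =
        (\<Prod>i<N. \<Prod>j<i. cmod (?w i - ?w j) * cmod (?w i - ?w j))"
      unfolding complex_cnj_diff[symmetric] complex_mod_cnj by (simp add: power2_eq_square norm_minus_commute)
    also have "\<dots> = (\<Prod>i<N. \<Prod>j\<in>{..<N} - {i}. cmod (?w i - ?w j))"
      by (rule prod_lower_triangle_square) (rule norm_minus_commute)
    also have "\<dots> = real N ^ N"
      by (simp add: prod_cmod_unity_root_diff[OF N])
    finally show ?thesis by (simp add: prod_ennreal prod_nonneg)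
  qed
  finally have "ennreal (real N ^ N) * (\<integral>\<^sup>+c. \<Psi> c \<partial>lborel_power N) = (\<Prod>j<N. \<integral>\<^sup>+w. \<phi> j w \<partial>lborel)" .
  moreover have "(\<Prod>n<N. ennreal ((cmod (\<alpha> n))\<^sup>2)) = ennreal (\<Prod>n<N. (a n * \<rho> ^ n)\<^sup>2)"
    unfolding \<alpha>(2) by (rule prod_ennreal) simp
  ultimately show ?thesis unfolding 1[symmetric]
    by (simp only: ennreal_mult[OF zero_le_power[OF of_nat_0_le_iff] prod_nonneg[OF zero_le_power2]] mult.assoc)
qed

text \<open>Domination is carried through the induction as an inequality of integrals, so the
  density of the product law never has to be formed.\<close>

lemma nn_integral_PiM_le_lborel_power:
  fixes D :: "complex measure"
  assumes "prob_space D" and sets: "sets D = sets borel"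
    and le: "\<And>g. g \<in> borel_measurable borel \<Longrightarrow> (\<integral>\<^sup>+w. g w \<partial>D) \<le> K * (\<integral>\<^sup>+w. g w \<partial>lborel)"
    and "\<Psi> \<in> borel_measurable (lborel_power N)"
  shows "(\<integral>\<^sup>+x. \<Psi> x \<partial>Pi\<^sub>M {..<N} (\<lambda>_. D)) \<le> K ^ N * (\<integral>\<^sup>+x. \<Psi> x \<partial>lborel_power N)"
  using assms(4)
proof (induction N arbitrary: \<Psi>)
  case 0
  then show ?case by (simp add: PiM_empty nn_integral_count_space_finite)
next
  case (Suc N)
  interpret D: prob_space D by fact
  interpret DP: product_sigma_finite "\<lambda>_ :: nat. D" by standard
  have cong: "sets (Pi\<^sub>M I (\<lambda>_. D)) = sets (Pi\<^sub>M I (\<lambda>_. lborel))" for I :: "nat set"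
    by (rule sets_PiM_cong) (simp_all add: sets)
  note [measurable_cong] = sets
  have M2: "(\<lambda>(x, y). \<Psi> (x(N := y))) \<in> borel_measurable (lborel_power N \<Otimes>\<^sub>M lborel)"
    using measurable_compose[OF measurable_lborel_power_upd Suc.prems] unfolding case_prod_unfold .
  define \<Psi>' where "\<Psi>' x = (\<integral>\<^sup>+y. \<Psi> (x(N := y)) \<partial>lborel)" for x
  have \<Psi>': "\<Psi>' \<in> borel_measurable (lborel_power N)"
    unfolding \<Psi>'_def using M2 by (rule lborel.borel_measurable_nn_integral)
  have "(\<integral>\<^sup>+x. \<Psi> x \<partial>Pi\<^sub>M {..<Suc N} (\<lambda>_. D)) =
      (\<integral>\<^sup>+x. \<integral>\<^sup>+y. \<Psi> (x(N := y)) \<partial>D \<partial>Pi\<^sub>M {..<N} (\<lambda>_. D))"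
    using Suc.prems unfolding lessThan_Suc
    by (intro DP.product_nn_integral_insert) (simp_all cong: measurable_cong_sets add: cong)
  also have "\<dots> \<le> (\<integral>\<^sup>+x. K * \<Psi>' x \<partial>Pi\<^sub>M {..<N} (\<lambda>_. D))"
    unfolding \<Psi>'_def
  proof (intro nn_integral_mono le)
    fix x assume "x \<in> space (Pi\<^sub>M {..<N} (\<lambda>_. D))"
    then have "x \<in> space (lborel_power N)" using sets_eq_imp_space_eq[OF cong] by blast
    then show "(\<lambda>y. \<Psi> (x(N := y))) \<in> borel_measurable borel"
      using measurable_Pair2[OF M2] by simp
  qed
  also have "\<dots> = K * (\<integral>\<^sup>+x. \<Psi>' x \<partial>Pi\<^sub>M {..<N} (\<lambda>_. D))"
    using \<Psi>' by (intro nn_integral_cmult) (simp cong: measurable_cong_sets add: cong)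
  also have "\<dots> \<le> K * (K ^ N * (\<integral>\<^sup>+x. \<Psi>' x \<partial>lborel_power N))"
    by (intro mult_left_mono Suc.IH \<Psi>') simp
  also have "(\<integral>\<^sup>+x. \<Psi>' x \<partial>lborel_power N) = (\<integral>\<^sup>+x. \<Psi> x \<partial>lborel_power (Suc N))"
    unfolding \<Psi>'_def by (rule nn_integral_lborel_power_Suc(1)[symmetric, OF Suc.prems])
  finally show ?case by (simp add: mult.assoc)
qed

section \<open>Gaussian coefficients dominated by Lebesgue measure\<close>

locale gaussian_coefficients = prob_space M for M :: "'w measure" +
  fixes \<zeta> :: "nat \<Rightarrow> 'w \<Rightarrow> complex"
  assumes indep: "indep_vars (\<lambda>_. borel) \<zeta> UNIV"
    and gaussian: "\<And>n. std_complex_gaussian M (\<zeta> n)"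
begin

lemma \<zeta>_measurable [measurable]: "\<zeta> n \<in> borel_measurable M"
  using indep by (simp add: indep_vars_def)

lemma nn_integral_\<zeta>:
  assumes "g \<in> borel_measurable borel"
  shows "(\<integral>\<^sup>+\<omega>. g (\<zeta> n \<omega>) \<partial>M) = (\<integral>\<^sup>+z. ennreal (1 / pi * exp (- (cmod z)\<^sup>2)) * g z \<partial>lborel)"
  using distributed_nn_integral[OF gaussian[of n, unfolded std_complex_gaussian_def], of g] assms
  by simp

lemma distr_\<zeta>: "distr M borel (\<zeta> n) = density lborel (\<lambda>z. ennreal (1 / pi * exp (- (cmod z)\<^sup>2)))"
  using gaussian[of n] distr_cong[of M M borel lborel "\<zeta> n" "\<zeta> n"]
  by (simp add: std_complex_gaussian_def distributed_def)

text \<open>The coefficients from \<open>N\<close> on are independent of the first \<open>N\<close>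
  and merely shift the values by \<open>b j\<close>. Once the Gaussian density is replaced by its
  maximum \<open>1 / pi\<close>, translation invariance of Lebesgue measure removes this shift, so
  nothing has to be known about the tail of the series.\<close>

lemma nn_integral_prod_values_le:
  assumes N: "N > 0" and \<rho>: "\<rho> > 0" and a: "\<And>n. a n > 0"
    and \<phi>: "\<And>j. j < N \<Longrightarrow> \<phi> j \<in> borel_measurable (borel :: complex measure)"
    and b: "\<And>j. j < N \<Longrightarrow> b j \<in> borel_measurable (Pi\<^sub>M {N..} (\<lambda>_. borel))"
  shows "ennreal (real N ^ N * (\<Prod>n<N. (a n * \<rho> ^ n)\<^sup>2)) *
     (\<integral>\<^sup>+\<omega>. (\<Prod>j<N. \<phi> j (b j (\<lambda>i\<in>{N..}. \<zeta> i \<omega>) +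
        (\<Sum>n<N. \<zeta> n \<omega> * of_real (a n) * (of_real \<rho> * unity_root N j) ^ n))) \<partial>M) \<le>
     ennreal (1 / pi) ^ N * (\<Prod>j<N. \<integral>\<^sup>+w. \<phi> j w \<partial>lborel)"
proof -
  let ?C = "ennreal (real N ^ N * (\<Prod>n<N. (a n * \<rho> ^ n)\<^sup>2))"
  let ?A = "Pi\<^sub>M {..<N} (\<lambda>_. borel :: complex measure)" and ?B = "Pi\<^sub>M {N..} (\<lambda>_. borel :: complex measure)"
  define X where "X \<omega> = (\<lambda>i\<in>{..<N}. \<zeta> i \<omega>)" for \<omega>
  define Y where "Y \<omega> = (\<lambda>i\<in>{N..}. \<zeta> i \<omega>)" for \<omega>
  define H where "H x y = (\<Prod>j<N. \<phi> j (b j y + (\<Sum>n<N. x n * of_real (a n) * (of_real \<rho> * unity_root N j) ^ n)))"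
    for x y
  have XY: "indep_var ?A X ?B Y"
    unfolding X_def Y_def by (rule indep_var_restrict[OF indep]) auto
  then have X[measurable]: "X \<in> M \<rightarrow>\<^sub>M ?A" and Y[measurable]: "Y \<in> M \<rightarrow>\<^sub>M ?B"
    and dist: "distr M ?A X \<Otimes>\<^sub>M distr M ?B Y = distr M (?A \<Otimes>\<^sub>M ?B) (\<lambda>\<omega>. (X \<omega>, Y \<omega>))"
    by (auto simp: indep_var_distribution_eq)
  interpret X: prob_space "distr M ?A X" by (rule prob_space_distr) simp
  interpret Y: prob_space "distr M ?B Y" by (rule prob_space_distr) simp
  interpret XY: pair_prob_space "distr M ?A X" "distr M ?B Y" ..
  have comp: "(\<lambda>x. x n) \<in> borel_measurable ?A" if "n < N" for n
    using that by simp
  have H: "(\<lambda>(x, y). H x y) \<in> borel_measurable (?A \<Otimes>\<^sub>M ?B)"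
    unfolding H_def case_prod_unfold
    by (intro borel_measurable_prod_ennreal measurable_compose[OF _ \<phi>] borel_measurable_add
        borel_measurable_sum borel_measurable_times measurable_compose[OF measurable_fst comp]
        measurable_compose[OF measurable_snd b]) auto
  define D where "D = density lborel (\<lambda>z. ennreal (1 / pi * exp (- (cmod z)\<^sup>2)))"
  have D: "distr M borel (\<zeta> n) = D" for n by (simp add: distr_\<zeta> D_def)
  have probD: "prob_space D" unfolding D[of 0, symmetric] by (rule prob_space_distr) simp
  have setsD: "sets D = sets borel" by (simp add: D_def)
  have leD: "(\<integral>\<^sup>+w. g w \<partial>D) \<le> ennreal (1 / pi) * (\<integral>\<^sup>+w. g w \<partial>lborel)"
    if "g \<in> borel_measurable borel" for g
  proof -
    have "(\<integral>\<^sup>+w. g w \<partial>D) = (\<integral>\<^sup>+w. ennreal (1 / pi * exp (- (cmod w)\<^sup>2)) * g w \<partial>lborel)"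
      unfolding D_def using that by (intro nn_integral_density) simp_all
    also have "\<dots> \<le> (\<integral>\<^sup>+w. ennreal (1 / pi) * g w \<partial>lborel)"
      by (intro nn_integral_mono mult_right_mono ennreal_leI) (simp_all add: divide_right_mono)
    also have "\<dots> = ennreal (1 / pi) * (\<integral>\<^sup>+w. g w \<partial>lborel)"
      using that by (intro nn_integral_cmult) simp
    finally show ?thesis .
  qed
  have dX: "distr M ?A X = Pi\<^sub>M {..<N} (\<lambda>_. D)"
  proof -
    have "indep_vars (\<lambda>_. borel) \<zeta> {..<N}" using indep by (rule indep_vars_subset) simp
    then show ?thesis
      using N indep_vars_iff_distr_eq_PiM[where I = "{..<N}" and M' = "\<lambda>_. borel" and X = \<zeta>] by (simp add: X_def[abs_def] D lessThan_empty_iff)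
  qed
  have inner: "?C * (\<integral>\<^sup>+x. H x y \<partial>distr M ?A X) \<le> ennreal (1 / pi) ^ N * (\<Prod>j<N. \<integral>\<^sup>+w. \<phi> j w \<partial>lborel)" for y
  proof -
    have Hy: "(\<lambda>x. H x y) \<in> borel_measurable (lborel_power N)"
      unfolding H_def
      by (intro borel_measurable_prod_ennreal measurable_compose[OF _ \<phi>] borel_measurable_add
        borel_measurable_sum borel_measurable_times measurable_lborel_power_component) auto
    have "?C * (\<integral>\<^sup>+x. H x y \<partial>distr M ?A X) \<le> ?C * (ennreal (1 / pi) ^ N * (\<integral>\<^sup>+x. H x y \<partial>lborel_power N))"
      unfolding dX by (intro mult_left_mono nn_integral_PiM_le_lborel_power probD setsD leD Hy) simp_all
    also have "\<dots> = ennreal (1 / pi) ^ N * (?C * (\<integral>\<^sup>+x. H x y \<partial>lborel_power N))" by (simp only: mult_ac)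
    also have "?C * (\<integral>\<^sup>+x. H x y \<partial>lborel_power N) = (\<Prod>j<N. \<integral>\<^sup>+w. \<phi> j (b j y + w) \<partial>lborel)"
      unfolding H_def
      by (rule nn_integral_unity_root_values[OF N \<rho> a, where \<phi> = "\<lambda>j w. \<phi> j (b j y + w)"])
         (intro measurable_compose[OF _ \<phi>], auto)
    also have "\<dots> = (\<Prod>j<N. \<integral>\<^sup>+w. \<phi> j w \<partial>lborel)"
      by (intro prod.cong refl nn_integral_lborel_translate \<phi>) simp
    finally show ?thesis .
  qed
  have "(\<integral>\<^sup>+\<omega>. H (X \<omega>) (Y \<omega>) \<partial>M) = (\<integral>\<^sup>+p. (case p of (x, y) \<Rightarrow> H x y) \<partial>distr M (?A \<Otimes>\<^sub>M ?B) (\<lambda>\<omega>. (X \<omega>, Y \<omega>)))"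
    using H by (subst nn_integral_distr) auto
  also have "\<dots> = (\<integral>\<^sup>+p. (case p of (x, y) \<Rightarrow> H x y) \<partial>(distr M ?A X \<Otimes>\<^sub>M distr M ?B Y))"
    by (simp add: dist)
  also have "\<dots> = (\<integral>\<^sup>+y. \<integral>\<^sup>+x. H x y \<partial>distr M ?A X \<partial>distr M ?B Y)"
    using H by (subst XY.nn_integral_snd[symmetric]) (auto cong: measurable_cong_sets)
  finally have "?C * (\<integral>\<^sup>+\<omega>. H (X \<omega>) (Y \<omega>) \<partial>M) =
      ?C * (\<integral>\<^sup>+y. \<integral>\<^sup>+x. H x y \<partial>distr M ?A X \<partial>distr M ?B Y)" by simp
  also have "\<dots> = (\<integral>\<^sup>+y. ?C * (\<integral>\<^sup>+x. H x y \<partial>distr M ?A X) \<partial>distr M ?B Y)"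
  proof (rule nn_integral_cmult[symmetric])
    have "(\<lambda>(y, x). H x y) \<in> borel_measurable (distr M ?B Y \<Otimes>\<^sub>M distr M ?A X)"
      using measurable_compose[OF measurable_pair_swap' H] by (simp add: case_prod_unfold cong: measurable_cong_sets)
    then show "(\<lambda>y. \<integral>\<^sup>+x. H x y \<partial>distr M ?A X) \<in> borel_measurable (distr M ?B Y)"
      by (rule X.borel_measurable_nn_integral)
  qed
  also have "\<dots> \<le> (\<integral>\<^sup>+y. ennreal (1 / pi) ^ N * (\<Prod>j<N. \<integral>\<^sup>+w. \<phi> j w \<partial>lborel) \<partial>distr M ?B Y)"
    by (intro nn_integral_mono inner)
  also have "\<dots> = ennreal (1 / pi) ^ N * (\<Prod>j<N. \<integral>\<^sup>+w. \<phi> j w \<partial>lborel)"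
    using Y.emeasure_space_1 by simp
  finally show ?thesis
    by (simp add: H_def X_def Y_def)
qed

end

section \<open>Gaussian estimates\<close>

text \<open>A sub-Gaussian bound for the hyperbolic cosine. The exponent \<open>x\<^sup>2\<close> in
  place of the sharp \<open>x\<^sup>2 / 2\<close> affects only constants in the Chernoff
  estimate.\<close>

lemma exp_plus_exp_minus_le: "exp x + exp (- x) \<le> 2 * exp (x\<^sup>2)" for x :: real
proof -
  have *: "exp x + exp (- x) \<le> 2 * exp (x\<^sup>2)" if x: "x \<ge> 0" for x :: real
  proof (cases "x \<le> 1")
    case True
    have "exp x \<le> 1 + x + x\<^sup>2" using exp_bound[OF x True] .
    moreover have "exp (- x) \<le> 1 - x + x\<^sup>2"
    proof -
      \<comment> \<open>The product equals \<open>1 + x ^ 3\<close>.\<close>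
      have "1 \<le> (1 - x + x\<^sup>2) * (1 + x)"
        using x by (simp add: algebra_simps power2_eq_square)
      also have "\<dots> \<le> (1 - x + x\<^sup>2) * exp x"
        using exp_ge_add_one_self[of x] True by (intro mult_left_mono) auto
      finally show ?thesis by (simp add: exp_minus field_simps)
    qed
    ultimately show ?thesis using exp_ge_add_one_self[of "x\<^sup>2"] by linarith
  next
    case False
    then have "x * 1 \<le> x * x" by (intro mult_left_mono) auto
    then have "exp x \<le> exp (x\<^sup>2)" by (simp add: power2_eq_square)
    moreover have "exp (- x) \<le> exp x" using x by simp
    ultimately show ?thesis by linarith
  qed
  show ?thesis using *[of x] *[of "- x"] by (cases "x \<ge> 0") auto
qed

context gaussian_coefficients
begin

lemma emeasure_\<zeta>:
  assumes A: "A \<in> sets borel"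
  shows "emeasure M {\<omega> \<in> space M. \<zeta> n \<omega> \<in> A} =
    (\<integral>\<^sup>+z. ennreal (1 / pi * exp (- (cmod z)\<^sup>2)) * indicator A z \<partial>lborel)"
proof -
  have "emeasure M {\<omega> \<in> space M. \<zeta> n \<omega> \<in> A} = (\<integral>\<^sup>+\<omega>. indicator {\<omega> \<in> space M. \<zeta> n \<omega> \<in> A} \<omega> \<partial>M)"
    using measurable_sets[OF \<zeta>_measurable A, of n]
    by (intro nn_integral_indicator[symmetric]) (simp add: vimage_def Int_def conj_commute)
  also have "\<dots> = (\<integral>\<^sup>+\<omega>. indicator A (\<zeta> n \<omega>) \<partial>M)"
    by (intro nn_integral_cong) (auto simp: indicator_def)
  finally show ?thesis using A by (subst (asm) nn_integral_\<zeta>) simp_all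
qed

text \<open>On the disc the density is at least \<open>exp (- R\<^sup>2) / pi\<close>, and the area
  supplies \<open>pi * r\<^sup>2\<close>. A disc at the origin gives the small-value bound, an
  off-centre one the large-value bound.\<close>

lemma gaussian_disk_ge:
  assumes A: "A \<in> sets borel" and sub: "cball c r \<subseteq> A" and r: "r \<ge> 0"
    and R: "\<And>z. z \<in> cball c r \<Longrightarrow> cmod z \<le> R"
  shows "r\<^sup>2 * exp (- R\<^sup>2) \<le> prob {\<omega> \<in> space M. \<zeta> n \<omega> \<in> A}"
proof -
  have "ennreal (r\<^sup>2 * exp (- R\<^sup>2)) = ennreal (1 / pi * exp (- R\<^sup>2)) * emeasure lborel (cball c r)"
    using r by (simp add: emeasure_cball unit_ball_vol_2 ennreal_mult[symmetric])
  also have "\<dots> = (\<integral>\<^sup>+z. ennreal (1 / pi * exp (- R\<^sup>2)) * indicator (cball c r) z \<partial>lborel)"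
    by (simp add: nn_integral_cmult_indicator)
  also have "\<dots> \<le> (\<integral>\<^sup>+z. ennreal (1 / pi * exp (- (cmod z)\<^sup>2)) * indicator A z \<partial>lborel)"
  proof (intro nn_integral_mono)
    fix z
    show "ennreal (1 / pi * exp (- R\<^sup>2)) * indicator (cball c r) z
      \<le> ennreal (1 / pi * exp (- (cmod z)\<^sup>2)) * indicator A z"
    proof (cases "z \<in> cball c r")
      case True
      have "(cmod z)\<^sup>2 \<le> R\<^sup>2" using R[OF True] by (intro power_mono) auto
      then have "1 / pi * exp (- R\<^sup>2) \<le> 1 / pi * exp (- (cmod z)\<^sup>2)" by (intro mult_left_mono) auto
      then show ?thesis using True sub by (auto simp: indicator_def intro!: ennreal_leI)
    qed simp
  qed
  also have "\<dots> = emeasure M {\<omega> \<in> space M. \<zeta> n \<omega> \<in> A}" by (rule emeasure_\<zeta>[OF A, symmetric])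
  finally show ?thesis by (simp add: emeasure_eq_measure)
qed

lemma prob_\<zeta>_small:
  assumes "b \<ge> 0"
  shows "min 1 (b\<^sup>2) / exp 1 \<le> prob {\<omega> \<in> space M. cmod (\<zeta> n \<omega>) \<le> b}"
proof -
  have "(min 1 b)\<^sup>2 * exp (- 1\<^sup>2) \<le> prob {\<omega> \<in> space M. \<zeta> n \<omega> \<in> cball 0 b}"
    by (rule gaussian_disk_ge[where c = 0]) (use assms in auto)
  moreover have "(min 1 b)\<^sup>2 = min 1 (b\<^sup>2)"
  proof (cases "b \<le> 1")
    case True
    then have "b\<^sup>2 \<le> 1" using assms by (simp add: power_le_one)
    then show ?thesis using True by simp
  next
    case False
    then have "1 \<le> b\<^sup>2" by (simp add: one_le_power)
    then show ?thesis using False by simp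
  qed
  ultimately show ?thesis by (simp add: exp_minus divide_inverse)
qed

lemma prob_\<zeta>_large:
  assumes "K \<ge> 0"
  shows "exp (- (K + 1)\<^sup>2) / 4 \<le> prob {\<omega> \<in> space M. K \<le> cmod (\<zeta> n \<omega>)}"
proof -
  \<comment> \<open>The annulus between \<open>K\<close> and \<open>K + 1\<close> contains a disc of
    radius \<open>1 / 2\<close>, whose squared radius is the factor \<open>1 / 4\<close>.\<close>
  have *: "K \<le> cmod z \<and> cmod z \<le> K + 1" if "z \<in> cball (of_real (K + 1 / 2)) (1 / 2)" for z :: complex
  proof -
    have d: "cmod (of_real (K + 1 / 2) - z) \<le> 1 / 2" using that by (simp add: dist_norm)
    have n: "cmod (of_real (K + 1 / 2)) = K + 1 / 2" using assms by (subst norm_of_real) simp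
    show ?thesis using norm_triangle_ineq2[of "of_real (K + 1 / 2)" z] norm_triangle_ineq2[of z "of_real (K + 1 / 2)"] d n
      by (simp add: norm_minus_commute)
  qed
  have "(1 / 2)\<^sup>2 * exp (- (K + 1)\<^sup>2) \<le> prob {\<omega> \<in> space M. \<zeta> n \<omega> \<in> {z. K \<le> cmod z}}"
    by (rule gaussian_disk_ge[where c = "of_real (K + 1 / 2)"]) (use * in \<open>auto simp del: mem_cball\<close>)
  then show ?thesis by (simp add: power2_eq_square)
qed

text \<open>The weight halves the exponent of the density, and scaling by \<open>sqrt 2\<close>
  restores it; the value 2 is the Jacobian of that scaling.\<close>

lemma exp_moment_\<zeta>: "(\<integral>\<^sup>+\<omega>. ennreal (exp ((cmod (\<zeta> n \<omega>))\<^sup>2 / 2)) \<partial>M) = 2"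
proof -
  let ?f = "\<lambda>z. ennreal (1 / pi * exp (- (cmod z)\<^sup>2 / 2))"
  have one: "(\<integral>\<^sup>+z. ennreal (1 / pi * exp (- (cmod z)\<^sup>2)) \<partial>lborel) = 1"
    using nn_integral_\<zeta>[of "\<lambda>_. 1" n] emeasure_space_1 by simp
  have "(\<integral>\<^sup>+\<omega>. ennreal (exp ((cmod (\<zeta> n \<omega>))\<^sup>2 / 2)) \<partial>M) =
      (\<integral>\<^sup>+z. ennreal (1 / pi * exp (- (cmod z)\<^sup>2)) * ennreal (exp ((cmod z)\<^sup>2 / 2)) \<partial>lborel)"
    by (rule nn_integral_\<zeta>) simp
  also have "\<dots> = (\<integral>\<^sup>+z. ?f z \<partial>lborel)"
  proof (rule nn_integral_cong)
    fix z :: complex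
    have "1 / pi * exp (- (cmod z)\<^sup>2) * exp ((cmod z)\<^sup>2 / 2) = 1 / pi * exp (- (cmod z)\<^sup>2 / 2)"
      by (simp add: mult_exp_exp)
    then show "ennreal (1 / pi * exp (- (cmod z)\<^sup>2)) * ennreal (exp ((cmod z)\<^sup>2 / 2)) = ?f z"
      by (simp add: ennreal_mult[symmetric])
  qed
  also have "\<dots> = ennreal ((cmod (of_real (sqrt 2)))\<^sup>2) * (\<integral>\<^sup>+z. ?f (of_real (sqrt 2) * z) \<partial>lborel)"
    by (rule nn_integral_lborel_complex_mult[symmetric]) auto
  also have "\<dots> = 2"
    using one by (simp add: norm_mult power_mult_distrib)
  finally show ?thesis .
qed

lemma prob_\<zeta>_tail:
  assumes "x \<ge> 0"
  shows "prob {\<omega> \<in> space M. x \<le> cmod (\<zeta> n \<omega>)} \<le> 2 * exp (- x\<^sup>2 / 2)"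
proof -
  have "ennreal (exp (x\<^sup>2 / 2)) * emeasure M {\<omega> \<in> space M. x \<le> cmod (\<zeta> n \<omega>)} =
      (\<integral>\<^sup>+\<omega>. ennreal (exp (x\<^sup>2 / 2)) * indicator {\<omega> \<in> space M. x \<le> cmod (\<zeta> n \<omega>)} \<omega> \<partial>M)"
    by (rule nn_integral_cmult_indicator[symmetric]) simp
  also have "\<dots> \<le> (\<integral>\<^sup>+\<omega>. ennreal (exp ((cmod (\<zeta> n \<omega>))\<^sup>2 / 2)) \<partial>M)"
    using assms by (intro nn_integral_mono) (auto simp: indicator_def intro!: ennreal_leI power_mono)
  also have "\<dots> = ennreal 2" by (simp add: exp_moment_\<zeta>)
  finally have "ennreal (exp (x\<^sup>2 / 2) * prob {\<omega> \<in> space M. x \<le> cmod (\<zeta> n \<omega>)}) \<le> ennreal 2"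
    by (simp add: emeasure_eq_measure ennreal_mult)
  then have "exp (x\<^sup>2 / 2) * prob {\<omega> \<in> space M. x \<le> cmod (\<zeta> n \<omega>)} \<le> 2"
    by (subst (asm) ennreal_le_iff) auto
  then show ?thesis by (simp add: exp_minus field_simps)
qed

lemma first_moment_\<zeta>: "(\<integral>\<^sup>+\<omega>. ennreal (cmod (\<zeta> n \<omega>)) \<partial>M) \<le> 2"
proof -
  have "x \<le> exp (x\<^sup>2 / 2)" for x :: real
  proof -
    have "x \<le> 1 + x\<^sup>2 / 2" using zero_le_power2[of "x - 1"] by (simp add: power2_eq_square algebra_simps)
    also have "\<dots> \<le> exp (x\<^sup>2 / 2)" by (rule exp_ge_add_one_self)
    finally show ?thesis .
  qed
  then have "(\<integral>\<^sup>+\<omega>. ennreal (cmod (\<zeta> n \<omega>)) \<partial>M) \<le> (\<integral>\<^sup>+\<omega>. ennreal (exp ((cmod (\<zeta> n \<omega>))\<^sup>2 / 2)) \<partial>M)"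
    by (intro nn_integral_mono ennreal_leI)
  then show ?thesis by (simp add: exp_moment_\<zeta>)
qed

text \<open>The truncated variable is symmetric, so its exponential moment is that of a hyperbolic cosine.\<close>

lemma truncated_exp_moment:
  assumes "b \<ge> 0"
  shows "(\<integral>\<^sup>+\<omega>. indicator (cball 0 b) (\<zeta> n \<omega>) * ennreal (exp (Re (c * \<zeta> n \<omega>))) \<partial>M)
    \<le> ennreal (exp ((cmod c * b)\<^sup>2)) * emeasure M {\<omega> \<in> space M. cmod (\<zeta> n \<omega>) \<le> b}"
proof -
  let ?\<gamma> = "\<lambda>z. ennreal (1 / pi * exp (- (cmod z)\<^sup>2)) * indicator (cball 0 b) z"
  let ?I = "\<integral>\<^sup>+z. ?\<gamma> z * ennreal (exp (Re (c * z))) \<partial>lborel"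
  have E[measurable]: "(\<lambda>z. ennreal (exp (Re (c * z)))) \<in> borel_measurable borel"
    "(\<lambda>z. ennreal (exp (- Re (c * z)))) \<in> borel_measurable borel"
    by (intro measurable_compose[OF _ measurable_ennreal] borel_measurable_continuous_onI continuous_intros)+
  have I: "(\<integral>\<^sup>+\<omega>. indicator (cball 0 b) (\<zeta> n \<omega>) * ennreal (exp (Re (c * \<zeta> n \<omega>))) \<partial>M) = ?I"
    by (subst nn_integral_\<zeta>[where g = "\<lambda>z. indicator (cball 0 b) z * ennreal (exp (Re (c * z)))"])
       (intro borel_measurable_times_ennreal borel_measurable_indicator, simp, measurable, simp only: mult.assoc)
  have G0: "?\<gamma> \<in> borel_measurable borel"
    by (rule borel_measurable_times_ennreal, simp, rule borel_measurable_indicator, simp)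
  have G1: "(\<lambda>z. ?\<gamma> z * ennreal (exp (Re (c * z)))) \<in> borel_measurable borel"
    by (rule borel_measurable_times_ennreal[OF G0 E(1)])
  have G2: "(\<lambda>z. ?\<gamma> z * ennreal (exp (- Re (c * z)))) \<in> borel_measurable borel"
    by (rule borel_measurable_times_ennreal[OF G0 E(2)])
  have "?I = (\<integral>\<^sup>+z. ?\<gamma> (- 1 * z) * ennreal (exp (Re (c * (- 1 * z)))) \<partial>lborel)"
    using nn_integral_lborel_complex_mult[OF G1, of "- 1"]
    by (simp only: norm_minus_cancel norm_one power_one ennreal_1 mult_1) simp
  also have "\<dots> = (\<integral>\<^sup>+z. ?\<gamma> z * ennreal (exp (- Re (c * z))) \<partial>lborel)"
    by (intro nn_integral_cong) (simp add: indicator_def)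
  finally have "?I + ?I = (\<integral>\<^sup>+z. ?\<gamma> z * ennreal (exp (Re (c * z))) \<partial>lborel) +
      (\<integral>\<^sup>+z. ?\<gamma> z * ennreal (exp (- Re (c * z))) \<partial>lborel)" by simp
  also have "\<dots> = (\<integral>\<^sup>+z. ?\<gamma> z * ennreal (exp (Re (c * z))) + ?\<gamma> z * ennreal (exp (- Re (c * z))) \<partial>lborel)"
    by (rule nn_integral_add[symmetric]) (unfold measurable_lborel2, rule G1, rule G2)
  also have "\<dots> \<le> (\<integral>\<^sup>+z. ennreal (2 * exp ((cmod c * b)\<^sup>2)) * ?\<gamma> z \<partial>lborel)"
  proof (rule nn_integral_mono)
    fix z
    show "?\<gamma> z * ennreal (exp (Re (c * z))) + ?\<gamma> z * ennreal (exp (- Re (c * z))) \<le>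
        ennreal (2 * exp ((cmod c * b)\<^sup>2)) * ?\<gamma> z"
    proof (cases "cmod z \<le> b")
      case True
      have "\<bar>Re (c * z)\<bar> \<le> cmod c * cmod z" using abs_Re_le_cmod[of "c * z"] by (simp add: norm_mult)
      also have "\<dots> \<le> cmod c * b" using True by (intro mult_left_mono) auto
      finally have "(Re (c * z))\<^sup>2 \<le> (cmod c * b)\<^sup>2" by (simp add: abs_le_square_iff[symmetric] assms)
      then have "exp (Re (c * z)) + exp (- Re (c * z)) \<le> 2 * exp ((cmod c * b)\<^sup>2)"
        using exp_plus_exp_minus_le[of "Re (c * z)"] by (smt (verit) exp_le_cancel_iff)
      then have "ennreal (exp (Re (c * z))) + ennreal (exp (- Re (c * z))) \<le> ennreal (2 * exp ((cmod c * b)\<^sup>2))"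
        by (simp add: ennreal_plus[symmetric] del: ennreal_plus)
      from mult_right_mono[OF this zero_le, of "?\<gamma> z"] show ?thesis
        by (simp only: distrib_right mult.commute[of "?\<gamma> z"])
    qed simp
  qed
  also have "\<dots> = ennreal (2 * exp ((cmod c * b)\<^sup>2)) * (\<integral>\<^sup>+z. ?\<gamma> z \<partial>lborel)"
    by (rule nn_integral_cmult) (unfold measurable_lborel2, rule G0)
  also have "(\<integral>\<^sup>+z. ?\<gamma> z \<partial>lborel) = emeasure M {\<omega> \<in> space M. \<zeta> n \<omega> \<in> cball 0 b}"
    by (rule emeasure_\<zeta>[symmetric]) simp
  finally have 2: "2 * ?I \<le> 2 * (ennreal (exp ((cmod c * b)\<^sup>2)) * emeasure M {\<omega> \<in> space M. cmod (\<zeta> n \<omega>) \<le> b})"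
    by (simp add: mult_2[symmetric] ennreal_mult mult.assoc)
  have "?I \<le> ennreal (exp ((cmod c * b)\<^sup>2)) * emeasure M {\<omega> \<in> space M. cmod (\<zeta> n \<omega>) \<le> b}"
    using 2 by (subst (asm) ennreal_mult_le_mult_iff) auto
  then show ?thesis unfolding I .
qed

end

section \<open>Negative moments of the values\<close>

text \<open>Up to a constant this is \<open>cmod w powr (- 2 * s)\<close> on the disc of radius \<open>S\<close>; the dyadic form
  makes its integral a geometric series of areas.\<close>

definition dyadic_weight :: "real \<Rightarrow> real \<Rightarrow> complex \<Rightarrow> ennreal" where
  "dyadic_weight s S w = (\<Sum>k. ennreal ((4 powr s) ^ k) * indicator (cball 0 (S / 2 ^ k)) w)"

lemma dyadic_weight_measurable [measurable]: "dyadic_weight s S \<in> borel_measurable borel"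
proof -
  have "(\<lambda>w. dyadic_weight s S w) \<in> borel_measurable borel"
    unfolding dyadic_weight_def
    by (rule borel_measurable_suminf_order, rule borel_measurable_times_ennreal, simp, rule borel_measurable_indicator, simp)
  then show ?thesis by simp
qed

lemma nn_integral_dyadic_weight:
  assumes S: "S > 0" and s: "s < 1"
  shows "(\<integral>\<^sup>+w. dyadic_weight s S w \<partial>lborel) = ennreal (pi * S\<^sup>2 / (1 - 4 powr (s - 1)))"
proof -
  have q: "0 \<le> 4 powr (s - 1)" "4 powr (s - 1) < (1::real)" using s by (auto simp: powr_less_one)
  have dyadic: "(4 powr s) ^ k * (pi * (S / 2 ^ k)\<^sup>2) = pi * S\<^sup>2 * (4 powr (s - 1)) ^ k" for k
  proof -
    have "(4::real) powr s = 4 * 4 powr (s - 1)" using powr_add[of 4 1 "s - 1"] by simp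
    then have 1: "((4::real) powr s) ^ k = 4 ^ k * (4 powr (s - 1)) ^ k" by (simp only: power_mult_distrib)
    have "(2 ^ k)\<^sup>2 = ((2::real)\<^sup>2) ^ k" by (simp only: power_mult[symmetric] mult.commute)
    then have "(2 ^ k)\<^sup>2 = (4::real) ^ k" by simp
    then have 2: "(S / 2 ^ k)\<^sup>2 = S\<^sup>2 / 4 ^ k" by (simp only: power_divide)
    show ?thesis unfolding 1 2 by simp
  qed
  have "(\<integral>\<^sup>+w. dyadic_weight s S w \<partial>lborel) =
      (\<Sum>k. \<integral>\<^sup>+w. ennreal ((4 powr s) ^ k) * indicator (cball 0 (S / 2 ^ k)) w \<partial>(lborel :: complex measure))"
    unfolding dyadic_weight_def by (intro nn_integral_suminf borel_measurable_times_ennreal borel_measurable_indicator) simp_all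
  also have "\<dots> = (\<Sum>k. ennreal (pi * S\<^sup>2 * (4 powr (s - 1)) ^ k))"
  proof (rule suminf_cong)
    fix k
    have "emeasure lborel (cball (0::complex) (S / 2 ^ k)) = ennreal (pi * (S / 2 ^ k)\<^sup>2)"
      using S by (simp add: emeasure_cball unit_ball_vol_2)
    then have "(\<integral>\<^sup>+w. ennreal ((4 powr s) ^ k) * indicator (cball 0 (S / 2 ^ k)) w \<partial>(lborel :: complex measure)) =
        ennreal ((4 powr s) ^ k) * ennreal (pi * (S / 2 ^ k)\<^sup>2)"
      by (subst nn_integral_cmult_indicator) simp_all
    also have "\<dots> = ennreal (pi * S\<^sup>2 * (4 powr (s - 1)) ^ k)"
      unfolding dyadic[symmetric] by (rule ennreal_mult[symmetric]) simp_all
    finally show "(\<integral>\<^sup>+w. ennreal ((4 powr s) ^ k) * indicator (cball 0 (S / 2 ^ k)) w \<partial>(lborel :: complex measure)) =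
        ennreal (pi * S\<^sup>2 * (4 powr (s - 1)) ^ k)" .
  qed
  also have "\<dots> = ennreal (pi * S\<^sup>2 / (1 - 4 powr (s - 1)))"
  proof (rule suminf_ennreal_eq)
    show "(\<lambda>k. pi * S\<^sup>2 * (4 powr (s - 1)) ^ k) sums (pi * S\<^sup>2 / (1 - 4 powr (s - 1)))"
      using sums_mult[OF geometric_sums[of "4 powr (s - 1)"], of "pi * S\<^sup>2"] q by simp
  qed simp
  finally show ?thesis .
qed

text \<open>A single term suffices: the one for the last \<open>k\<close> such that \<open>w\<close>
  still lies in the disc of radius \<open>S / 2 ^ k\<close>. The factor 2 in the denominator pays
  for rounding the logarithm.\<close>

lemma dyadic_weight_ge:
  assumes s: "0 \<le> s" and w: "0 < cmod w" "cmod w \<le> S"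
  shows "ennreal ((S / (2 * cmod w)) powr (2 * s)) \<le> dyadic_weight s S w"
proof -
  define x where "x = S / cmod w"
  have x: "x \<ge> 1" using w by (simp add: x_def)
  define k where "k = nat \<lfloor>log 2 x\<rfloor>"
  have l: "0 \<le> log 2 x" using x by simp
  have "2 powr real k \<le> 2 powr (log 2 x)" using l by (intro powr_mono) (auto simp: k_def)
  then have k1: "2 ^ k \<le> x" using x by (simp add: powr_realpow)
  have "log 2 x < real k + 1" using l by (simp add: k_def)
  then have "2 powr (log 2 x) < 2 powr (real k + 1)" by (intro powr_less_mono) auto
  then have k2: "x / 2 < 2 ^ k" using x by (simp add: powr_add powr_realpow)
  have "(x / 2) powr (2 * s) \<le> (2 ^ k) powr (2 * s)"
    using k2 x s by (intro powr_mono2) auto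
  also have "\<dots> = (4 powr s) ^ k"
  proof -
    have "(2 ^ k) powr (2 * s) = (2 powr real k) powr (2 * s)" by (simp add: powr_realpow)
    also have "\<dots> = ((2 powr 2) powr s) powr real k" by (simp only: powr_powr mult_ac)
    also have "\<dots> = (4 powr s) ^ k" by (simp add: powr_realpow)
    finally show ?thesis .
  qed
  finally have "ennreal ((S / (2 * cmod w)) powr (2 * s)) \<le> ennreal ((4 powr s) ^ k)"
    by (intro ennreal_leI) (simp add: x_def field_simps)
  also have "\<dots> = ennreal ((4 powr s) ^ k) * indicator (cball 0 (S / 2 ^ k)) w"
    using k1 w by (simp add: x_def field_simps)
  also have "\<dots> \<le> dyadic_weight s S w"
    unfolding dyadic_weight_def
    using sum_le_suminf[of "\<lambda>k. ennreal ((4 powr s) ^ k) * indicator (cball 0 (S / 2 ^ k)) w" "{k}"]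
    by (simp del: sum_mult_indicator)
  finally show ?thesis .
qed

context gaussian_coefficients
begin

text \<open>Markov's inequality for a negative moment: on \<open>A\<close> the product of weights is
  at least \<open>((S / 2) powr (2 * s)) ^ N / t powr (2 * s)\<close>, while its expectation
  factorises through the change of variables. The condition \<open>s < 1\<close> makes
  \<open>cmod w powr (- 2 * s)\<close> integrable at the origin of the plane.\<close>

lemma prob_small_product_le:
  assumes N: "N > 0" and \<rho>: "\<rho> > 0" and a: "\<And>n. a n > 0"
    and b: "\<And>j. j < N \<Longrightarrow> b j \<in> borel_measurable (Pi\<^sub>M {N..} (\<lambda>_. borel))"
    and S: "S > 0" and s: "0 \<le> s" "s < 1" and t: "t > 0"
    and X: "\<And>j \<omega>. X j \<omega> = b j (\<lambda>i\<in>{N..}. \<zeta> i \<omega>) +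
        (\<Sum>n<N. \<zeta> n \<omega> * of_real (a n) * (of_real \<rho> * unity_root N j) ^ n)"
    and A: "A \<in> events"
    and small: "\<And>\<omega> j. \<omega> \<in> A \<Longrightarrow> j < N \<Longrightarrow> 0 < cmod (X j \<omega>) \<and> cmod (X j \<omega>) \<le> S"
    and prod: "\<And>\<omega>. \<omega> \<in> A \<Longrightarrow> (\<Prod>j<N. cmod (X j \<omega>)) \<le> t"
  shows "prob A \<le> (S\<^sup>2 / (1 - 4 powr (s - 1))) ^ N * t powr (2 * s) /
     (((S / 2) powr (2 * s)) ^ N * (real N ^ N * (\<Prod>n<N. (a n * \<rho> ^ n)\<^sup>2)))"
proof -
  let ?C = "real N ^ N * (\<Prod>n<N. (a n * \<rho> ^ n)\<^sup>2)"
  let ?L = "((S / 2) powr (2 * s)) ^ N / t powr (2 * s)"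
  let ?G = "1 - 4 powr (s - 1) :: real"
  have G: "?G > 0" using s by (simp add: powr_less_one)
  have C: "?C > 0" using N a \<rho> by (intro mult_pos_pos prod_pos zero_less_power) simp_all
  have L: "?L > 0" using S t by simp
  have pt: "ennreal ?L * indicator A \<omega> \<le> (\<Prod>j<N. dyadic_weight s S (X j \<omega>))" for \<omega>
  proof (cases "\<omega> \<in> A")
    case True
    have pos: "(\<Prod>j<N. cmod (X j \<omega>)) > 0" using small[OF True] by (intro prod_pos) auto
    have mono: "(\<Prod>j<N. cmod (X j \<omega>)) powr (2 * s) \<le> t powr (2 * s)"
      by (rule powr_mono2) (use s less_imp_le[OF pos] prod[OF True] in auto)
    have pos': "(\<Prod>j<N. cmod (X j \<omega>)) powr (2 * s) > 0" "t powr (2 * s) > 0"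
      using pos t by (metis powr_gt_zero less_irrefl)+
    have "?L \<le> ((S / 2) powr (2 * s)) ^ N / (\<Prod>j<N. cmod (X j \<omega>)) powr (2 * s)"
      by (rule divide_left_mono[OF mono _ mult_pos_pos[OF pos'(2,1)]]) simp
    also have "(\<Prod>j<N. cmod (X j \<omega>)) powr (2 * s) = (\<Prod>j<N. cmod (X j \<omega>) powr (2 * s))"
      by (rule prod_powr_distrib)
    also have "((S / 2) powr (2 * s)) ^ N / (\<Prod>j<N. cmod (X j \<omega>) powr (2 * s)) =
        (\<Prod>j<N. (S / 2) powr (2 * s) / cmod (X j \<omega>) powr (2 * s))"
      by (simp add: prod_dividef)
    also have "\<dots> = (\<Prod>j<N. (S / (2 * cmod (X j \<omega>))) powr (2 * s))"
      using S by (simp add: powr_divide[symmetric])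
    finally have "ennreal ?L \<le> (\<Prod>j<N. ennreal ((S / (2 * cmod (X j \<omega>))) powr (2 * s)))"
      by (subst prod_ennreal) (auto intro: ennreal_leI)
    also have "\<dots> \<le> (\<Prod>j<N. dyadic_weight s S (X j \<omega>))"
      using small[OF True] s by (intro prod_mono_ennreal dyadic_weight_ge) auto
    finally show ?thesis using True by simp
  qed simp
  have "ennreal ?C * (ennreal ?L * emeasure M A) = ennreal ?C * (\<integral>\<^sup>+\<omega>. ennreal ?L * indicator A \<omega> \<partial>M)"
    by (simp add: nn_integral_cmult_indicator[OF A])
  also have "\<dots> \<le> ennreal ?C * (\<integral>\<^sup>+\<omega>. (\<Prod>j<N. dyadic_weight s S (X j \<omega>)) \<partial>M)"
    by (intro mult_left_mono nn_integral_mono pt) simp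
  also have "\<dots> \<le> ennreal (1 / pi) ^ N * (\<Prod>j<N. \<integral>\<^sup>+w. dyadic_weight s S w \<partial>lborel)"
    unfolding X by (rule nn_integral_prod_values_le[OF N \<rho> a]) (use b in auto)
  also have "\<dots> = ennreal ((S\<^sup>2 / ?G) ^ N)"
    using G S by (simp add: nn_integral_dyadic_weight[OF S s(2)] ennreal_power ennreal_mult[symmetric]
        power_mult_distrib[symmetric])
  finally have "?C * (?L * prob A) \<le> (S\<^sup>2 / ?G) ^ N"
    using C L G by (simp add: emeasure_eq_measure ennreal_mult[symmetric] del: ennreal_mult)
  then have "prob A \<le> (S\<^sup>2 / ?G) ^ N / (?C * ?L)"
    using mult_pos_pos[OF C L] by (subst pos_le_divide_eq) (simp_all add: mult_ac)
  also have "\<dots> = (S\<^sup>2 / ?G) ^ N * t powr (2 * s) / (((S / 2) powr (2 * s)) ^ N * ?C)"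
    by simp
  finally show ?thesis .
qed

end

section \<open>The random series\<close>

locale hyperbolic_series = gaussian_coefficients M \<zeta> for M :: "'w measure" and \<zeta> +
  fixes a :: "nat \<Rightarrow> real" and \<beta> c\<^sub>1 C\<^sub>1 :: real
  assumes \<beta>_pos: "\<beta> > 0"
    and a_pos: "\<And>n. a n > 0"
    and a_0: "a 0 = 1"
    and c\<^sub>1_pos: "0 < c\<^sub>1"
    and a_ge: "\<And>n. n \<ge> 1 \<Longrightarrow> c\<^sub>1 * real n powr \<beta> \<le> a n"
    and a_le: "\<And>n. n \<ge> 1 \<Longrightarrow> a n \<le> C\<^sub>1 * real n powr \<beta>"
begin

lemma C\<^sub>1_pos: "0 < C\<^sub>1"
  using a_le[of 1] a_pos[of 1] by simp

text \<open>Apply \<open>x \<le> exp x\<close> to \<open>x = real n * \<delta> / (4 * k)\<close> and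
  raise to the power \<open>k\<close>. The bound is uniform in \<open>n\<close> and \<delta>:
  polynomial growth is traded for a power of \<open>1 / \<delta>\<close> and a quarter of the decay
  rate of \<open>(1 - \<delta>) ^ n\<close>.\<close>

lemma coefficient_growth:
  obtains D :: real and k :: nat where "D \<ge> 1"
    "\<And>\<delta> n. 0 < \<delta> \<Longrightarrow> \<delta> \<le> 1 \<Longrightarrow> a n \<le> D * (1 / \<delta>) ^ k * exp (real n * \<delta> / 4)"
proof -
  define k where "k = nat \<lceil>\<beta>\<rceil>"
  have "0 < \<lceil>\<beta>\<rceil>" using \<beta>_pos by simp
  then have k: "k \<ge> 1" "\<beta> \<le> real k" unfolding k_def by linarith+
  define D where "D = max 1 (C\<^sub>1 * (4 * real k) ^ k)"
  have "a n \<le> D * (1 / \<delta>) ^ k * exp (real n * \<delta> / 4)" if \<delta>: "0 < \<delta>" "\<delta> \<le> 1" for \<delta> n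
  proof (cases "n = 0")
    case True
    have "1 * 1 \<le> D * (1 / \<delta>) ^ k"
      using \<delta> by (intro mult_mono one_le_power) (auto simp: D_def)
    then show ?thesis using True a_0 by simp
  next
    case False
    have "real n * \<delta> / (4 * k) \<le> exp (real n * \<delta> / (4 * k))"
      using exp_ge_add_one_self[of "real n * \<delta> / (4 * k)"] by linarith
    then have "(real n * \<delta> / (4 * k)) ^ k \<le> exp (real n * \<delta> / (4 * k)) ^ k"
      using \<delta> by (intro power_mono) auto
    also have "\<dots> = exp (real n * \<delta> / 4)"
      using k by (simp add: exp_of_nat_mult[symmetric])
    finally have "(4 * real k / \<delta>) ^ k * (real n * \<delta> / (4 * k)) ^ k \<le> (4 * real k / \<delta>) ^ k * exp (real n * \<delta> / 4)"
      using \<delta> by (intro mult_left_mono) auto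
    then have nk: "real n ^ k \<le> (4 * real k / \<delta>) ^ k * exp (real n * \<delta> / 4)"
      using \<delta> k by (simp add: power_mult_distrib[symmetric])
    have "a n \<le> C\<^sub>1 * real n powr \<beta>" using False by (intro a_le) simp
    also have "\<dots> \<le> C\<^sub>1 * real n powr real k"
      using False k C\<^sub>1_pos by (intro mult_left_mono powr_mono) auto
    also have "\<dots> = C\<^sub>1 * real n ^ k" using False by (simp add: powr_realpow)
    also have "\<dots> \<le> C\<^sub>1 * ((4 * real k / \<delta>) ^ k * exp (real n * \<delta> / 4))"
      using nk C\<^sub>1_pos by (intro mult_left_mono) auto
    also have "\<dots> = (C\<^sub>1 * (4 * real k) ^ k) * (1 / \<delta>) ^ k * exp (real n * \<delta> / 4)"
      by (simp add: power_divide)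
    also have "\<dots> \<le> D * (1 / \<delta>) ^ k * exp (real n * \<delta> / 4)"
      using \<delta> by (intro mult_right_mono) (auto simp: D_def)
    finally show ?thesis .
  qed
  moreover have "D \<ge> 1" by (simp add: D_def)
  ultimately show ?thesis using that by blast
qed

text \<open>Of the decay rate \<delta> of \<open>(1 - \<delta>) ^ n\<close>, a quarter pays for the
  growth of \<open>a n\<close>; the rest leaves a geometric majorant, used below for convergence,
  for tails and for the maximum of the series.\<close>

lemma coefficient_decay:
  obtains D :: real and k :: nat where "D \<ge> 1"
    "\<And>\<delta> n. 0 < \<delta> \<Longrightarrow> \<delta> < 1 \<Longrightarrow> a n * (1 - \<delta>) ^ n \<le> D * (1 / \<delta>) ^ k * exp (- (3 * \<delta> / 4)) ^ n"
proof -
  obtain D k where D: "D \<ge> 1" and Dk: "\<And>\<delta> n. 0 < \<delta> \<Longrightarrow> \<delta> \<le> 1 \<Longrightarrow> a n \<le> D * (1 / \<delta>) ^ k * exp (real n * \<delta> / 4)"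
    using coefficient_growth by blast
  have "a n * (1 - \<delta>) ^ n \<le> D * (1 / \<delta>) ^ k * exp (- (3 * \<delta> / 4)) ^ n" if \<delta>: "0 < \<delta>" "\<delta> < 1" for \<delta> n
  proof -
    have "(1 - \<delta>) ^ n \<le> exp (- \<delta>) ^ n"
      using exp_ge_add_one_self[of "- \<delta>"] \<delta> by (intro power_mono) auto
    then have "a n * (1 - \<delta>) ^ n \<le> (D * (1 / \<delta>) ^ k * exp (real n * \<delta> / 4)) * exp (- \<delta>) ^ n"
      using Dk[of \<delta> n] a_pos[of n] \<delta> D by (intro mult_mono) auto
    also have "\<dots> = D * (1 / \<delta>) ^ k * (exp (real n * \<delta> / 4) * exp (real n * - \<delta>))"
      by (simp only: exp_of_nat_mult mult.assoc)
    also have "exp (real n * \<delta> / 4) * exp (real n * - \<delta>) = exp (real n * - (3 * \<delta> / 4))"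
      unfolding exp_add[symmetric] by (rule arg_cong[of _ _ exp]) (simp add: field_simps)
    finally show ?thesis by (simp only: exp_of_nat_mult)
  qed
  with D that show ?thesis by blast
qed

definition F :: "'w \<Rightarrow> complex \<Rightarrow> complex" where
  "F = gaussian_series \<zeta> a"

definition converges :: "'w \<Rightarrow> bool" where
  "converges \<omega> \<longleftrightarrow> conv_radius (\<lambda>n. \<zeta> n \<omega> * of_real (a n)) \<ge> 1"

lemma F_eq: "F \<omega> z = (\<Sum>n. \<zeta> n \<omega> * of_real (a n) * z ^ n)"
  by (simp add: F_def gaussian_series_def)

lemma Hole_eq: "Hole M \<zeta> a r = {\<omega> \<in> space M. converges \<omega> \<and> (\<forall>z. cmod z \<le> r \<longrightarrow> F \<omega> z \<noteq> 0)}"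
  by (simp add: Hole_def converges_def F_def)

lemma F_sums:
  assumes "converges \<omega>" "cmod z < 1"
  shows "(\<lambda>n. \<zeta> n \<omega> * of_real (a n) * z ^ n) sums F \<omega> z"
proof -
  have "ereal (cmod z) < conv_radius (\<lambda>n. \<zeta> n \<omega> * of_real (a n))"
    using assms less_le_trans[of "ereal (cmod z)" 1] by (simp add: converges_def)
  then show ?thesis unfolding F_eq by (intro summable_sums summable_in_conv_radius)
qed

lemma F_holomorphic: "converges \<omega> \<Longrightarrow> F \<omega> holomorphic_on ball 0 1"
  by (rule power_series_holomorphic[where a = "\<lambda>n. \<zeta> n \<omega> * of_real (a n)"]) (use F_sums in auto)

lemma F_0: "converges \<omega> \<Longrightarrow> F \<omega> 0 = \<zeta> 0 \<omega>"
  unfolding F_eq by (subst powser_zero) (simp add: a_0)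

lemma F_measurable [measurable]: "(\<lambda>\<omega>. F \<omega> z) \<in> borel_measurable M"
  unfolding F_eq by (rule borel_measurable_suminf) measurable

lemma converges_measurable [measurable]: "Measurable.pred M converges"
  unfolding converges_def conv_radius_def by measurable

text \<open>First moments are bounded, so at a fixed radius below 1 the series of absolute values
  has finite expectation. The radii \<open>1 - 1 / (m + 2)\<close> are countably many and tend to
  1.\<close>

lemma AE_converges: "AE \<omega> in M. converges \<omega>"
proof -
  obtain D k where D: "D \<ge> 1"
    and Dk: "\<And>\<delta> n. 0 < \<delta> \<Longrightarrow> \<delta> < 1 \<Longrightarrow> a n * (1 - \<delta>) ^ n \<le> D * (1 / \<delta>) ^ k * exp (- (3 * \<delta> / 4)) ^ n"
    using coefficient_decay by blast
  have "AE \<omega> in M. summable (\<lambda>n. cmod (\<zeta> n \<omega>) * (a n * (1 - 1 / (real m + 2)) ^ n))" for m :: nat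
  proof -
    define \<delta> where "\<delta> = 1 / (real m + 2)"
    have \<delta>: "0 < \<delta>" "\<delta> \<le> 1" "\<delta> < 1" by (auto simp: \<delta>_def field_simps)
    have sm: "summable (\<lambda>n. 2 * (D * (1 / \<delta>) ^ k * exp (- (3 * \<delta> / 4)) ^ n))"
      using \<delta> by (intro summable_mult summable_geometric) auto
    have tm: "(\<lambda>\<omega>. ennreal (cmod (\<zeta> n \<omega>) * (a n * (1 - \<delta>) ^ n))) \<in> borel_measurable M" for n
      by measurable
    have "(\<integral>\<^sup>+\<omega>. (\<Sum>n. ennreal (cmod (\<zeta> n \<omega>) * (a n * (1 - \<delta>) ^ n))) \<partial>M) =
        (\<Sum>n. \<integral>\<^sup>+\<omega>. ennreal (cmod (\<zeta> n \<omega>) * (a n * (1 - \<delta>) ^ n)) \<partial>M)"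
      by (rule nn_integral_suminf) (rule tm)
    also have "\<dots> \<le> (\<Sum>n. ennreal (2 * (D * (1 / \<delta>) ^ k * exp (- (3 * \<delta> / 4)) ^ n)))"
    proof (intro suminf_le)
      fix n
      have "(\<integral>\<^sup>+\<omega>. ennreal (cmod (\<zeta> n \<omega>) * (a n * (1 - \<delta>) ^ n)) \<partial>M) =
          (\<integral>\<^sup>+\<omega>. ennreal (cmod (\<zeta> n \<omega>)) * ennreal (a n * (1 - \<delta>) ^ n) \<partial>M)"
        using a_pos[of n] \<delta> by (intro nn_integral_cong ennreal_mult) simp_all
      also have "\<dots> = (\<integral>\<^sup>+\<omega>. ennreal (cmod (\<zeta> n \<omega>)) \<partial>M) * ennreal (a n * (1 - \<delta>) ^ n)"
        by (rule nn_integral_multc) simp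
      also have "\<dots> \<le> 2 * ennreal (D * (1 / \<delta>) ^ k * exp (- (3 * \<delta> / 4)) ^ n)"
        by (rule mult_mono[OF first_moment_\<zeta> ennreal_leI[OF Dk[OF \<delta>(1,3)]]]) simp_all
      also have "\<dots> = ennreal (2 * (D * (1 / \<delta>) ^ k * exp (- (3 * \<delta> / 4)) ^ n))"
      proof -
        have "0 \<le> D * (1 / \<delta>) ^ k * exp (- (3 * \<delta> / 4)) ^ n" using D \<delta> by simp
        from ennreal_mult[OF zero_le_numeral this, of "num.Bit0 num.One"] show ?thesis by simp
      qed
      finally show "(\<integral>\<^sup>+\<omega>. ennreal (cmod (\<zeta> n \<omega>) * (a n * (1 - \<delta>) ^ n)) \<partial>M) \<le>
        ennreal (2 * (D * (1 / \<delta>) ^ k * exp (- (3 * \<delta> / 4)) ^ n))" .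
    qed auto
    also have "\<dots> < \<infinity>"
      unfolding infinity_ennreal_def less_top[symmetric]
      by (rule ennreal_suminf_neq_top[OF sm]) (use D \<delta> in simp)
    finally have "(\<integral>\<^sup>+\<omega>. (\<Sum>n. ennreal (cmod (\<zeta> n \<omega>) * (a n * (1 - \<delta>) ^ n))) \<partial>M) \<noteq> \<infinity>"
      by simp
    then have "AE \<omega> in M. (\<Sum>n. ennreal (cmod (\<zeta> n \<omega>) * (a n * (1 - \<delta>) ^ n))) \<noteq> \<infinity>"
      by (intro nn_integral_PInf_AE borel_measurable_suminf_order tm)
    then show ?thesis
    proof eventually_elim
      case (elim \<omega>)
      show ?case unfolding \<delta>_def[symmetric]
      proof (rule summable_suminf_not_top)
        show "0 \<le> cmod (\<zeta> n \<omega>) * (a n * (1 - \<delta>) ^ n)" for n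
          using a_pos[of n] \<delta> by simp
        show "(\<Sum>n. ennreal (cmod (\<zeta> n \<omega>) * (a n * (1 - \<delta>) ^ n))) \<noteq> top"
          using elim unfolding infinity_ennreal_def .
      qed
    qed
  qed
  then have "AE \<omega> in M. \<forall>m. summable (\<lambda>n. cmod (\<zeta> n \<omega>) * (a n * (1 - 1 / (real m + 2)) ^ n))"
    by (subst AE_all_countable) blast
  then show ?thesis
  proof eventually_elim
    case (elim \<omega>)
    show ?case unfolding converges_def
    proof (rule conv_radius_geI_ex')
      fix r :: real assume r: "0 < r" "ereal r < 1"
      then have r1: "r < 1" by simp
      obtain m :: nat where m: "1 / (1 - r) < real m" using reals_Archimedean2 by blast
      then have "1 / (real m + 2) \<le> 1 - r" using r1 by (simp add: field_simps)
      then have rm: "r \<le> 1 - 1 / (real m + 2)" by simp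
      show "summable (\<lambda>n. \<zeta> n \<omega> * of_real (a n) * of_real r ^ n)"
      proof (rule summable_comparison_test'[OF elim[rule_format, of m]])
        fix n :: nat assume "n \<ge> 0"
        have "r ^ n \<le> (1 - 1 / (real m + 2)) ^ n" using rm r by (intro power_mono) auto
        then show "cmod (\<zeta> n \<omega> * of_real (a n) * of_real r ^ n) \<le> cmod (\<zeta> n \<omega>) * (a n * (1 - 1 / (real m + 2)) ^ n)"
          using a_pos[of n] r by (simp add: norm_mult norm_power mult.assoc mult_left_mono)
      qed
    qed
  qed
qed

lemma prob_inter_converges: "A \<in> events \<Longrightarrow> prob {\<omega> \<in> A. converges \<omega>} = prob A"
proof (rule finite_measure_eq_AE)
  show "AE \<omega> in M. (\<omega> \<in> {\<omega> \<in> A. converges \<omega>}) = (\<omega> \<in> A)"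
    using AE_converges by eventually_elim auto
  assume [measurable]: "A \<in> events"
  show "{\<omega> \<in> A. converges \<omega>} \<in> events" by measurable
qed

text \<open>On the compact disc a continuous function without zeros is bounded away from 0, so the
  condition can be tested on a countable dense set. The uniform bound \<open>1 / (m + 1)\<close> is
  essential: a function may vanish on the disc and nowhere on the dense set.\<close>

lemma Hole_measurable:
  assumes r: "0 < r" "r < 1"
  shows "Hole M \<zeta> a r \<in> events"
proof -
  obtain T where T: "countable T" "T \<subseteq> cball (0::complex) r" "cball 0 r \<subseteq> closure T"
    using separable by blast
  have cl: "closure T = cball 0 r" using T(2,3) closure_minimal[OF T(2) closed_cball] by blast
  have "Hole M \<zeta> a r = {\<omega> \<in> space M. converges \<omega> \<and> (\<exists>m::nat. \<forall>z\<in>T. 1 / (real m + 1) \<le> cmod (F \<omega> z))}"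
  proof -
    have "(\<forall>z. cmod z \<le> r \<longrightarrow> F \<omega> z \<noteq> 0) \<longleftrightarrow> (\<exists>m::nat. \<forall>z\<in>T. 1 / (real m + 1) \<le> cmod (F \<omega> z))"
      if "converges \<omega>" for \<omega>
    proof -
      have cont: "continuous_on (cball 0 r) (\<lambda>z. cmod (F \<omega> z))"
        using r by (intro continuous_intros holomorphic_on_imp_continuous_on
            holomorphic_on_subset[OF F_holomorphic[OF that]]) auto
      show ?thesis
      proof
        assume nz: "\<forall>z. cmod z \<le> r \<longrightarrow> F \<omega> z \<noteq> 0"
        obtain z0 where z0: "z0 \<in> cball 0 r" "\<And>z. z \<in> cball 0 r \<Longrightarrow> cmod (F \<omega> z0) \<le> cmod (F \<omega> z)"
          using continuous_attains_inf[OF compact_cball _ cont] r by auto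
        have "cmod (F \<omega> z0) > 0" using nz z0(1) by auto
        then obtain m :: nat where "1 / (real m + 1) < cmod (F \<omega> z0)"
          using reals_Archimedean[of "cmod (F \<omega> z0)"] by (auto simp: divide_inverse add.commute)
        then show "\<exists>m::nat. \<forall>z\<in>T. 1 / (real m + 1) \<le> cmod (F \<omega> z)"
          using z0(2) T(2) by (intro exI[of _ m]) (meson less_imp_le order_trans subsetD)
      next
        assume "\<exists>m::nat. \<forall>z\<in>T. 1 / (real m + 1) \<le> cmod (F \<omega> z)"
        then obtain m :: nat where m: "\<And>z. z \<in> T \<Longrightarrow> 1 / (real m + 1) \<le> cmod (F \<omega> z)" by blast
        have "1 / (real m + 1) \<le> cmod (F \<omega> z)" if "cmod z \<le> r" for z
          using continuous_ge_on_closure[of T "\<lambda>z. cmod (F \<omega> z)" z "1 / (real m + 1)"] cont that m cl by auto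
        moreover have "1 / (real m + 1) > 0" by simp
        ultimately show "\<forall>z. cmod z \<le> r \<longrightarrow> F \<omega> z \<noteq> 0" by (metis norm_zero not_less)
      qed
    qed
    then show ?thesis unfolding Hole_eq by blast
  qed
  also have "\<dots> \<in> events"
    using T(1) by (intro sets.sets_Collect_conj sets.sets_Collect_countable_Ex sets.sets_Collect_countable_Ball) measurable
  finally show ?thesis .
qed

end

section \<open>Lower bound for the hole probability\<close>

lemma cmod_cis_diff_le: "cmod (cis s - cis t) \<le> \<bar>s - t\<bar>"
proof -
  have "(cmod (cis s - cis t))\<^sup>2 = 2 - 2 * cos (s - t)"
    using sin_cos_squared_add[of s] sin_cos_squared_add[of t]
    by (simp add: cmod_power2 power2_diff cos_diff algebra_simps)
  also have "\<dots> = (2 * sin ((s - t) / 2))\<^sup>2"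
  proof -
    have "cos (s - t) = 1 - 2 * (sin ((s - t) / 2))\<^sup>2"
      using cos_double_sin[of "(s - t) / 2"] by (simp only: times_divide_eq_right nonzero_mult_div_cancel_left)
    then show ?thesis by (simp add: power_mult_distrib)
  qed
  also have "\<dots> \<le> (s - t)\<^sup>2"
    using abs_sin_x_le_abs_x[of "(s - t) / 2"] by (subst abs_le_square_iff[symmetric]) (simp add: abs_mult)
  finally show ?thesis by (simp add: abs_le_square_iff[symmetric])
qed

lemma unity_root_net:
  assumes "cmod u = 1" and m: "m > 0"
  shows "\<exists>k<m. cmod (u - unity_root m k) \<le> 2 * pi / real m"
proof -
  define t where "t = Arg2pi u"
  have t: "0 \<le> t" "t < 2 * pi" "u = cis t"
    using Arg2pi[of u] assms by (auto simp: t_def cis_conv_exp is_Arg_def)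
  define k where "k = nat \<lfloor>t * real m / (2 * pi)\<rfloor>"
  have "0 \<le> t * real m / (2 * pi)" using t by simp
  then have k: "real k \<le> t * real m / (2 * pi)" "t * real m / (2 * pi) < real k + 1"
    by (simp_all add: k_def)
  have "t * real m < 2 * pi * real m" using t m by simp
  then have "t * real m / (2 * pi) < real m" by (simp add: field_simps)
  then have "k < m" using k by linarith
  moreover have "cmod (u - unity_root m k) \<le> \<bar>t - 2 * pi * real k / real m\<bar>"
    unfolding t(3) unity_root_def by (rule cmod_cis_diff_le)
  moreover have "2 * pi * real k / real m \<le> t" "t \<le> 2 * pi * real k / real m + 2 * pi / real m"
    using k m by (simp_all add: field_simps)
  ultimately show ?thesis by (intro exI[of _ k]) auto
qed

section \<open>Coefficients confined to a product of sets\<close>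

context gaussian_coefficients
begin

lemma nn_integral_prod_\<zeta>:
  assumes I: "finite I" and g: "\<And>n. n \<in> I \<Longrightarrow> g n \<in> borel_measurable (borel :: complex measure)"
  shows "(\<integral>\<^sup>+\<omega>. (\<Prod>n\<in>I. g n (\<zeta> n \<omega>)) \<partial>M) = (\<Prod>n\<in>I. \<integral>\<^sup>+\<omega>. g n (\<zeta> n \<omega>) \<partial>M)"
proof (rule indep_vars_nn_integral[OF I])
  have "indep_vars (\<lambda>_. borel) \<zeta> I" using indep by (rule indep_vars_subset) simp
  then show "indep_vars (\<lambda>_. borel) (\<lambda>n \<omega>. g n (\<zeta> n \<omega>)) I"
    by (rule indep_vars_compose2) (use g in simp)
qed simp

definition box :: "nat set \<Rightarrow> (nat \<Rightarrow> complex set) \<Rightarrow> 'w set" where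
  "box I A = {\<omega> \<in> space M. \<forall>n\<in>I. \<zeta> n \<omega> \<in> A n}"

lemma nn_integral_indicator_\<zeta>:
  assumes "A \<in> sets borel"
  shows "(\<integral>\<^sup>+\<omega>. indicator A (\<zeta> n \<omega>) \<partial>M) = emeasure M {\<omega> \<in> space M. \<zeta> n \<omega> \<in> A}"
  using emeasure_\<zeta>[OF assms, of n] nn_integral_\<zeta>[of "indicator A" n] assms by simp

lemma indicator_box:
  assumes "finite I" "\<omega> \<in> space M"
  shows "indicator (box I A) \<omega> = (\<Prod>n\<in>I. indicator (A n) (\<zeta> n \<omega>) :: ennreal)"
  using assms by (auto simp: box_def indicator_def prod_zero_iff intro: prod.neutral)

lemma box_measurable [measurable]:
  assumes I: "finite I" and A: "\<And>n. n \<in> I \<Longrightarrow> A n \<in> sets borel"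
  shows "box I A \<in> events"
proof (cases "I = {}")
  case False
  have "{\<omega> \<in> space M. \<zeta> n \<omega> \<in> A n} \<in> events" if "n \<in> I" for n
  proof -
    have "{\<omega> \<in> space M. \<zeta> n \<omega> \<in> A n} = \<zeta> n -` A n \<inter> space M" by auto
    then show ?thesis using measurable_sets[OF \<zeta>_measurable A[OF that], of n] by simp
  qed
  then show ?thesis unfolding box_def by (rule sets.sets_Collect_finite_All'[OF _ I False])
qed (simp add: box_def)

lemma emeasure_box:
  assumes I: "finite I" and A: "\<And>n. n \<in> I \<Longrightarrow> A n \<in> sets borel"
  shows "emeasure M (box I A) = (\<Prod>n\<in>I. emeasure M {\<omega> \<in> space M. \<zeta> n \<omega> \<in> A n})"
proof -
  have "emeasure M (box I A) = (\<integral>\<^sup>+\<omega>. indicator (box I A) \<omega> \<partial>M)"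
    using I A by (intro nn_integral_indicator[symmetric] box_measurable)
  also have "\<dots> = (\<integral>\<^sup>+\<omega>. (\<Prod>n\<in>I. indicator (A n) (\<zeta> n \<omega>)) \<partial>M)"
    by (intro nn_integral_cong indicator_box I)
  also have "\<dots> = (\<Prod>n\<in>I. \<integral>\<^sup>+\<omega>. indicator (A n) (\<zeta> n \<omega>) \<partial>M)"
    using I by (rule nn_integral_prod_\<zeta>) (use A in simp)
  finally show ?thesis using A by (simp add: nn_integral_indicator_\<zeta>)
qed

text \<open>Restriction to the box keeps the coefficients independent, and those in \<open>J\<close>
  rotation invariant. Each index of \<open>J\<close> costs at most
  \<open>exp (\<epsilon>\<^sup>2)\<close> in the exponential moment. The factor
  \<open>prob (box I A)\<close> makes this a conditional estimate, which is vital because the box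
  itself is extremely unlikely.\<close>

lemma box_chernoff:
  assumes I: "finite I" and J: "J \<subseteq> I" and A: "\<And>n. n \<in> I \<Longrightarrow> A n \<in> sets borel"
    and AJ: "\<And>n. n \<in> J \<Longrightarrow> A n = cball 0 (b n) \<and> 0 \<le> b n \<and> cmod (e n) * b n \<le> \<epsilon>"
  shows "prob {\<omega> \<in> box I A. x \<le> (\<Sum>n\<in>J. Re (e n * \<zeta> n \<omega>))}
    \<le> exp (real (card J) * \<epsilon>\<^sup>2 - x) * prob (box I A)"
proof -
  define g where "g n z = indicator (A n) z * (if n \<in> J then ennreal (exp (Re (e n * z))) else 1)" for n z
  have g: "g n \<in> borel_measurable borel" if "n \<in> I" for n
  proof -
    have "(\<lambda>z. ennreal (exp (Re (e n * z)))) \<in> borel_measurable borel"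
      by (intro measurable_compose[OF _ measurable_ennreal] borel_measurable_continuous_onI continuous_intros)
    then show ?thesis unfolding g_def using A[OF that]
      by (cases "n \<in> J") (auto intro!: borel_measurable_times_ennreal borel_measurable_indicator)
  qed
  have Jf: "finite J" using finite_subset[OF J I] .
  let ?E = "{\<omega> \<in> box I A. x \<le> (\<Sum>n\<in>J. Re (e n * \<zeta> n \<omega>))}"
  have box: "box I A \<in> events" using I A by (rule box_measurable)
  have E: "?E \<in> events"
  proof -
    have [measurable]: "(\<lambda>\<omega>. \<Sum>n\<in>J. Re (e n * \<zeta> n \<omega>)) \<in> borel_measurable M"
      by measurable
    have eq: "?E = box I A \<inter> {\<omega> \<in> space M. x \<le> (\<Sum>n\<in>J. Re (e n * \<zeta> n \<omega>))}"
      by (auto simp: box_def)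
    have "{\<omega> \<in> space M. x \<le> (\<Sum>n\<in>J. Re (e n * \<zeta> n \<omega>))} \<in> events" by measurable
    then show ?thesis unfolding eq using box by (rule sets.Int[rotated])
  qed
  have bound: "(\<integral>\<^sup>+\<omega>. g n (\<zeta> n \<omega>) \<partial>M) \<le> (if n \<in> J then ennreal (exp (\<epsilon>\<^sup>2)) else 1) * emeasure M {\<omega> \<in> space M. \<zeta> n \<omega> \<in> A n}"
    if n: "n \<in> I" for n
  proof (cases "n \<in> J")
    case True
    have "(\<integral>\<^sup>+\<omega>. g n (\<zeta> n \<omega>) \<partial>M) \<le> ennreal (exp ((cmod (e n) * b n)\<^sup>2)) * emeasure M {\<omega> \<in> space M. cmod (\<zeta> n \<omega>) \<le> b n}"
      using truncated_exp_moment[of "b n" n "e n"] AJ[OF True] True by (simp add: g_def)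
    also have "\<dots> \<le> ennreal (exp (\<epsilon>\<^sup>2)) * emeasure M {\<omega> \<in> space M. cmod (\<zeta> n \<omega>) \<le> b n}"
      using AJ[OF True] by (intro mult_right_mono ennreal_leI) (auto intro!: power_mono)
    finally show ?thesis using AJ[OF True] True by simp
  next
    case False
    then show ?thesis using A[OF n] by (simp add: g_def nn_integral_indicator_\<zeta>)
  qed
  have "ennreal (exp x) * emeasure M ?E = (\<integral>\<^sup>+\<omega>. ennreal (exp x) * indicator ?E \<omega> \<partial>M)"
    by (rule nn_integral_cmult_indicator[symmetric, OF E])
  also have "\<dots> \<le> (\<integral>\<^sup>+\<omega>. (\<Prod>n\<in>I. g n (\<zeta> n \<omega>)) \<partial>M)"
  proof (rule nn_integral_mono)
    fix \<omega> assume \<omega>: "\<omega> \<in> space M"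
    show "ennreal (exp x) * indicator ?E \<omega> \<le> (\<Prod>n\<in>I. g n (\<zeta> n \<omega>))"
    proof (cases "\<omega> \<in> ?E")
      case True
      have "(\<Prod>n\<in>I. g n (\<zeta> n \<omega>)) = (\<Prod>n\<in>I. if n \<in> J then ennreal (exp (Re (e n * \<zeta> n \<omega>))) else 1)"
        using True by (intro prod.cong) (auto simp: g_def box_def)
      also have "\<dots> = (\<Prod>n\<in>J. ennreal (exp (Re (e n * \<zeta> n \<omega>))))"
        using I J by (subst prod.inter_restrict[symmetric]) (auto simp: Int_absorb1)
      also have "\<dots> = ennreal (exp (\<Sum>n\<in>J. Re (e n * \<zeta> n \<omega>)))"
        using Jf by (simp add: exp_sum prod_ennreal)
      finally show ?thesis using True by (auto intro: ennreal_leI)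
    qed simp
  qed
  also have "\<dots> = (\<Prod>n\<in>I. \<integral>\<^sup>+\<omega>. g n (\<zeta> n \<omega>) \<partial>M)"
    using I g by (rule nn_integral_prod_\<zeta>)
  also have "\<dots> \<le> (\<Prod>n\<in>I. (if n \<in> J then ennreal (exp (\<epsilon>\<^sup>2)) else 1) * emeasure M {\<omega> \<in> space M. \<zeta> n \<omega> \<in> A n})"
    by (intro prod_mono_ennreal bound)
  also have "\<dots> = (\<Prod>n\<in>I. if n \<in> J then ennreal (exp (\<epsilon>\<^sup>2)) else 1) * emeasure M (box I A)"
    using I A by (simp add: prod.distrib emeasure_box)
  also have "(\<Prod>n\<in>I. if n \<in> J then ennreal (exp (\<epsilon>\<^sup>2)) else 1) = (\<Prod>n\<in>J. ennreal (exp (\<epsilon>\<^sup>2)))"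
    using I J by (subst prod.inter_restrict[symmetric]) (auto simp: Int_absorb1)
  also have "\<dots> = ennreal (exp (real (card J) * \<epsilon>\<^sup>2))"
    by (simp add: ennreal_power exp_of_nat_mult)
  finally have "ennreal (exp x * prob ?E) \<le> ennreal (exp (real (card J) * \<epsilon>\<^sup>2) * prob (box I A))"
    by (simp add: emeasure_eq_measure ennreal_mult)
  then have "exp x * prob ?E \<le> exp (real (card J) * \<epsilon>\<^sup>2) * prob (box I A)"
    by (subst (asm) ennreal_le_iff) auto
  then show ?thesis by (simp add: exp_diff field_simps)
qed

text \<open>Markov's inequality for coefficients outside the box, which are independent of it; the
  factor 2 bounds their first absolute moment. The sum is taken in \<open>ennreal\<close>, so that
  convergence need not be known beforehand.\<close>

lemma box_tail:
  assumes I: "finite I" and A: "\<And>n. n \<in> I \<Longrightarrow> A n \<in> sets borel"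
    and f: "\<And>n. f n \<notin> I" and c: "\<And>n. 0 \<le> c n" and sm: "summable c" and x: "x > 0"
  shows "prob {\<omega> \<in> box I A. ennreal x \<le> (\<Sum>n. ennreal (c n * cmod (\<zeta> (f n) \<omega>)))}
    \<le> 2 * suminf c / x * prob (box I A)"
proof -
  let ?T = "\<lambda>\<omega>. \<Sum>n. ennreal (c n * cmod (\<zeta> (f n) \<omega>))"
  let ?E = "{\<omega> \<in> box I A. ennreal x \<le> ?T \<omega>}"
  have box: "box I A \<in> events" using I A by (rule box_measurable)
  have eb: "emeasure M (box I A) = (\<Prod>n\<in>I. emeasure M {\<omega> \<in> space M. \<zeta> n \<omega> \<in> A n})"
    using I A by (rule emeasure_box)
  have tm: "(\<lambda>\<omega>. ennreal (c n * cmod (\<zeta> (f n) \<omega>))) \<in> borel_measurable M" for n by measurable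
  have T: "?T \<in> borel_measurable M" by (rule borel_measurable_suminf_order) (rule tm)
  have E: "?E \<in> events"
  proof -
    have "?E = box I A \<inter> (?T -` {ennreal x..} \<inter> space M)" by (auto simp: box_def)
    moreover have "?T -` {ennreal x..} \<inter> space M \<in> events"
      by (rule measurable_sets[OF T]) simp
    ultimately show ?thesis using box by simp
  qed
  have one: "(\<integral>\<^sup>+\<omega>. ennreal (c n * cmod (\<zeta> (f n) \<omega>)) * indicator (box I A) \<omega> \<partial>M)
      \<le> ennreal (c n) * 2 * emeasure M (box I A)" for n
  proof -
    let ?g = "\<lambda>m z. if m = f n then ennreal (cmod z) else indicator (A m) z"
    have "(\<integral>\<^sup>+\<omega>. ennreal (c n * cmod (\<zeta> (f n) \<omega>)) * indicator (box I A) \<omega> \<partial>M) =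
        (\<integral>\<^sup>+\<omega>. ennreal (c n) * (\<Prod>m\<in>insert (f n) I. ?g m (\<zeta> m \<omega>)) \<partial>M)"
    proof (rule nn_integral_cong)
      fix \<omega> assume \<omega>: "\<omega> \<in> space M"
      have "(\<Prod>m\<in>insert (f n) I. ?g m (\<zeta> m \<omega>)) = ennreal (cmod (\<zeta> (f n) \<omega>)) * (\<Prod>m\<in>I. ?g m (\<zeta> m \<omega>))"
        using I f[of n] by simp
      also have "(\<Prod>m\<in>I. ?g m (\<zeta> m \<omega>)) = indicator (box I A) \<omega>"
        unfolding indicator_box[OF I \<omega>] using f[of n] by (intro prod.cong) auto
      finally show "ennreal (c n * cmod (\<zeta> (f n) \<omega>)) * indicator (box I A) \<omega> =
          ennreal (c n) * (\<Prod>m\<in>insert (f n) I. ?g m (\<zeta> m \<omega>))"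
        using c[of n] by (simp add: ennreal_mult mult.assoc)
    qed
    also have gm: "?g m \<in> borel_measurable borel" if "m \<in> insert (f n) I" for m
      using that A[of m] by (cases "m = f n") (auto intro: borel_measurable_indicator)
    then have "(\<integral>\<^sup>+\<omega>. ennreal (c n) * (\<Prod>m\<in>insert (f n) I. ?g m (\<zeta> m \<omega>)) \<partial>M) =
        ennreal (c n) * (\<integral>\<^sup>+\<omega>. (\<Prod>m\<in>insert (f n) I. ?g m (\<zeta> m \<omega>)) \<partial>M)"
      by (intro nn_integral_cmult borel_measurable_prod_ennreal measurable_compose[OF \<zeta>_measurable gm])
    also have "(\<integral>\<^sup>+\<omega>. (\<Prod>m\<in>insert (f n) I. ?g m (\<zeta> m \<omega>)) \<partial>M) =
        (\<Prod>m\<in>insert (f n) I. \<integral>\<^sup>+\<omega>. ?g m (\<zeta> m \<omega>) \<partial>M)"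
      by (rule nn_integral_prod_\<zeta>[where g = ?g]) (use I gm in auto)
    also have "\<dots> = (\<integral>\<^sup>+\<omega>. ennreal (cmod (\<zeta> (f n) \<omega>)) \<partial>M) * (\<Prod>m\<in>I. \<integral>\<^sup>+\<omega>. ?g m (\<zeta> m \<omega>) \<partial>M)"
      using I f[of n] by simp
    also have "(\<Prod>m\<in>I. \<integral>\<^sup>+\<omega>. ?g m (\<zeta> m \<omega>) \<partial>M) = emeasure M (box I A)"
      unfolding eb
    proof (rule prod.cong[OF refl])
      fix m assume m: "m \<in> I"
      then have "m \<noteq> f n" using f[of n] by auto
      then show "(\<integral>\<^sup>+\<omega>. ?g m (\<zeta> m \<omega>) \<partial>M) = emeasure M {\<omega> \<in> space M. \<zeta> m \<omega> \<in> A m}"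
        using nn_integral_indicator_\<zeta>[OF A[OF m]] by simp
    qed
    also have "ennreal (c n) * ((\<integral>\<^sup>+\<omega>. ennreal (cmod (\<zeta> (f n) \<omega>)) \<partial>M) * emeasure M (box I A))
        \<le> ennreal (c n) * (2 * emeasure M (box I A))"
      by (intro mult_left_mono mult_right_mono first_moment_\<zeta>) simp_all
    finally show ?thesis by (simp add: mult.assoc)
  qed
  have "ennreal x * emeasure M ?E = (\<integral>\<^sup>+\<omega>. ennreal x * indicator ?E \<omega> \<partial>M)"
    by (rule nn_integral_cmult_indicator[symmetric, OF E])
  also have "\<dots> \<le> (\<integral>\<^sup>+\<omega>. ?T \<omega> * indicator (box I A) \<omega> \<partial>M)"
    by (rule nn_integral_mono) (auto simp: indicator_def)
  also have "\<dots> = (\<integral>\<^sup>+\<omega>. (\<Sum>n. ennreal (c n * cmod (\<zeta> (f n) \<omega>)) * indicator (box I A) \<omega>) \<partial>M)"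
    by simp
  also have "\<dots> = (\<Sum>n. \<integral>\<^sup>+\<omega>. ennreal (c n * cmod (\<zeta> (f n) \<omega>)) * indicator (box I A) \<omega> \<partial>M)"
    by (intro nn_integral_suminf borel_measurable_times_ennreal tm borel_measurable_indicator box)
  also have "\<dots> \<le> (\<Sum>n. ennreal (c n) * (2 * emeasure M (box I A)))"
    using one by (intro suminf_le) (simp_all add: mult.assoc)
  also have "\<dots> = ennreal (suminf c) * (2 * emeasure M (box I A))"
    using suminf_ennreal_eq[OF c summable_sums[OF sm]] by simp
  finally have "ennreal (x * prob ?E) \<le> ennreal (suminf c * (2 * prob (box I A)))"
    using x suminf_nonneg[OF sm c] by (simp add: emeasure_eq_measure ennreal_mult)
  then have "x * prob ?E \<le> suminf c * (2 * prob (box I A))"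
    using suminf_nonneg[OF sm c] by (subst (asm) ennreal_le_iff) auto
  then show ?thesis using x by (simp add: field_simps)
qed

end

section \<open>Construction of a hole from small coefficients\<close>

context hyperbolic_series
begin

lemma summable_coefficients:
  assumes "0 < r" "r < 1"
  shows "summable (\<lambda>n. a n * r ^ n)"
proof -
  obtain D k where D: "D \<ge> 1"
    and Dk: "\<And>\<delta> n. 0 < \<delta> \<Longrightarrow> \<delta> < 1 \<Longrightarrow> a n * (1 - \<delta>) ^ n \<le> D * (1 / \<delta>) ^ k * exp (- (3 * \<delta> / 4)) ^ n"
    using coefficient_decay by blast
  have "summable (\<lambda>n. D * (1 / (1 - r)) ^ k * exp (- (3 * (1 - r) / 4)) ^ n)"
    using assms by (intro summable_mult summable_geometric) simp
  then show ?thesis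
  proof (rule summable_comparison_test')
    fix n :: nat assume "n \<ge> 0"
    show "norm (a n * r ^ n) \<le> D * (1 / (1 - r)) ^ k * exp (- (3 * (1 - r) / 4)) ^ n"
      using Dk[of "1 - r" n] assms a_pos[of n] by simp
  qed
qed

text \<open>The hole is forced by a constant term of modulus \<open>K\<close> and coefficients so small that, with their
  independent phases, their sum over \<open>0 < n \<le> N\<close> stays below \<open>K\<close> on a net of the circle.\<close>

lemma prob_Hole_ge:
  assumes r: "0 < r" "r < 1" and K: "K > 0" and \<epsilon>: "\<epsilon> > 0" and m: "m > 0" and l: "l > 0"
    and mesh: "real N * (real N * \<epsilon> * (2 * pi / real m)) \<le> K / 8"
    and chernoff: "16 * real m * exp (real N * (l * \<epsilon>)\<^sup>2 - l * K / 4) \<le> 1"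
    and tail: "32 * (\<Sum>n. a (n + Suc N) * r ^ (n + Suc N)) \<le> K"
  shows "1 / 2 * (prob {\<omega> \<in> space M. K \<le> cmod (\<zeta> 0 \<omega>)} *
      (\<Prod>n\<in>{1..N}. prob {\<omega> \<in> space M. cmod (\<zeta> n \<omega>) \<le> \<epsilon> / (a n * r ^ n)})) \<le> prob (Hole M \<zeta> a r)"
proof -
  let ?I = "insert 0 {1..N}" and ?J = "{1..N}"
  define b where "b n = \<epsilon> / (a n * r ^ n)" for n
  have arp: "a n * r ^ n > 0" for n using a_pos r by simp
  have b: "b n > 0" "a n * r ^ n * b n = \<epsilon>" for n
    using arp[of n] \<epsilon> unfolding b_def
    by (rule divide_pos_pos[rotated], simp only: times_divide_eq_right nonzero_mult_div_cancel_left[OF less_imp_neq[OF arp, symmetric]])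
  define A where "A n = (if n = 0 then {z. K \<le> cmod z} else cball 0 (b n))" for n
  have A: "A n \<in> sets borel" for n
    by (cases "n = 0") (simp_all add: A_def)
  define B where "B = box ?I A"
  have Bm: "B \<in> events" unfolding B_def using A by (intro box_measurable) auto
  have pB: "prob B = prob {\<omega> \<in> space M. K \<le> cmod (\<zeta> 0 \<omega>)} * (\<Prod>n\<in>?J. prob {\<omega> \<in> space M. cmod (\<zeta> n \<omega>) \<le> b n})"
  proof -
    have "emeasure M B = (\<Prod>n\<in>?I. emeasure M {\<omega> \<in> space M. \<zeta> n \<omega> \<in> A n})"
      unfolding B_def using A by (intro emeasure_box) auto
    then have "ennreal (prob B) = ennreal (\<Prod>n\<in>?I. prob {\<omega> \<in> space M. \<zeta> n \<omega> \<in> A n})"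
      by (simp only: emeasure_eq_measure prod_ennreal measure_nonneg)
    then have "prob B = (\<Prod>n\<in>?I. prob {\<omega> \<in> space M. \<zeta> n \<omega> \<in> A n})"
      by (subst (asm) ennreal_inj) (auto intro!: prod_nonneg mult_nonneg_nonneg)
    then show ?thesis by (simp add: A_def)
  qed
  \<comment> \<open>Four real parts control a complex number: if \<open>Re (c * w) < K / 4\<close>
    for all four directions \<open>c\<close>, then \<open>cmod w \<le> K / 2\<close>.\<close>
  define dirs where "dirs = {1, -1, \<i>, - \<i>}"
  have dirs: "finite dirs" "card dirs \<le> 4" "\<And>c. c \<in> dirs \<Longrightarrow> cmod c = 1"
    by (auto simp: dirs_def card_insert_if)
  \<comment> \<open>\<open>l\<close> is the Chernoff parameter. On the box each scaled term has
    modulus at most \<open>l * \<epsilon>\<close>, whatever \<open>n\<close> is.\<close>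
  define e where "e k c n = of_real (l * (a n * r ^ n)) * (c * unity_root m k ^ n)" for k c n
  define Bad where "Bad k c = {\<omega> \<in> B. l * K / 4 \<le> (\<Sum>n\<in>?J. Re (e k c n * \<zeta> n \<omega>))}" for k c
  have Bad_le: "prob (Bad k c) \<le> 1 / (16 * real m) * prob B" if c: "c \<in> dirs" for k c
  proof -
    have en: "cmod (e k c n) * b n = l * \<epsilon>" for n
    proof -
      have "cmod (e k c n) = l * (a n * r ^ n)"
        using arp[of n] l dirs(3)[OF c] by (simp add: e_def norm_mult norm_power less_imp_le del: of_real_mult)
      then show ?thesis using b(2)[of n] by (simp add: mult.assoc)
    qed
    have "prob (Bad k c) \<le> exp (real (card ?J) * (l * \<epsilon>)\<^sup>2 - l * K / 4) * prob (box ?I A)"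
      unfolding Bad_def B_def
      by (rule box_chernoff[where b = b]) (use A en in \<open>auto simp: A_def less_imp_le[OF b(1)]\<close>)
    also have "\<dots> \<le> 1 / (16 * real m) * prob (box ?I A)"
      using chernoff m by (intro mult_right_mono) (simp_all add: field_simps)
    finally show ?thesis by (simp add: B_def)
  qed
  have Bad_m: "Bad k c \<in> events" for k c
  proof -
    have eq: "Bad k c = B \<inter> {\<omega> \<in> space M. l * K / 4 \<le> (\<Sum>n\<in>?J. Re (e k c n * \<zeta> n \<omega>))}"
      by (auto simp: Bad_def B_def box_def)
    have "{\<omega> \<in> space M. l * K / 4 \<le> (\<Sum>n\<in>?J. Re (e k c n * \<zeta> n \<omega>))} \<in> events" by measurable
    then show ?thesis unfolding eq using Bm by (rule sets.Int[rotated])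
  qed
  define cc where "cc n = a (n + Suc N) * r ^ (n + Suc N)" for n
  have cc: "0 \<le> cc n" for n using arp[of "n + Suc N"] by (simp add: cc_def)
  have sm: "summable cc"
    unfolding cc_def using summable_coefficients[OF r] by (subst summable_iff_shift)
  have tail': "32 * suminf cc \<le> K" using tail by (simp only: cc_def[abs_def])
  define T where "T \<omega> = (\<Sum>n. ennreal (cc n * cmod (\<zeta> (n + Suc N) \<omega>)))" for \<omega>
  define BT where "BT = {\<omega> \<in> B. ennreal (K / 4) \<le> T \<omega>}"
  have T_m: "T \<in> borel_measurable M"
    unfolding T_def by (rule borel_measurable_suminf_order) measurable
  have BT_m: "BT \<in> events"
  proof -
    have "BT = B \<inter> (T -` {ennreal (K / 4)..} \<inter> space M)" by (auto simp: BT_def B_def box_def)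
    then show ?thesis using Bm measurable_sets[OF T_m, of "{ennreal (K / 4)..}"] by auto
  qed
  have BT_le: "prob BT \<le> 1 / 4 * prob B"
  proof -
    have "prob BT \<le> 2 * suminf cc / (K / 4) * prob (box ?I A)"
      unfolding BT_def B_def T_def
      by (rule box_tail) (use A cc sm K in auto)
    also have "\<dots> \<le> 1 / 4 * prob (box ?I A)"
      using tail' K by (intro mult_right_mono) (simp_all add: field_simps)
    finally show ?thesis by (simp add: B_def)
  qed
  \<comment> \<open>At most \<open>4 * m\<close> events of conditional probability at most
    \<open>1 / (16 * m)\<close>: a quarter of the box is lost here and another quarter to the tail,
    so half survives.\<close>
  define U where "U = (\<Union>p\<in>{..<m} \<times> dirs. Bad (fst p) (snd p))"
  have U_m: "U \<in> events" unfolding U_def using dirs Bad_m by (intro sets.finite_UN) auto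
  have "prob U \<le> (\<Sum>p\<in>{..<m} \<times> dirs. prob (Bad (fst p) (snd p)))"
    unfolding U_def using dirs Bad_m by (intro finite_measure_subadditive_finite) auto
  also have "\<dots> \<le> (\<Sum>p\<in>{..<m} \<times> dirs. 1 / (16 * real m) * prob B)"
    using Bad_le by (intro sum_mono) auto
  also have "\<dots> = real m * real (card dirs) * (1 / (16 * real m) * prob B)"
    by (simp add: card_cartesian_product)
  also have "\<dots> \<le> real m * 4 * (1 / (16 * real m) * prob B)"
    using dirs(2) by (intro mult_right_mono mult_left_mono) auto
  also have "\<dots> = 1 / 4 * prob B" using m by simp
  finally have U_le: "prob U \<le> 1 / 4 * prob B" .
  define Good where "Good = {\<omega> \<in> B - (U \<union> BT). converges \<omega>}"
  have "prob B \<le> prob (B - (U \<union> BT)) + prob (U \<union> BT)"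
    using Bm U_m BT_m by (subst finite_measure_Diff') (auto simp: finite_measure_mono intro!: finite_measure_mono)
  moreover have "prob (U \<union> BT) \<le> 1 / 4 * prob B + 1 / 4 * prob B"
    using measure_Un_le[OF U_m BT_m] U_le BT_le by linarith
  moreover have "prob Good = prob (B - (U \<union> BT))"
    unfolding Good_def using Bm U_m BT_m by (intro prob_inter_converges) auto
  ultimately have "1 / 2 * prob B \<le> prob Good" by linarith
  also have "\<dots> \<le> prob (Hole M \<zeta> a r)"
  proof (rule finite_measure_mono)
    show "Hole M \<zeta> a r \<in> events" by (rule Hole_measurable[OF r])
    show "Good \<subseteq> Hole M \<zeta> a r"
    proof
      fix \<omega> assume "\<omega> \<in> Good"
      then have \<omega>: "\<omega> \<in> B" "\<omega> \<notin> U" "\<omega> \<notin> BT" "converges \<omega>" "\<omega> \<in> space M"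
        by (auto simp: Good_def B_def box_def)
      have z0: "K \<le> cmod (\<zeta> 0 \<omega>)" using \<omega>(1) by (auto simp: B_def box_def A_def)
      have zn: "cmod (\<zeta> n \<omega>) \<le> b n" if "n \<in> ?J" for n
        using \<omega>(1) that by (auto simp: B_def box_def A_def)
      define f where "f u = (\<Sum>n\<in>?J. \<zeta> n \<omega> * of_real (a n * r ^ n) * u ^ n)" for u
      have Re_l: "Re (of_real l * w) = l * Re w" for w by simp
      have re: "Re (c * f (unity_root m k)) < K / 4" if "k < m" "c \<in> dirs" for k c
      proof -
        have "\<omega> \<notin> Bad k c" using \<omega>(2) that by (force simp: U_def)
        then have "(\<Sum>n\<in>?J. Re (e k c n * \<zeta> n \<omega>)) < l * K / 4" using \<omega>(1) by (simp add: Bad_def)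
        also have "(\<Sum>n\<in>?J. Re (e k c n * \<zeta> n \<omega>)) = Re (\<Sum>n\<in>?J. e k c n * \<zeta> n \<omega>)" by (simp only: Re_sum)
        also have "(\<Sum>n\<in>?J. e k c n * \<zeta> n \<omega>) = of_real l * (c * f (unity_root m k))"
          by (simp add: e_def f_def sum_distrib_left mult_ac)
        also have "Re \<dots> = l * Re (c * f (unity_root m k))" by (rule Re_l)
        finally show ?thesis using l by (metis mult_less_cancel_left_pos times_divide_eq_right)
      qed
      have root: "cmod (f (unity_root m k)) \<le> K / 2" if "k < m" for k
      proof -
        have "Re (f (unity_root m k)) < K / 4" "- Re (f (unity_root m k)) < K / 4"
          "- Im (f (unity_root m k)) < K / 4" "Im (f (unity_root m k)) < K / 4"
          using re[OF that, of 1] re[OF that, of "-1"] re[OF that, of \<i>] re[OF that, of "-\<i>"]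
          by (simp_all add: dirs_def)
        then show ?thesis using cmod_le[of "f (unity_root m k)"] by linarith
      qed
      \<comment> \<open>\<open>K / 2\<close> on the net plus \<open>K / 8\<close> for the mesh gives
        \<open>5 * K / 8\<close>. With less than \<open>K / 4\<close> from the tail the total stays
        below \<open>7 * K / 8\<close>, hence below the constant term.\<close>
      have circle: "cmod (f u) \<le> 5 * K / 8" if u: "cmod u = 1" for u
      proof -
        obtain k where k: "k < m" "cmod (u - unity_root m k) \<le> 2 * pi / real m"
          using unity_root_net[OF u m] by blast
        have "cmod (f u - f (unity_root m k)) \<le> (\<Sum>n\<in>?J. real N * \<epsilon> * (2 * pi / real m))"
          unfolding f_def sum_subtractf[symmetric]
        proof (rule sum_norm_le)
          fix n assume n: "n \<in> ?J"
          have "cmod (u ^ n - unity_root m k ^ n) \<le> real n * cmod (u - unity_root m k)"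
            using u by (intro norm_power_diff) auto
          also have "\<dots> \<le> real N * (2 * pi / real m)" using n k by (intro mult_mono) auto
          finally have 1: "cmod (u ^ n - unity_root m k ^ n) \<le> real N * (2 * pi / real m)" .
          have "cmod (\<zeta> n \<omega>) * (a n * r ^ n) \<le> b n * (a n * r ^ n)"
            using zn[OF n] arp[of n] by (intro mult_right_mono) auto
          then have 2: "cmod (\<zeta> n \<omega>) * (a n * r ^ n) \<le> \<epsilon>" using b(2)[of n] by (simp add: mult.commute)
          have "cmod (\<zeta> n \<omega> * of_real (a n * r ^ n) * u ^ n - \<zeta> n \<omega> * of_real (a n * r ^ n) * unity_root m k ^ n) =
              cmod (\<zeta> n \<omega>) * (a n * r ^ n) * cmod (u ^ n - unity_root m k ^ n)"
            using arp[of n] unfolding right_diff_distrib[symmetric]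
            by (simp only: norm_mult norm_of_real abs_of_pos)
          also have "\<dots> \<le> \<epsilon> * (real N * (2 * pi / real m))"
            using 1 2 \<epsilon> by (intro mult_mono) auto
          finally show "cmod (\<zeta> n \<omega> * of_real (a n * r ^ n) * u ^ n - \<zeta> n \<omega> * of_real (a n * r ^ n) * unity_root m k ^ n)
            \<le> real N * \<epsilon> * (2 * pi / real m)" by (simp only: mult_ac)
        qed
        also have "\<dots> \<le> K / 8" using mesh by simp
        finally show ?thesis using root[OF k(1)] norm_triangle_ineq2[of "f u" "f (unity_root m k)"] by linarith
      qed
      \<comment> \<open>The variable of \<open>f\<close> is \<open>z / r\<close>, so the maximum
        principle on the unit disc carries the bound to the whole disc of radius
        \<open>r\<close>.\<close>
      have disc: "cmod (f u) \<le> 5 * K / 8" if "cmod u \<le> 1" for u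
      proof (rule maximum_modulus_frontier[where f = f and \<xi> = u and S = "cball 0 1"])
        show "f holomorphic_on interior (cball 0 1)" unfolding f_def by (intro holomorphic_intros)
        show "continuous_on (closure (cball 0 1)) f" unfolding f_def by (intro continuous_intros)
        show "cmod (f z) \<le> 5 * K / 8" if "z \<in> frontier (cball 0 1)" for z
          using circle that by simp
      qed (use that in auto)
      have "T \<omega> < ennreal (K / 4)" using \<omega>(1,3) by (auto simp: BT_def)
      define h where "h n = cc n * cmod (\<zeta> (n + Suc N) \<omega>)" for n
      have h: "0 \<le> h n" for n using cc by (simp add: h_def)
      have Th: "(\<Sum>n. ennreal (h n)) < ennreal (K / 4)" using \<open>T \<omega> < ennreal (K / 4)\<close> by (simp add: T_def h_def)
      have smh: "summable h"
        by (rule summable_suminf_not_top[OF h]) (use Th in auto)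
      have sh: "suminf h < K / 4"
        using Th suminf_ennreal_eq[OF h summable_sums[OF smh]] K suminf_nonneg[OF smh h] by (simp add: ennreal_less_iff)
      show "\<omega> \<in> Hole M \<zeta> a r" unfolding Hole_eq
      proof (intro CollectI conjI allI impI)
        fix z assume z: "cmod z \<le> r"
        let ?t = "\<lambda>n. \<zeta> n \<omega> * of_real (a n) * z ^ n"
        have S: "?t sums F \<omega> z" using z r by (intro F_sums \<omega>(4)) auto
        have "(\<lambda>n. ?t (n + Suc N)) sums (F \<omega> z - (\<Sum>n<Suc N. ?t n))"
          using S by (subst sums_iff_shift) simp
        then have tl: "(\<Sum>n. ?t (n + Suc N)) = F \<omega> z - (\<Sum>n<Suc N. ?t n)" by (rule sums_unique[symmetric])
        have "{..<Suc N} = ?I" by auto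
        then have "(\<Sum>n<Suc N. ?t n) = \<zeta> 0 \<omega> + (\<Sum>n\<in>?J. ?t n)" using a_0 by simp
        also have "(\<Sum>n\<in>?J. ?t n) = f (z / of_real r)"
          unfolding f_def using r by (intro sum.cong) (simp_all add: power_divide)
        finally have Feq: "F \<omega> z = \<zeta> 0 \<omega> + f (z / of_real r) + (\<Sum>n. ?t (n + Suc N))" using tl by simp
        have "cmod (\<Sum>n. ?t (n + Suc N)) \<le> suminf h"
        proof (rule norm_suminf_le[OF _ smh])
          fix n
          have "cmod z ^ (n + Suc N) \<le> r ^ (n + Suc N)" using z by (intro power_mono) auto
          then have "cmod (\<zeta> (n + Suc N) \<omega>) * a (n + Suc N) * cmod z ^ (n + Suc N) \<le>
              cmod (\<zeta> (n + Suc N) \<omega>) * a (n + Suc N) * r ^ (n + Suc N)"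
            using a_pos[of "n + Suc N"] by (intro mult_left_mono) auto
          then show "cmod (?t (n + Suc N)) \<le> h n"
            using a_pos[of "n + Suc N"] by (simp add: h_def cc_def norm_mult norm_power mult_ac del: power_Suc)
        qed
        moreover have "cmod (f (z / of_real r)) \<le> 5 * K / 8"
          using z r by (intro disc) (simp add: norm_divide)
        moreover have "cmod (\<zeta> 0 \<omega>) \<le> cmod (F \<omega> z) + cmod (f (z / of_real r)) + cmod (\<Sum>n. ?t (n + Suc N))"
        proof -
          have tri: "cmod (x - y - w) \<le> cmod x + cmod y + cmod w" for x y w :: complex
            using norm_triangle_ineq4[of "x - y" w] norm_triangle_ineq4[of x y] by linarith
          have eq: "\<zeta> 0 \<omega> = F \<omega> z - f (z / of_real r) - (\<Sum>n. ?t (n + Suc N))" using Feq by simp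
          show ?thesis unfolding eq by (rule tri)
        qed
        ultimately have "cmod (F \<omega> z) > 0" using z0 sh K by linarith
        then show "F \<omega> z \<noteq> 0" by simp
      qed (use \<omega> in auto)
    qed
  qed
  finally show ?thesis by (simp add: pB b_def)
qed

end

section \<open>Upper bound for the hole probability\<close>

context gaussian_coefficients
begin

text \<open>The threshold grows with \<open>n\<close>, and
  \<open>((n + 1) * B)\<^sup>2 \<ge> (n + 1) * B\<^sup>2\<close> makes the tail probabilities
  geometric with ratio \<open>exp (- B\<^sup>2 / 2)\<close>. For \<open>B \<ge> 1\<close> this ratio
  is at most \<open>2 / 3\<close>, so the series contributes a factor 3 to the constant 6.\<close>

lemma prob_some_\<zeta>_large_le:
  assumes B: "B \<ge> 1"
  shows "prob {\<omega> \<in> space M. \<exists>n. (real n + 1) * B \<le> cmod (\<zeta> n \<omega>)} \<le> 6 * exp (- B\<^sup>2 / 2)"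
proof -
  define x where "x = exp (- B\<^sup>2 / 2)"
  have "1 \<le> B\<^sup>2" using B by simp
  then have "x \<le> exp (- (1 / 2))" by (simp add: x_def)
  also have "\<dots> \<le> 2 / 3" using exp_ge_add_one_self[of "1 / 2 :: real"] by (simp add: exp_minus field_simps)
  finally have x: "0 < x" "x \<le> 2 / 3" by (auto simp: x_def)
  let ?E = "\<lambda>n. {\<omega> \<in> space M. (real n + 1) * B \<le> cmod (\<zeta> n \<omega>)}"
  have le: "prob (?E n) \<le> 2 * x * x ^ n" for n
  proof -
    have "prob (?E n) \<le> 2 * exp (- ((real n + 1) * B)\<^sup>2 / 2)"
      using B by (intro prob_\<zeta>_tail) simp
    also have "(real n + 1) * B\<^sup>2 \<le> ((real n + 1) * B)\<^sup>2"
    proof -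
      have "(real n + 1) * 1 \<le> (real n + 1) * (real n + 1)" by (intro mult_left_mono) auto
      then have "(real n + 1) * B\<^sup>2 \<le> (real n + 1)\<^sup>2 * B\<^sup>2"
        by (intro mult_right_mono) (simp_all add: power2_eq_square)
      then show ?thesis by (simp only: power_mult_distrib)
    qed
    then have "2 * exp (- ((real n + 1) * B)\<^sup>2 / 2) \<le> 2 * exp (real (Suc n) * (- B\<^sup>2 / 2))"
      by (simp add: field_simps)
    also have "\<dots> = 2 * x * x ^ n" unfolding exp_of_nat_mult by (simp add: x_def)
    finally show ?thesis .
  qed
  have sm: "summable (\<lambda>n. 2 * x * x ^ n)" using x by (intro summable_mult summable_geometric) auto
  have smp: "summable (\<lambda>n. prob (?E n))"
    by (rule summable_comparison_test'[OF sm]) (use le in auto)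
  have "{\<omega> \<in> space M. \<exists>n. (real n + 1) * B \<le> cmod (\<zeta> n \<omega>)} = (\<Union>n. ?E n)" by auto
  then have "prob {\<omega> \<in> space M. \<exists>n. (real n + 1) * B \<le> cmod (\<zeta> n \<omega>)} = prob (\<Union>n. ?E n)" by simp
  also have "\<dots> \<le> (\<Sum>n. prob (?E n))"
    using smp by (intro finite_measure_subadditive_countably) auto
  also have "\<dots> \<le> (\<Sum>n. 2 * x * x ^ n)" using smp sm le by (intro suminf_le)
  also have "\<dots> = 2 * x * (1 / (1 - x))" using x by (subst suminf_mult) (auto simp: suminf_geometric summable_geometric)
  also have "\<dots> \<le> 2 * x * 3" using x by (intro mult_left_mono) (auto simp: field_simps)
  finally show ?thesis by (simp add: x_def)
qed

end

context hyperbolic_series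
begin

text \<open>Outside two Gaussian tail events the series is below \<open>S\<close> on the closed disc
  and its value at 0 is below \<open>T\<close>. On a hole Harnack's inequality then bounds the
  product of the values by \<open>t\<close>, to which the negative-moment estimate applies. The last
  two summands are the tail events.\<close>

lemma prob_Hole_le:
  assumes r: "0 < r" "r < 1" and \<rho>: "0 < \<rho>" "\<rho> < r" and N: "N > 0" and s: "0 \<le> s" "s < 1"
    and B: "B \<ge> 1" and T: "T \<ge> 1" and S: "S \<ge> 1" and t: "t > 0"
    and summable: "summable (\<lambda>n. (real n + 1) * B * (a n * r ^ n))"
    and sum: "(\<Sum>n. (real n + 1) * B * (a n * r ^ n)) < S"
    and q: "q = (\<rho> / r) ^ N"
    and harnack: "real N * (2 * q / (1 + q) * ln S + (1 - q) / (1 + q) * ln T) \<le> ln t"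
  shows "prob (Hole M \<zeta> a r) \<le>
     (S\<^sup>2 / (1 - 4 powr (s - 1))) ^ N * t powr (2 * s) /
       (((S / 2) powr (2 * s)) ^ N * (real N ^ N * (\<Prod>n<N. (a n * \<rho> ^ n)\<^sup>2)))
     + 2 * exp (- T\<^sup>2 / 2) + 6 * exp (- B\<^sup>2 / 2)"
proof -
  let ?E1 = "{\<omega> \<in> space M. T \<le> cmod (\<zeta> 0 \<omega>)}"
  let ?E2 = "{\<omega> \<in> space M. \<exists>n. (real n + 1) * B \<le> cmod (\<zeta> n \<omega>)}"
  define A where "A = Hole M \<zeta> a r - (?E1 \<union> ?E2)"
  have E1: "?E1 \<in> events" by measurable
  have E2: "?E2 \<in> events" by measurable
  have H: "Hole M \<zeta> a r \<in> events" using r by (rule Hole_measurable)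
  have A_m: "A \<in> events" unfolding A_def using H E1 E2 by auto
  define z where "z j = of_real \<rho> * unity_root N j" for j
  have zn: "cmod (z j) = \<rho>" for j using \<rho> by (simp add: z_def norm_mult)
  define b where "b j y = (\<Sum>n. y (n + N) * of_real (a (n + N)) * z j ^ (n + N))" for j and y :: "nat \<Rightarrow> complex"
  \<comment> \<open>The change of variables needs a formula valid on all of the probability space,
    split into the first \<open>N\<close> coefficients and a function of the others. It agrees with
    the value of the series wherever that converges.\<close>
  define X where "X j \<omega> = b j (\<lambda>i\<in>{N..}. \<zeta> i \<omega>) + (\<Sum>n<N. \<zeta> n \<omega> * of_real (a n) * z j ^ n)" for j \<omega>
  have b_m: "b j \<in> borel_measurable (Pi\<^sub>M {N..} (\<lambda>_. borel))" for j
    unfolding b_def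
  proof (rule borel_measurable_suminf)
    fix n
    have "(\<lambda>y. y (n + N)) \<in> borel_measurable (Pi\<^sub>M {N..} (\<lambda>_. borel :: complex measure))"
      by (rule measurable_component_singleton) simp
    then show "(\<lambda>y. y (n + N) * of_real (a (n + N)) * z j ^ (n + N)) \<in> borel_measurable (Pi\<^sub>M {N..} (\<lambda>_. borel))"
      by (intro borel_measurable_times) simp_all
  qed
  have X: "X j \<omega> = F \<omega> (z j)" if "converges \<omega>" for j \<omega>
  proof -
    have S: "(\<lambda>n. \<zeta> n \<omega> * of_real (a n) * z j ^ n) sums F \<omega> (z j)"
      using zn \<rho> r by (intro F_sums that) auto
    then have "(\<lambda>n. \<zeta> (n + N) \<omega> * of_real (a (n + N)) * z j ^ (n + N)) sums
        (F \<omega> (z j) - (\<Sum>n<N. \<zeta> n \<omega> * of_real (a n) * z j ^ n))"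
      by (subst sums_iff_shift) simp
    then have "b j (\<lambda>i\<in>{N..}. \<zeta> i \<omega>) = F \<omega> (z j) - (\<Sum>n<N. \<zeta> n \<omega> * of_real (a n) * z j ^ n)"
      by (simp add: b_def sums_unique[symmetric])
    then show ?thesis by (simp add: X_def)
  qed
  have onA: "\<omega> \<in> space M" "converges \<omega>" "\<And>u. cmod u \<le> r \<Longrightarrow> F \<omega> u \<noteq> 0" "cmod (\<zeta> 0 \<omega>) < T"
    "\<And>n. cmod (\<zeta> n \<omega>) < (real n + 1) * B" if "\<omega> \<in> A" for \<omega>
    using that by (auto simp: A_def Hole_eq not_le)
  have FS: "cmod (F \<omega> u) < S" if \<omega>: "\<omega> \<in> A" and u: "cmod u \<le> r" for \<omega> u
  proof -
    have "cmod (F \<omega> u) \<le> (\<Sum>n. (real n + 1) * B * (a n * r ^ n))"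
      unfolding F_eq
    proof (rule norm_suminf_le[OF _ summable])
      fix n
      have "cmod u ^ n \<le> r ^ n" using u by (intro power_mono) auto
      then have "cmod (\<zeta> n \<omega>) * (a n * cmod u ^ n) \<le> ((real n + 1) * B) * (a n * r ^ n)"
        using a_pos[of n] onA(5)[OF \<omega>, of n] B by (intro mult_mono) auto
      then show "cmod (\<zeta> n \<omega> * of_real (a n) * u ^ n) \<le> (real n + 1) * B * (a n * r ^ n)"
        using a_pos[of n] by (simp add: norm_mult norm_power mult_ac)
    qed
    then show ?thesis using sum by simp
  qed
  have q01: "0 < q" "q < 1"
    using \<rho> r N by (auto simp: q power_less_one_iff)
  have small: "0 < cmod (X j \<omega>) \<and> cmod (X j \<omega>) \<le> S" if "\<omega> \<in> A" for \<omega> j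
    using X[OF onA(2)[OF that], of j] onA(3)[OF that, of "z j"] FS[OF that, of "z j"] zn[of j] \<rho> by simp
  have prod: "(\<Prod>j<N. cmod (X j \<omega>)) \<le> t" if \<omega>: "\<omega> \<in> A" for \<omega>
  proof -
    have "(\<Sum>j<N. ln (cmod (F \<omega> (of_real \<rho> * unity_root N j))))
      \<le> real N * (2 * q / (1 + q) * ln S + (1 - q) / (1 + q) * ln (cmod (F \<omega> 0)))"
    proof (rule sum_ln_unity_roots_le[where R = r])
      show "F \<omega> holomorphic_on ball 0 r"
        using F_holomorphic[OF onA(2)[OF \<omega>]] r by (auto intro: holomorphic_on_subset)
    qed (use onA(3)[OF \<omega>] FS[OF \<omega>] N \<rho> q in auto)
    also have "ln (cmod (F \<omega> 0)) \<le> ln T"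
    proof -
      have "F \<omega> 0 \<noteq> 0" using onA(3)[OF \<omega>, of 0] r by simp
      then show ?thesis using F_0[OF onA(2)[OF \<omega>]] onA(4)[OF \<omega>] T by simp
    qed
    then have "real N * (2 * q / (1 + q) * ln S + (1 - q) / (1 + q) * ln (cmod (F \<omega> 0))) \<le>
        real N * (2 * q / (1 + q) * ln S + (1 - q) / (1 + q) * ln T)"
      using q01 by (intro mult_left_mono add_left_mono) auto
    also note harnack
    finally have le: "(\<Sum>j<N. ln (cmod (X j \<omega>))) \<le> ln t"
      using X[OF onA(2)[OF \<omega>]] by (simp add: z_def)
    have "(\<Prod>j<N. cmod (X j \<omega>)) = (\<Prod>j<N. exp (ln (cmod (X j \<omega>))))"
      using small[OF \<omega>] by (intro prod.cong) auto
    also have "\<dots> = exp (\<Sum>j<N. ln (cmod (X j \<omega>)))" by (simp add: exp_sum)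
    also have "\<dots> \<le> exp (ln t)" using le by simp
    finally show ?thesis using t by simp
  qed
  have "prob A \<le> (S\<^sup>2 / (1 - 4 powr (s - 1))) ^ N * t powr (2 * s) /
     (((S / 2) powr (2 * s)) ^ N * (real N ^ N * (\<Prod>n<N. (a n * \<rho> ^ n)\<^sup>2)))"
    by (rule prob_small_product_le[where X = X and b = b])
       (use N \<rho> a_pos b_m S s t A_m small prod in \<open>auto simp: X_def z_def\<close>)
  moreover have "prob (Hole M \<zeta> a r) \<le> prob A + prob ?E1 + prob ?E2"
  proof -
    have "prob (Hole M \<zeta> a r) \<le> prob (A \<union> (?E1 \<union> ?E2))"
      by (intro finite_measure_mono sets.Un A_m E1 E2) (auto simp: A_def)
    also have "\<dots> \<le> prob A + prob (?E1 \<union> ?E2)"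
      using A_m E1 E2 by (intro measure_Un_le) auto
    also have "prob (?E1 \<union> ?E2) \<le> prob ?E1 + prob ?E2"
      using E1 E2 by (intro measure_Un_le)
    finally show ?thesis by simp
  qed
  moreover have "prob ?E1 \<le> 2 * exp (- T\<^sup>2 / 2)" using T by (intro prob_\<zeta>_tail) simp
  moreover have "prob ?E2 \<le> 6 * exp (- B\<^sup>2 / 2)" using B by (rule prob_some_\<zeta>_large_le)
  ultimately show ?thesis by linarith
qed

end

section \<open>Asymptotics\<close>

text \<open>The lower half of Stirling's formula: \<open>M * ln (M + 1) - M * ln M\<close> is at
  most 1 because \<open>ln (1 + x) \<le> x\<close>.\<close>

lemma sum_ln_ge: "real M * ln (real M) - real M \<le> (\<Sum>n=1..M. ln (real n))"
proof (induction M)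
  case (Suc M)
  have "real M * ln (real (Suc M)) - real M * ln (real M) \<le> 1"
  proof (cases "M = 0")
    case False
    have "ln (real (Suc M)) - ln (real M) = ln (1 + 1 / real M)"
    proof -
      have "1 + 1 / real M = real (Suc M) / real M" using False by (simp add: field_simps)
      then show ?thesis using False by (simp add: ln_div del: of_nat_Suc)
    qed
    also have "\<dots> \<le> 1 / real M" by (rule ln_add_one_self_le_self) simp
    finally have "real M * (ln (real (Suc M)) - ln (real M)) \<le> real M * (1 / real M)"
      by (rule mult_left_mono) simp
    then show ?thesis using False by (simp add: right_diff_distrib)
  qed simp
  moreover have "real (Suc M) * ln (real (Suc M)) = real M * ln (real (Suc M)) + ln (real (Suc M))"
    by (simp add: distrib_right)
  ultimately show ?case using Suc by simp
qed simp

lemma sum_nat_le_square: "2 * (\<Sum>n<N. real n) \<le> (real N)\<^sup>2"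
  by (induction N) (auto simp: power2_eq_square algebra_simps)

text \<open>Comparison with the integral of the positive part, done by telescoping its
  antiderivative \<open>(max 0 y)\<^sup>2\<close>. With \<open>B\<close> about
  \<open>2 * (\<beta> + \<eta>) * \<Lambda>\<close> the bound is the leading cost of the
  hole.\<close>

lemma sum_positive_part_le:
  assumes \<delta>: "\<delta> > 0"
  shows "(\<Sum>n=1..N. max 0 (B - 2 * real n * \<delta>)) \<le> B\<^sup>2 / (4 * \<delta>)"
proof -
  define g where "g y = (max 0 y)\<^sup>2" for y :: real
  have step: "4 * \<delta> * max 0 y \<le> g (y + 2 * \<delta>) - g y" for y
  proof (cases "y \<ge> 0")
    case True
    then show ?thesis using \<delta> by (simp add: g_def power2_eq_square algebra_simps)
  qed (simp add: g_def)
  have "4 * \<delta> * (\<Sum>n=1..N. max 0 (B - 2 * real n * \<delta>)) \<le> g B - g (B - 2 * real N * \<delta>)"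
  proof (induction N)
    case (Suc N)
    have "B - 2 * real (Suc N) * \<delta> + 2 * \<delta> = B - 2 * real N * \<delta>" by (simp add: algebra_simps)
    then have "4 * \<delta> * max 0 (B - 2 * real (Suc N) * \<delta>) \<le> g (B - 2 * real N * \<delta>) - g (B - 2 * real (Suc N) * \<delta>)"
      using step[of "B - 2 * real (Suc N) * \<delta>"] by (simp only:)
    then show ?case using Suc by (simp add: distrib_left del: of_nat_Suc)
  qed simp
  also have "\<dots> \<le> g B" by (simp add: g_def)
  also have "\<dots> \<le> B\<^sup>2" by (auto simp: g_def max_def)
  finally show ?thesis using \<delta> by (simp add: field_simps)
qed

lemma one_minus_exp_ge: "0 \<le> y \<Longrightarrow> y \<le> 1 \<Longrightarrow> y / 2 \<le> 1 - exp (- y)" for y :: real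
proof -
  assume y: "0 \<le> y" "y \<le> 1"
  have "1 \<le> (1 - y / 2) * (1 + y)" using y mult_left_mono[OF y(2,1)] by (simp add: algebra_simps)
  also have "\<dots> \<le> (1 - y / 2) * exp y" using exp_ge_add_one_self[of y] y by (intro mult_left_mono) auto
  finally show ?thesis by (simp add: exp_minus field_simps)
qed

text \<open>\<open>x \<delta>\<close> is the number of points before rounding. The shift by 1
  accounts for the floor, the shift by 2 for the floor together with the omitted index 0. The factor
  \<open>1 + \<eta>\<close> is the price of the smaller radius.\<close>

lemma upper_rate_limits:
  fixes \<beta> \<eta> :: real
  assumes "\<beta> > 0" "\<eta> > 0"
  defines "x \<equiv> \<lambda>\<delta>. \<beta> * ln (1 / \<delta>) / \<delta>"
  shows "((\<lambda>\<delta>. \<delta> / (ln (1 / \<delta>))\<^sup>2 * x \<delta>) \<longlongrightarrow> 0) (at_right 0)"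
    and "((\<lambda>\<delta>. \<delta> / (ln (1 / \<delta>))\<^sup>2 * (x \<delta> * ln (1 / \<delta>))) \<longlongrightarrow> \<beta>) (at_right 0)"
    and "((\<lambda>\<delta>. \<delta> / (ln (1 / \<delta>))\<^sup>2 * ((x \<delta> - 1) * ln (x \<delta> - 1))) \<longlongrightarrow> \<beta>) (at_right 0)"
    and "((\<lambda>\<delta>. \<delta> / (ln (1 / \<delta>))\<^sup>2 * ((x \<delta> - 2) * ln (x \<delta> - 2))) \<longlongrightarrow> \<beta>) (at_right 0)"
    and "((\<lambda>\<delta>. \<delta> / (ln (1 / \<delta>))\<^sup>2 * ((x \<delta>)\<^sup>2 * (- ln ((1 - \<delta>) * (1 - \<eta> * \<delta>))))) \<longlongrightarrow> \<beta>\<^sup>2 * (1 + \<eta>)) (at_right 0)"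
  using assms(1,2) unfolding x_def
      apply -
  subgoal by real_asymp
  subgoal by real_asymp
  subgoal by real_asymp
  subgoal by real_asymp
  subgoal by (real_asymp simp: power2_eq_square field_simps)
  done

text \<open>Only the squared bracket has order \<open>\<Lambda>\<^sup>2 / \<delta>\<close>; there
  the inner logarithm is asymptotic to \<Lambda>. The constant term costs order
  \<open>1 / \<delta>\<close> and the factor \<open>exp (-1)\<close> per coefficient costs order
  \<open>\<Lambda> / \<delta>\<close>.\<close>

lemma lower_rate_limit:
  fixes \<beta> \<eta> A C :: real
  assumes "\<beta> > 0" "\<eta> > 0" "A > 0" "C > 0"
  shows "((\<lambda>\<delta>. 4 * \<delta> / (ln (1 / \<delta>))\<^sup>2 * (ln 8 + (1 / sqrt \<delta> + 1)\<^sup>2 + (A * ln (1 / \<delta>) / \<delta> + 1)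
     + (2 * ln C + 2 * \<beta> * ln (A * ln (1 / \<delta>) / \<delta> + 1) + 2 * \<eta> * ln (1 / \<delta>))\<^sup>2 / (4 * \<delta>)))
     \<longlongrightarrow> (2 * \<beta> + 2 * \<eta>)\<^sup>2) (at_right 0)"
  using assms by (real_asymp simp: power2_eq_square field_simps)

section \<open>Choice of parameters and the two rates\<close>

context hyperbolic_series
begin

lemma prob_Hole_lower_rate:
  assumes \<eta>: "\<eta> > 0"
  shows "\<forall>\<^sub>F \<delta> in at_right 0. 0 < prob (Hole M \<zeta> a (1 - \<delta>)) \<and>
    4 * \<delta> / (ln (1 / \<delta>))\<^sup>2 * - ln (prob (Hole M \<zeta> a (1 - \<delta>))) \<le> (2 * \<beta> + 2 * \<eta>)\<^sup>2 + \<eta>"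
proof -
  obtain D k where D: "D \<ge> 1"
    and Dk: "\<And>\<delta> n. 0 < \<delta> \<Longrightarrow> \<delta> < 1 \<Longrightarrow> a n * (1 - \<delta>) ^ n \<le> D * (1 / \<delta>) ^ k * exp (- (3 * \<delta> / 4)) ^ n"
    using coefficient_decay by blast
  \<comment> \<open>With \<open>y = exp (- 3 * \<delta> / 4)\<close> this makes \<open>y ^ N\<close>
    at most \<open>\<delta> ^ (k + 1)\<close>. That absorbs the factor
    \<open>(1 / \<delta>) ^ k\<close> of the coefficients and the \<open>3 / \<delta>\<close> of the
    geometric series, leaving a tail of at most \<open>3 * D\<close>.\<close>
  define A where "A = 2 * real k + 2"
  define C where "C = max 1 C\<^sub>1"
  have A: "A > 0" and C: "C > 0" "C \<ge> 1" by (auto simp: A_def C_def)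
  define Lam where "Lam \<delta> = ln (1 / \<delta>)" for \<delta> :: real
  define N' where "N' \<delta> = A * ln (1 / \<delta>) / \<delta> + 1" for \<delta>
  have ev: "\<forall>\<^sub>F \<delta> in at_right 0. 0 < \<delta> \<and> \<delta> < (1/2 :: real)"
    using eventually_at_right_real[of 0 "1/2"] by (auto elim: eventually_mono)
  moreover have "\<forall>\<^sub>F \<delta> in at_right 0. N' \<delta> * (N' \<delta> * (2 * pi * \<delta> ^ 4)) \<le> (1 / sqrt \<delta>) / 8"
    unfolding N'_def using A by real_asymp
  moreover have "\<forall>\<^sub>F \<delta> in at_right 0. 16 * (1 / \<delta> ^ 4 + 1) *
      exp (N' \<delta> * (sqrt \<delta> * (ln (1 / \<delta>))\<^sup>2 * \<delta> powr \<eta>)\<^sup>2 - (ln (1 / \<delta>))\<^sup>2 / 4) \<le> 1"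
    unfolding N'_def using A \<eta> by real_asymp
  moreover have "\<forall>\<^sub>F \<delta> in at_right 0. 96 * D \<le> 1 / sqrt \<delta>"
    by real_asymp
  moreover have "\<forall>\<^sub>F \<delta> in at_right 0. 4 * \<delta> / (ln (1 / \<delta>))\<^sup>2 * (ln 8 + (1 / sqrt \<delta> + 1)\<^sup>2 + N' \<delta>
     + (2 * ln C + 2 * \<beta> * ln (N' \<delta>) + 2 * \<eta> * ln (1 / \<delta>))\<^sup>2 / (4 * \<delta>)) < (2 * \<beta> + 2 * \<eta>)\<^sup>2 + \<eta>"
    unfolding N'_def using \<eta> by (intro order_tendstoD(2)[OF lower_rate_limit[OF \<beta>_pos \<eta> A C(1)]]) simp
  ultimately show ?thesis
  proof eventually_elim
    case (elim \<delta>)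
    have \<delta>: "0 < \<delta>" "\<delta> < 1/2" "\<delta> < 1" using elim(1) by auto
    define L where "L = ln (1 / \<delta>)"
    have L: "L > 0" using \<delta> by (simp add: L_def)
    define r where "r = 1 - \<delta>"
    have r: "0 < r" "r < 1" using \<delta> by (auto simp: r_def)
    define N where "N = nat \<lceil>A * L / \<delta>\<rceil>"
    have "A * L / \<delta> > 0" using A L \<delta> by simp
    then have N: "A * L / \<delta> \<le> real N" "real N \<le> N' \<delta>" "N > 0"
      unfolding N_def N'_def L_def[symmetric] by linarith+
    define K where "K = 1 / sqrt \<delta>"
    define \<epsilon> where "\<epsilon> = \<delta> powr \<eta>"
    \<comment> \<open>Now \<open>l * K = L\<^sup>2\<close>, while
      \<open>N * (l * \<epsilon>)\<^sup>2\<close> is of order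
      \<open>L ^ 5 * \<delta> powr (2 * \<eta>)\<close> and tends to 0. So the Chernoff bound decays
      like \<open>exp (- L\<^sup>2 / 4)\<close>, faster than any power of \<delta>, and beats a net
      of polynomial size such as \<open>m\<close> below.\<close>
    define l where "l = sqrt \<delta> * L\<^sup>2"
    define m where "m = nat \<lceil>1 / \<delta> ^ 4\<rceil>"
    have K: "K > 0" and \<epsilon>: "\<epsilon> > 0" "\<epsilon> \<le> 1" and l: "l > 0"
      using \<delta> L \<eta> by (auto simp: K_def \<epsilon>_def l_def powr_le_one_le powr_le1)
    have "1 / \<delta> ^ 4 > 0" using \<delta> by simp
    then have m: "1 / \<delta> ^ 4 \<le> real m" "real m \<le> 1 / \<delta> ^ 4 + 1" "m > 0"
      unfolding m_def by linarith+
    have lK: "l * K = L\<^sup>2" using \<delta> by (simp add: l_def K_def)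
    have mesh: "real N * (real N * \<epsilon> * (2 * pi / real m)) \<le> K / 8"
    proof -
      have "1 / real m \<le> \<delta> ^ 4" using m \<delta> by (simp add: field_simps)
      then have "2 * pi / real m \<le> 2 * pi * \<delta> ^ 4"
        using mult_left_mono[of "1 / real m" "\<delta> ^ 4" "2 * pi"] by simp
      then have "real N * (real N * \<epsilon> * (2 * pi / real m)) \<le> N' \<delta> * (N' \<delta> * 1 * (2 * pi * \<delta> ^ 4))"
        using N \<epsilon> by (intro mult_mono) auto
      then show ?thesis using elim(2) by (simp add: K_def)
    qed
    have chernoff: "16 * real m * exp (real N * (l * \<epsilon>)\<^sup>2 - l * K / 4) \<le> 1"
    proof -
      have "16 * real m * exp (real N * (l * \<epsilon>)\<^sup>2 - l * K / 4) \<le>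
          16 * (1 / \<delta> ^ 4 + 1) * exp (N' \<delta> * (sqrt \<delta> * L\<^sup>2 * \<delta> powr \<eta>)\<^sup>2 - L\<^sup>2 / 4)"
        using m N unfolding lK unfolding l_def \<epsilon>_def
        by (intro mult_mono) (auto intro!: mult_right_mono)
      also have "\<dots> \<le> 1" using elim(3) by (simp only: L_def)
      finally show ?thesis .
    qed
    have tail: "32 * (\<Sum>n. a (n + Suc N) * r ^ (n + Suc N)) \<le> K"
    proof -
      define y where "y = exp (- (3 * \<delta> / 4))"
      have y: "0 < y" "y < 1" "\<delta> / 3 \<le> 1 - y"
        using \<delta> one_minus_exp_ge[of "3 * \<delta> / 4"] by (auto simp: y_def)
      have y3: "1 / (1 - y) \<le> 3 / \<delta>" using y \<delta> by (simp add: field_simps)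
      have sg: "summable (\<lambda>n. D * (1 / \<delta>) ^ k * y ^ N * y ^ n)"
        using y by (intro summable_mult summable_geometric) auto
      have yN: "y ^ N \<le> \<delta> ^ (k + 1)"
      proof -
        have "y ^ N = exp (real N * - (3 * \<delta> / 4))" by (simp only: y_def exp_of_nat_mult)
        also have "\<dots> \<le> exp (- (real (k + 1) * L))"
        proof -
          have "A * L \<le> real N * \<delta>" using N(1) \<delta> by (simp add: field_simps)
          moreover have "3 / 4 * (A * L) = 3 / 2 * (real (k + 1) * L)" by (simp add: A_def algebra_simps)
          moreover have "0 \<le> real (k + 1) * L" using L by simp
          ultimately have "real (k + 1) * L \<le> real N * (3 * \<delta> / 4)" by linarith
          then show ?thesis by simp
        qed
        also have "\<dots> = exp (- L) ^ (k + 1)" by (simp only: exp_of_nat_mult[symmetric] mult_minus_right)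
        also have "exp (- L) = \<delta>" using \<delta> by (simp add: L_def ln_div)
        finally show ?thesis .
      qed
      have "(\<Sum>n. a (n + Suc N) * r ^ (n + Suc N)) \<le> (\<Sum>n. D * (1 / \<delta>) ^ k * y ^ N * y ^ n)"
      proof (rule suminf_le[OF _ _ sg])
        show "summable (\<lambda>n. a (n + Suc N) * r ^ (n + Suc N))"
          using summable_coefficients[OF r] by (subst summable_iff_shift)
        fix n
        have "a (n + Suc N) * r ^ (n + Suc N) \<le> D * (1 / \<delta>) ^ k * y ^ (n + Suc N)"
          unfolding r_def y_def by (rule Dk[OF \<delta>(1,3)])
        also have "\<dots> \<le> D * (1 / \<delta>) ^ k * (y ^ N * y ^ n)"
        proof (rule mult_left_mono)
          have "y ^ (n + Suc N) = (y ^ N * y ^ n) * y" by (simp add: power_add)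
          also have "\<dots> \<le> y ^ N * y ^ n" using y by (intro mult_left_le) auto
          finally show "y ^ (n + Suc N) \<le> y ^ N * y ^ n" .
        qed (use D \<delta> in auto)
        finally show "a (n + Suc N) * r ^ (n + Suc N) \<le> D * (1 / \<delta>) ^ k * y ^ N * y ^ n" by (simp only: mult.assoc)
      qed
      also have "\<dots> = D * (1 / \<delta>) ^ k * y ^ N * (1 / (1 - y))"
        using y by (subst suminf_mult) (auto simp: suminf_geometric summable_geometric)
      also have "\<dots> \<le> D * (1 / \<delta>) ^ k * \<delta> ^ (k + 1) * (3 / \<delta>)"
        using D \<delta> y yN y3 by (intro mult_mono) auto
      also have "\<dots> = 3 * D" using \<delta> by (simp add: power_divide)
      finally show ?thesis using elim(4) by (simp add: K_def)
    qed
    \<comment> \<open>Uniformly for \<open>1 \<le> n \<le> N\<close>,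
      \<open>2 * ln (a n / \<epsilon>)\<close> is at most \<open>B\<close>; the factor
      \<open>r ^ n\<close> then contributes \<open>- 2 * n * \<delta>\<close>.\<close>
    define B where "B = 2 * ln C + 2 * \<beta> * ln (N' \<delta>) + 2 * \<eta> * L"
    have factor: "exp (- 1 - max 0 (B - 2 * real n * \<delta>)) \<le> prob {\<omega> \<in> space M. cmod (\<zeta> n \<omega>) \<le> \<epsilon> / (a n * r ^ n)}"
      if n: "n \<in> {1..N}" for n
    proof -
      have arp: "a n * r ^ n > 0" using a_pos r by simp
      define b where "b = \<epsilon> / (a n * r ^ n)"
      have b: "b > 0" using arp \<epsilon> by (simp add: b_def)
      have "ln (a n) \<le> ln (C * N' \<delta> powr \<beta>)"
      proof -
        have "a n \<le> C\<^sub>1 * real n powr \<beta>" using n by (intro a_le) simp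
        also have "\<dots> \<le> C * N' \<delta> powr \<beta>"
          using n N C\<^sub>1_pos \<beta>_pos by (intro mult_mono powr_mono2) (auto simp: C_def)
        finally show ?thesis using a_pos[of n] by simp
      qed
      also have "\<dots> = ln C + \<beta> * ln (N' \<delta>)"
        using C N by (simp add: ln_mult ln_powr)
      finally have la: "ln (a n) \<le> ln C + \<beta> * ln (N' \<delta>)" .
      have lr: "ln r \<le> - \<delta>" using ln_le_minus_one[of r] r by (simp add: r_def)
      have "ln b = - (\<eta> * L) - (ln (a n) + real n * ln r)"
        using \<epsilon> a_pos[of n] r \<delta> by (simp add: b_def ln_div ln_mult ln_realpow \<epsilon>_def ln_powr L_def)
      moreover have "real n * ln r \<le> real n * - \<delta>" using lr by (intro mult_left_mono) auto
      ultimately have lb: "- (B - 2 * real n * \<delta>) \<le> 2 * ln b" using la by (simp add: B_def)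
      have "b\<^sup>2 = exp (2 * ln b)" using b by (simp add: exp_double power2_eq_square)
      then have be: "exp (- (B - 2 * real n * \<delta>)) \<le> b\<^sup>2" using lb by simp
      have "exp (- max 0 (B - 2 * real n * \<delta>)) \<le> min 1 (b\<^sup>2)"
      proof (cases "B - 2 * real n * \<delta> < 0")
        case True
        then have "1 \<le> exp (- (B - 2 * real n * \<delta>))" by (subst one_le_exp_iff) linarith
        then have "1 \<le> b\<^sup>2" using be by linarith
        then show ?thesis using True by simp
      qed (use be in \<open>simp add: max_def\<close>)
      then have "exp (- 1 - max 0 (B - 2 * real n * \<delta>)) \<le> min 1 (b\<^sup>2) / exp 1"
        by (simp add: exp_diff exp_minus field_simps)
      also have "\<dots> \<le> prob {\<omega> \<in> space M. cmod (\<zeta> n \<omega>) \<le> b}" using b by (intro prob_\<zeta>_small) simp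
      finally show ?thesis by (simp add: b_def)
    qed
    \<comment> \<open>\<open>ln 8\<close> collects the \<open>1 / 2\<close> of
      \<open>prob_Hole_ge\<close> and the \<open>1 / 4\<close> of
      \<open>prob_\<zeta>_large\<close>.\<close>
    define \<Phi> where "\<Phi> = ln 8 + (K + 1)\<^sup>2 + N' \<delta> + B\<^sup>2 / (4 * \<delta>)"
    have "exp (- \<Phi>) \<le> 1 / 2 * (exp (- (K + 1)\<^sup>2) / 4 * exp (\<Sum>n=1..N. - 1 - max 0 (B - 2 * real n * \<delta>)))"
    proof -
      have "(\<Sum>n=1..N. - 1 - max 0 (B - 2 * real n * \<delta>)) = - real N - (\<Sum>n=1..N. max 0 (B - 2 * real n * \<delta>))"
        by (simp add: sum_subtractf)
      then have "- N' \<delta> - B\<^sup>2 / (4 * \<delta>) \<le> (\<Sum>n=1..N. - 1 - max 0 (B - 2 * real n * \<delta>))"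
        using sum_positive_part_le[OF \<delta>(1), of B N] N by linarith
      then have "- \<Phi> \<le> - ln 8 + (- (K + 1)\<^sup>2 + (\<Sum>n=1..N. - 1 - max 0 (B - 2 * real n * \<delta>)))"
        by (simp add: \<Phi>_def)
      then have "exp (- \<Phi>) \<le> exp (- ln 8 + (- (K + 1)\<^sup>2 + (\<Sum>n=1..N. - 1 - max 0 (B - 2 * real n * \<delta>))))"
        by (simp only: exp_le_cancel_iff)
      also have "\<dots> = 1 / 8 * (exp (- (K + 1)\<^sup>2) * exp (\<Sum>n=1..N. - 1 - max 0 (B - 2 * real n * \<delta>)))"
        unfolding exp_add by (simp add: exp_minus)
      finally show ?thesis by simp
    qed
    also have "\<dots> \<le> 1 / 2 * (prob {\<omega> \<in> space M. K \<le> cmod (\<zeta> 0 \<omega>)} *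
      (\<Prod>n\<in>{1..N}. prob {\<omega> \<in> space M. cmod (\<zeta> n \<omega>) \<le> \<epsilon> / (a n * r ^ n)}))"
      unfolding exp_sum[OF finite_atLeastAtMost]
      using K by (intro mult_left_mono mult_mono prob_\<zeta>_large prod_mono conjI factor prod_nonneg) auto
    also have "\<dots> \<le> prob (Hole M \<zeta> a r)"
      by (rule prob_Hole_ge[OF r K \<epsilon>(1) m(3) l mesh chernoff tail])
    finally have P: "exp (- \<Phi>) \<le> prob (Hole M \<zeta> a r)" .
    then have pos: "0 < prob (Hole M \<zeta> a r)" using exp_gt_zero less_le_trans by blast
    have "ln (exp (- \<Phi>)) \<le> ln (prob (Hole M \<zeta> a r))" using P pos by (subst ln_le_cancel_iff) auto
    then have "- ln (prob (Hole M \<zeta> a r)) \<le> \<Phi>" by simp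
    then have "4 * \<delta> / (ln (1 / \<delta>))\<^sup>2 * - ln (prob (Hole M \<zeta> a r)) \<le> 4 * \<delta> / (ln (1 / \<delta>))\<^sup>2 * \<Phi>"
      using \<delta> by (intro mult_left_mono) auto
    also have "\<dots> \<le> (2 * \<beta> + 2 * \<eta>)\<^sup>2 + \<eta>"
      using elim(5) by (simp add: \<Phi>_def B_def K_def L_def less_imp_le)
    finally show ?case using pos by (simp add: r_def)
  qed
qed

text \<open>\<kappa> is independent of \<eta>, so that \<eta> can tend to 0 after \<delta>. The
  hypothesis of positive probability guards against the convention \<open>ln 0 = 0\<close>.\<close>

lemma prob_Hole_upper_rate:
  obtains \<kappa> :: real where "\<And>\<eta>. 0 < \<eta> \<Longrightarrow> \<eta> < 1 \<Longrightarrow>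
    \<forall>\<^sub>F \<delta> in at_right 0. 0 < prob (Hole M \<zeta> a (1 - \<delta>)) \<longrightarrow>
      4 * \<beta>\<^sup>2 - \<kappa> * \<eta> \<le> 4 * \<delta> / (ln (1 / \<delta>))\<^sup>2 * - ln (prob (Hole M \<zeta> a (1 - \<delta>)))"
proof -
  obtain D k where D: "D \<ge> 1"
    and Dk: "\<And>\<delta> n. 0 < \<delta> \<Longrightarrow> \<delta> < 1 \<Longrightarrow> a n * (1 - \<delta>) ^ n \<le> D * (1 / \<delta>) ^ k * exp (- (3 * \<delta> / 4)) ^ n"
    using coefficient_decay by blast
  define C where "C = real (k + 4)"
  have C: "C > 0" by (simp add: C_def)
  \<comment> \<open>The bracket gathers the terms linear in \<eta> of the limit \<open>lim\<close>
    below. Of the additional 2, one unit makes the comparison with that limit strict and the other,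
    through the \<open>+ \<eta>\<close> in \<open>w\<close>, pays for the factor 3 of the union
    bound.\<close>
  define \<kappa> where "\<kappa> = 4 * (\<beta> * (2 * C + 3) + \<beta>\<^sup>2) + 2"
  have "\<forall>\<^sub>F \<delta> in at_right 0. 0 < prob (Hole M \<zeta> a (1 - \<delta>)) \<longrightarrow>
      4 * \<beta>\<^sup>2 - \<kappa> * \<eta> \<le> 4 * \<delta> / (ln (1 / \<delta>))\<^sup>2 * - ln (prob (Hole M \<zeta> a (1 - \<delta>)))"
    if \<eta>: "0 < \<eta>" "\<eta> < 1" for \<eta>
  proof -
    define G where "G = 1 - 4 powr (- \<eta>)"
    have "4 powr (- \<eta>) < 1" using \<eta> by (intro powr_less_one) auto
    then have G: "0 < G" "G < 1" by (auto simp: G_def)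
    define x where "x \<delta> = \<beta> * ln (1 / \<delta>) / \<delta>" for \<delta> :: real
    \<comment> \<open>An upper bound for the logarithm of the first summand in
      \<open>prob_Hole_le\<close>, with \<open>N\<close> replaced by \<open>x \<delta>\<close>. The
      powers of \<open>S\<close> cancel up to \<open>2 * C * \<eta>\<close> because
      \<open>s = 1 - \<eta>\<close>; the power of \<open>t\<close> gives
      \<open>(1 - \<eta>) * (1 + 4 * \<eta>)\<close>, whose main part is cancelled by the term from
      \<open>N ^ N\<close>.\<close>
    define U where "U \<delta> = x \<delta> * ln (1 / \<delta>) * (2 * C * \<eta> + (1 - \<eta>) * (1 + 4 * \<eta>))
      + x \<delta> * (2 * ln 2 - ln G + 2 * \<bar>ln c\<^sub>1\<bar> + 2 * \<beta>)
      - (x \<delta> - 1) * ln (x \<delta> - 1) - 2 * \<beta> * ((x \<delta> - 2) * ln (x \<delta> - 2))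
      + (x \<delta>)\<^sup>2 * (- ln ((1 - \<delta>) * (1 - \<eta> * \<delta>)))" for \<delta>
    define w where "w = 4 * \<beta>\<^sup>2 - \<kappa> * \<eta> + \<eta>"
    have lim: "((\<lambda>\<delta>. \<delta> / (ln (1 / \<delta>))\<^sup>2 * U \<delta>) \<longlongrightarrow>
        \<beta> * (2 * C * \<eta> + (1 - \<eta>) * (1 + 4 * \<eta>)) + 0 * (2 * ln 2 - ln G + 2 * \<bar>ln c\<^sub>1\<bar> + 2 * \<beta>)
        - \<beta> - 2 * \<beta> * \<beta> + \<beta>\<^sup>2 * (1 + \<eta>)) (at_right 0)"
    proof -
      note lims = upper_rate_limits[OF \<beta>_pos \<eta>(1), folded x_def]
      have "((\<lambda>\<delta>. \<delta> / (ln (1 / \<delta>))\<^sup>2 * (x \<delta> * ln (1 / \<delta>)) * (2 * C * \<eta> + (1 - \<eta>) * (1 + 4 * \<eta>))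
          + \<delta> / (ln (1 / \<delta>))\<^sup>2 * x \<delta> * (2 * ln 2 - ln G + 2 * \<bar>ln c\<^sub>1\<bar> + 2 * \<beta>)
          - \<delta> / (ln (1 / \<delta>))\<^sup>2 * ((x \<delta> - 1) * ln (x \<delta> - 1))
          - 2 * \<beta> * (\<delta> / (ln (1 / \<delta>))\<^sup>2 * ((x \<delta> - 2) * ln (x \<delta> - 2)))
          + \<delta> / (ln (1 / \<delta>))\<^sup>2 * ((x \<delta>)\<^sup>2 * (- ln ((1 - \<delta>) * (1 - \<eta> * \<delta>))))) \<longlongrightarrow>
        \<beta> * (2 * C * \<eta> + (1 - \<eta>) * (1 + 4 * \<eta>)) + 0 * (2 * ln 2 - ln G + 2 * \<bar>ln c\<^sub>1\<bar> + 2 * \<beta>)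
        - \<beta> - 2 * \<beta> * \<beta> + \<beta>\<^sup>2 * (1 + \<eta>)) (at_right 0)"
        by (intro tendsto_intros lims)
      moreover have "p * (v * e * c + v * c' - l - 2 * b * l' + l'') =
          p * (v * e) * c + p * v * c' - p * l - 2 * b * (p * l') + p * l''"
        for p v e c c' l b l' l'' :: real by (simp add: algebra_simps)
      ultimately show ?thesis unfolding U_def by (simp only:)
    qed
    have lt: "\<beta> * (2 * C * \<eta> + (1 - \<eta>) * (1 + 4 * \<eta>)) + 0 * (2 * ln 2 - ln G + 2 * \<bar>ln c\<^sub>1\<bar> + 2 * \<beta>)
        - \<beta> - 2 * \<beta> * \<beta> + \<beta>\<^sup>2 * (1 + \<eta>) < - w / 4"
    proof -
      have "0 \<le> \<beta> * \<eta>\<^sup>2" using \<beta>_pos by simp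
      then show ?thesis using \<eta> by (simp add: w_def \<kappa>_def field_simps power2_eq_square)
    qed
    have "\<forall>\<^sub>F \<delta> in at_right 0. 0 < \<delta> \<and> \<delta> < (1/2 :: real)"
      using eventually_at_right_real[of 0 "1/2"] by (auto elim: eventually_mono)
    moreover have "\<forall>\<^sub>F \<delta> in at_right 0. x \<delta> > 3"
      unfolding x_def using \<beta>_pos by real_asymp
    moreover have "\<forall>\<^sub>F \<delta> in at_right 0. 2 * C * exp (- \<eta> * (\<beta> * ln (1 / \<delta>) - \<delta>)) \<le> \<eta>"
      using \<beta>_pos \<eta> C by real_asymp
    moreover have "\<forall>\<^sub>F \<delta> in at_right 0. 9 * D < 1 / \<delta>"
      by real_asymp
    moreover have "\<forall>\<^sub>F \<delta> in at_right 0. \<delta> / (ln (1 / \<delta>))\<^sup>2 * U \<delta> < - w / 4"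
      by (rule order_tendstoD(2)[OF lim lt])
    moreover have "\<forall>\<^sub>F \<delta> in at_right (0::real).
        ln 2 - ((1 / \<delta>) powr (1 / 2 + \<eta>))\<^sup>2 / 2 \<le> - (w * (ln (1 / \<delta>))\<^sup>2 / (4 * \<delta>))"
      using \<eta> by real_asymp
    moreover have "\<forall>\<^sub>F \<delta> in at_right (0::real). ln 6 - (1 / \<delta>)\<^sup>2 / 2 \<le> - (w * (ln (1 / \<delta>))\<^sup>2 / (4 * \<delta>))"
      by real_asymp
    moreover have "\<forall>\<^sub>F \<delta> in at_right (0::real). 4 * \<delta> * ln 3 / (ln (1 / \<delta>))\<^sup>2 \<le> \<eta>"
      using \<eta> by real_asymp
    ultimately show ?thesis
    proof eventually_elim
      case (elim \<delta>)
      have \<delta>: "0 < \<delta>" "\<delta> < 1/2" "\<delta> < 1" using elim(1) by auto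
      define L where "L = ln (1 / \<delta>)"
      have L: "L > 0" using \<delta> by (simp add: L_def)
      define r where "r = 1 - \<delta>"
      have r: "0 < r" "r < 1" using \<delta> by (auto simp: r_def)
      define y where "y = x \<delta>"
      have y: "y = \<beta> * L / \<delta>" "y > 3" using elim(2) by (auto simp: y_def x_def L_def)
      define N where "N = nat \<lfloor>y\<rfloor>"
      have N: "real N \<le> y" "y - 1 \<le> real N" "N > 0" using y(2) unfolding N_def by linarith+
      have \<eta>\<delta>: "0 < \<eta> * \<delta>" "\<eta> * \<delta> < 1"
        using \<eta> \<delta> mult_strict_mono[of \<eta> 1 \<delta> 1] by auto
      \<comment> \<open>Close enough to \<open>r\<close> to change \<open>- ln \<rho>\<close> only
        by about a factor \<open>1 + \<eta>\<close>, yet far enough that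
        \<open>q = (1 - \<eta> * \<delta>) ^ N\<close> decays like
        \<open>\<delta> powr (\<eta> * \<beta>)\<close>.\<close>
      define \<rho> where "\<rho> = r * (1 - \<eta> * \<delta>)"
      have \<rho>: "0 < \<rho>" "\<rho> < r" using r \<eta>\<delta> mult_strict_left_mono[of "1 - \<eta> * \<delta>" 1 r] by (auto simp: \<rho>_def)
      have \<rho>1: "\<rho> < 1" using \<rho> r by linarith
      define q where "q = (\<rho> / r) ^ N"
      define s where "s = 1 - \<eta>"
      have s: "0 \<le> s" "s < 1" using \<eta> by (auto simp: s_def)
      \<comment> \<open>Exponent \<open>k\<close> comes from the coefficients, 1 from
        \<open>B\<close> and 2 from the sum of \<open>(n + 1) * g ^ n\<close>; the last unit absorbs
        the constant \<open>9 * D\<close>.\<close>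
      define S where "S = (1 / \<delta>) ^ (k + 4)"
      have lnS: "ln S = C * L" using \<delta> by (simp add: S_def C_def L_def ln_realpow)
      have S: "S \<ge> 1" using \<delta> by (simp add: S_def one_le_power)
      \<comment> \<open>The exponent exceeds \<open>1 / 2\<close>, so \<open>T\<^sup>2\<close>
        outweighs \<open>L\<^sup>2 / \<delta>\<close> and the event of a large constant term is
        negligible.\<close>
      define T where "T = (1 / \<delta>) powr (1 / 2 + \<eta>)"
      have lnT: "ln T = (1 / 2 + \<eta>) * L" using \<delta> by (simp add: T_def L_def ln_powr)
      have T: "T \<ge> 1" using \<delta> \<eta> by (simp add: T_def ge_one_powr_ge_zero)
      \<comment> \<open>One \<eta> stems from \<open>ln T\<close>, the other covers the Harnack
        error \<open>2 * q * ln S\<close>.\<close>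
      define t where "t = exp (real N * ((1 / 2 + 2 * \<eta>) * L))"
      have t: "t > 0" by (simp add: t_def)
      define B where "B = 1 / \<delta>"
      have B: "B \<ge> 1" using \<delta> by (simp add: B_def)
      define g where "g = exp (- (3 * \<delta> / 4))"
      have g: "0 < g" "g < 1" "\<delta> / 3 \<le> 1 - g"
        using \<delta> one_minus_exp_ge[of "3 * \<delta> / 4"] by (auto simp: g_def)
      have gsum: "(\<lambda>n. B * (D * (1 / \<delta>) ^ k) * (of_nat (Suc n) * g ^ n)) sums (B * (D * (1 / \<delta>) ^ k) * (1 / (1 - g)\<^sup>2))"
        using g by (intro sums_mult geometric_deriv_sums) auto
      have cle: "(real n + 1) * B * (a n * r ^ n) \<le> B * (D * (1 / \<delta>) ^ k) * (of_nat (Suc n) * g ^ n)" for n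
      proof -
        have "(real n + 1) * B * (a n * r ^ n) \<le> (real n + 1) * B * (D * (1 / \<delta>) ^ k * g ^ n)"
          using Dk[OF \<delta>(1,3), of n] B unfolding r_def g_def by (intro mult_left_mono) auto
        then show ?thesis by (simp add: mult_ac add.commute)
      qed
      have sm: "summable (\<lambda>n. (real n + 1) * B * (a n * r ^ n))"
        by (rule summable_comparison_test'[OF sums_summable[OF gsum]])
           (use cle B a_pos[THEN less_imp_le] r in \<open>simp add: abs_mult\<close>)
      have "(\<Sum>n. (real n + 1) * B * (a n * r ^ n)) \<le> B * (D * (1 / \<delta>) ^ k) * (1 / (1 - g)\<^sup>2)"
        using suminf_le[OF cle sm sums_summable[OF gsum]] sums_unique[OF gsum] by simp
      also have "\<dots> \<le> B * (D * (1 / \<delta>) ^ k) * (9 / \<delta>\<^sup>2)"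
      proof (rule mult_left_mono)
        have "(\<delta> / 3)\<^sup>2 \<le> (1 - g)\<^sup>2" using g \<delta> by (intro power_mono) auto
        then have "1 / (1 - g)\<^sup>2 \<le> 1 / (\<delta> / 3)\<^sup>2" using \<delta> g by (intro divide_left_mono) auto
        then show "1 / (1 - g)\<^sup>2 \<le> 9 / \<delta>\<^sup>2" by (simp add: power_divide)
      qed (use B D \<delta> in auto)
      also have "\<dots> = 9 * D * (1 / \<delta>) ^ (k + 3)"
        by (simp add: B_def power_add power_divide power2_eq_square power3_eq_cube mult_ac)
      also have "\<dots> < (1 / \<delta>) * (1 / \<delta>) ^ (k + 3)"
        using elim(4) \<delta> by (intro mult_strict_right_mono) auto
      also have "\<dots> = S" by (simp add: S_def power_add power_divide eval_nat_numeral)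
      finally have sumS: "(\<Sum>n. (real n + 1) * B * (a n * r ^ n)) < S" .
      have q01: "0 < q" "q \<le> 1" using \<rho> r by (auto simp: q_def power_le_one)
      have qC: "2 * q * C \<le> \<eta>"
      proof -
        have "q = (1 - \<eta> * \<delta>) ^ N" using r by (simp add: q_def \<rho>_def)
        also have "\<dots> \<le> exp (- (\<eta> * \<delta>)) ^ N"
          using exp_ge_add_one_self[of "- (\<eta> * \<delta>)"] \<eta>\<delta> by (intro power_mono) auto
        also have "\<dots> = exp (real N * - (\<eta> * \<delta>))" by (simp only: exp_of_nat_mult)
        also have "\<dots> \<le> exp (- \<eta> * (\<beta> * L - \<delta>))"
        proof -
          have "(y - 1) * (\<eta> * \<delta>) \<le> real N * (\<eta> * \<delta>)" using N \<eta>\<delta> by (intro mult_right_mono) auto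
          moreover have "(y - 1) * (\<eta> * \<delta>) = \<eta> * (\<beta> * L - \<delta>)" using \<delta> y(1) by (simp add: field_simps)
          ultimately show ?thesis by simp
        qed
        finally have "2 * C * q \<le> 2 * C * exp (- \<eta> * (\<beta> * L - \<delta>))" using C by (intro mult_left_mono) auto
        then show ?thesis using elim(3) by (simp add: L_def mult_ac)
      qed
      have harnack: "real N * (2 * q / (1 + q) * ln S + (1 - q) / (1 + q) * ln T) \<le> ln t"
      proof -
        have "2 * q / (1 + q) \<le> 2 * q" using q01 by (simp add: field_simps)
        then have "2 * q / (1 + q) * ln S \<le> 2 * q * ln S" using lnS C L by (intro mult_right_mono) auto
        also have "\<dots> = (2 * q * C) * L" by (simp add: lnS)
        also have "\<dots> \<le> \<eta> * L" using qC L by (intro mult_right_mono) auto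
        finally have 1: "2 * q / (1 + q) * ln S \<le> \<eta> * L" .
        have "(1 - q) / (1 + q) \<le> 1" using q01 by (simp add: field_simps)
        then have "(1 - q) / (1 + q) * ln T \<le> 1 * ln T"
          using lnT L \<eta> by (intro mult_right_mono) auto
        then have "2 * q / (1 + q) * ln S + (1 - q) / (1 + q) * ln T \<le> (1 / 2 + 2 * \<eta>) * L"
          using 1 lnT by (simp add: algebra_simps)
        then show ?thesis unfolding t_def ln_exp by (intro mult_left_mono) auto
      qed
      define P1 where "P1 = (S\<^sup>2 / (1 - 4 powr (s - 1))) ^ N * t powr (2 * s) /
       (((S / 2) powr (2 * s)) ^ N * (real N ^ N * (\<Prod>n<N. (a n * \<rho> ^ n)\<^sup>2)))"
      have Hle: "prob (Hole M \<zeta> a r) \<le> P1 + 2 * exp (- T\<^sup>2 / 2) + 6 * exp (- B\<^sup>2 / 2)"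
        unfolding P1_def by (rule prob_Hole_le[OF r \<rho>(1,2) N(3) s B T S t sm sumS q_def harnack])
      have P1: "P1 \<le> exp (U \<delta>)"
      proof -
        have arp: "a n * \<rho> ^ n > 0" for n using a_pos \<rho> by simp
        have e1: "(S\<^sup>2 / (1 - 4 powr (s - 1))) ^ N = exp (real N * (2 * (C * L) - ln G))"
        proof -
          have "S\<^sup>2 / (1 - 4 powr (s - 1)) = S\<^sup>2 / G" by (simp add: s_def G_def)
          also have "\<dots> = exp (ln (S\<^sup>2 / G))" using S G by simp
          also have "ln (S\<^sup>2 / G) = 2 * (C * L) - ln G" using S G by (simp add: ln_div ln_realpow lnS)
          finally show ?thesis by (simp only: exp_of_nat_mult)
        qed
        have e2: "t powr (2 * s) = exp (2 * s * (real N * ((1 / 2 + 2 * \<eta>) * L)))"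
          by (simp add: powr_def t_def)
        have e3: "((S / 2) powr (2 * s)) ^ N = exp (real N * (2 * s * (C * L - ln 2)))"
          using S by (simp add: powr_def exp_of_nat_mult ln_div lnS)
        have e4: "real N ^ N = exp (real N * ln (real N))"
          using N by (simp add: exp_of_nat_mult)
        have e5: "(\<Prod>n<N. (a n * \<rho> ^ n)\<^sup>2) = exp (\<Sum>n<N. 2 * ln (a n) + 2 * (real n * ln \<rho>))"
        proof -
          have "(a n * \<rho> ^ n)\<^sup>2 = exp (2 * ln (a n) + 2 * (real n * ln \<rho>))" for n
          proof -
            have "(a n * \<rho> ^ n)\<^sup>2 = exp (ln (a n * \<rho> ^ n)) ^ 2" using arp[of n] by simp
            also have "\<dots> = exp (2 * ln (a n * \<rho> ^ n))" by (simp add: exp_double)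
            also have "2 * ln (a n * \<rho> ^ n) = 2 * ln (a n) + 2 * (real n * ln \<rho>)"
              using a_pos[of n] \<rho> by (simp add: ln_mult ln_realpow)
            finally show ?thesis .
          qed
          then show ?thesis by (simp only: exp_sum[OF finite_lessThan])
        qed
        define Z where "Z = real N * (2 * (C * L) - ln G) + 2 * s * (real N * ((1 / 2 + 2 * \<eta>) * L))
          - (real N * (2 * s * (C * L - ln 2)) + (real N * ln (real N) + (\<Sum>n<N. 2 * ln (a n) + 2 * (real n * ln \<rho>))))"
        have "P1 = exp Z" unfolding P1_def e1 e2 e3 e4 e5 Z_def exp_diff exp_add ..
        moreover have "Z \<le> U \<delta>"
        proof -
          have z1: "real N * (2 * (C * L)) + 2 * s * (real N * ((1 / 2 + 2 * \<eta>) * L)) - real N * (2 * s * (C * L)) =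
              real N * (L * (2 * C * \<eta> + (1 - \<eta>) * (1 + 4 * \<eta>)))"
            by (simp add: s_def algebra_simps)
          have "real N * (L * (2 * C * \<eta> + (1 - \<eta>) * (1 + 4 * \<eta>))) \<le> y * (L * (2 * C * \<eta> + (1 - \<eta>) * (1 + 4 * \<eta>)))"
            using N L C \<eta> by (intro mult_right_mono) auto
          moreover have "real N * - ln G \<le> y * - ln G"
            using N G by (intro mult_right_mono) auto
          moreover have "real N * (2 * s * ln 2) \<le> y * (2 * ln 2)"
            using N s by (intro mult_mono) auto
          moreover have "(y - 1) * ln (y - 1) \<le> real N * ln (real N)"
            using N y by (intro mult_mono) auto
          moreover have "- (2 * y * \<bar>ln c\<^sub>1\<bar>) + 2 * \<beta> * ((y - 2) * ln (y - 2) - y) \<le> (\<Sum>n<N. 2 * ln (a n))"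
          proof -
            \<comment> \<open>The coefficient of index 0 equals 1 and has logarithm 0, so
              \<open>N - 1\<close> coefficients remain, and \<open>N - 1\<close> is at least
              \<open>y - 2\<close>.\<close>
            define m where "m = N - 1"
            have m: "real m \<le> y" "y - 2 \<le> real m" "{..<N} = insert 0 {1..m}" using N y by (auto simp: m_def)
            have "2 * ln c\<^sub>1 + 2 * \<beta> * ln (real n) \<le> 2 * ln (a n)" if "n \<in> {1..m}" for n
            proof -
              have "ln (c\<^sub>1 * real n powr \<beta>) \<le> ln (a n)"
                using a_ge[of n] that c\<^sub>1_pos by (subst ln_le_cancel_iff) (auto simp: a_pos)
              then show ?thesis using that c\<^sub>1_pos by (simp add: ln_mult ln_powr)
            qed
            then have "(\<Sum>n\<in>{1..m}. 2 * ln c\<^sub>1 + 2 * \<beta> * ln (real n)) \<le> (\<Sum>n\<in>{1..m}. 2 * ln (a n))"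
              by (rule sum_mono)
            also have "\<dots> = (\<Sum>n<N. 2 * ln (a n))" unfolding m(3) using a_0 by simp
            also have "(\<Sum>n\<in>{1..m}. 2 * ln c\<^sub>1 + 2 * \<beta> * ln (real n)) =
                real m * (2 * ln c\<^sub>1) + 2 * \<beta> * (\<Sum>n=1..m. ln (real n))"
              by (simp add: sum.distrib sum_distrib_left)
            finally have s1: "real m * (2 * ln c\<^sub>1) + 2 * \<beta> * (\<Sum>n=1..m. ln (real n)) \<le> (\<Sum>n<N. 2 * ln (a n))" .
            have "(y - 2) * ln (y - 2) \<le> real m * ln (real m)" using m y by (intro mult_mono) auto
            then have "(y - 2) * ln (y - 2) - y \<le> (\<Sum>n=1..m. ln (real n))"
              using sum_ln_ge[of m] m by linarith
            then have s2: "2 * \<beta> * ((y - 2) * ln (y - 2) - y) \<le> 2 * \<beta> * (\<Sum>n=1..m. ln (real n))"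
              using \<beta>_pos by (intro mult_left_mono) auto
            have "real m * (2 * - ln c\<^sub>1) \<le> real m * (2 * \<bar>ln c\<^sub>1\<bar>)" by (intro mult_left_mono) auto
            also have "\<dots> \<le> y * (2 * \<bar>ln c\<^sub>1\<bar>)" using m by (intro mult_right_mono) auto
            finally have s3: "- (2 * y * \<bar>ln c\<^sub>1\<bar>) \<le> real m * (2 * ln c\<^sub>1)" by (simp add: mult_ac)
            show ?thesis using s1 s2 s3 by linarith
          qed
          moreover have "- (y\<^sup>2 * - ln \<rho>) \<le> (\<Sum>n<N. 2 * (real n * ln \<rho>))"
          proof -
            have lr: "0 \<le> - ln \<rho>" using \<rho> \<rho>1 by simp
            have "2 * (\<Sum>n<N. real n) * - ln \<rho> \<le> (real N)\<^sup>2 * - ln \<rho>"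
              using sum_nat_le_square[of N] lr by (intro mult_right_mono)
            also have "\<dots> \<le> y\<^sup>2 * - ln \<rho>" using N lr by (intro mult_right_mono power_mono) auto
            finally show ?thesis by (simp add: sum_distrib_left sum_distrib_right mult_ac sum_negf)
          qed
          moreover have "U \<delta> = y * (L * (2 * C * \<eta> + (1 - \<eta>) * (1 + 4 * \<eta>))) + y * - ln G + y * (2 * ln 2)
              - (y - 1) * ln (y - 1) - (- (2 * y * \<bar>ln c\<^sub>1\<bar>) + 2 * \<beta> * ((y - 2) * ln (y - 2) - y)) - - (y\<^sup>2 * - ln \<rho>)"
            unfolding U_def y_def[symmetric] L_def[symmetric] \<rho>_def r_def by (simp add: algebra_simps)
          moreover have "Z = real N * (L * (2 * C * \<eta> + (1 - \<eta>) * (1 + 4 * \<eta>))) + real N * - ln G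
              + real N * (2 * s * ln 2) - real N * ln (real N) - (\<Sum>n<N. 2 * ln (a n)) - (\<Sum>n<N. 2 * (real n * ln \<rho>))"
            unfolding Z_def z1[symmetric] sum.distrib by (simp add: algebra_simps)
          ultimately show ?thesis by linarith
        qed
        ultimately show ?thesis by simp
      qed
      define V where "V = w * L\<^sup>2 / (4 * \<delta>)"
      have UV: "U \<delta> \<le> - V"
      proof -
        have "\<delta> / L\<^sup>2 * U \<delta> \<le> - w / 4" using elim(5) by (simp add: L_def)
        then have "L\<^sup>2 / \<delta> * (\<delta> / L\<^sup>2 * U \<delta>) \<le> L\<^sup>2 / \<delta> * (- w / 4)" using \<delta> by (intro mult_left_mono) auto
        then show ?thesis using \<delta> L by (simp add: V_def mult_ac)
      qed
      have b1: "P1 \<le> exp (- V)" using P1 UV by (meson exp_le_cancel_iff order_trans)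
      have b2: "2 * exp (- T\<^sup>2 / 2) \<le> exp (- V)"
      proof -
        have "2 * exp (- T\<^sup>2 / 2) = exp (ln 2 + - T\<^sup>2 / 2)" unfolding exp_add by simp
        also have "\<dots> \<le> exp (- V)" using elim(6) by (simp add: V_def T_def L_def)
        finally show ?thesis .
      qed
      have b3: "6 * exp (- B\<^sup>2 / 2) \<le> exp (- V)"
      proof -
        have "6 * exp (- B\<^sup>2 / 2) = exp (ln 6 + - B\<^sup>2 / 2)" unfolding exp_add by simp
        also have "\<dots> \<le> exp (- V)" using elim(7) by (simp add: V_def B_def L_def)
        finally show ?thesis .
      qed
      show ?case
      proof
        assume pos: "0 < prob (Hole M \<zeta> a (1 - \<delta>))"
        have "prob (Hole M \<zeta> a r) \<le> 3 * exp (- V)" using Hle b1 b2 b3 by linarith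
        then have "ln (prob (Hole M \<zeta> a r)) \<le> ln (3 * exp (- V))"
          using pos by (subst ln_le_cancel_iff) (auto simp: r_def)
        also have "\<dots> = ln 3 - V" by (simp add: ln_mult)
        finally have "V - ln 3 \<le> - ln (prob (Hole M \<zeta> a r))" by simp
        then have "4 * \<delta> / L\<^sup>2 * (V - ln 3) \<le> 4 * \<delta> / L\<^sup>2 * - ln (prob (Hole M \<zeta> a r))"
          using \<delta> by (intro mult_left_mono) auto
        moreover have "4 * \<delta> / L\<^sup>2 * (V - ln 3) = w - 4 * \<delta> * ln 3 / L\<^sup>2"
          using \<delta> L by (simp add: V_def right_diff_distrib)
        moreover have "4 * \<delta> * ln 3 / L\<^sup>2 \<le> \<eta>" using elim(8) by (simp add: L_def)
        ultimately show "4 * \<beta>\<^sup>2 - \<kappa> * \<eta> \<le> 4 * \<delta> / (ln (1 / \<delta>))\<^sup>2 * - ln (prob (Hole M \<zeta> a (1 - \<delta>)))"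
          by (simp add: w_def r_def L_def)
      qed
    qed
  qed
  then show ?thesis using that by blast
qed

text \<open>For each side of the limit a fixed small \<eta> leaves room between its bound and
  \<open>e\<close>. The lower estimate of the probability also supplies the positivity required by
  the upper one.\<close>

lemma tendsto_hole_rate:
  "((\<lambda>\<delta>. 4 * \<delta> / (ln (1 / \<delta>))\<^sup>2 * - ln (prob (Hole M \<zeta> a (1 - \<delta>)))) \<longlongrightarrow> 4 * \<beta>\<^sup>2) (at_right 0)"
proof (rule order_tendstoI)
  fix e :: real
  obtain \<kappa> where \<kappa>: "\<And>\<eta>. 0 < \<eta> \<Longrightarrow> \<eta> < 1 \<Longrightarrow>
    \<forall>\<^sub>F \<delta> in at_right 0. 0 < prob (Hole M \<zeta> a (1 - \<delta>)) \<longrightarrow>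
      4 * \<beta>\<^sup>2 - \<kappa> * \<eta> \<le> 4 * \<delta> / (ln (1 / \<delta>))\<^sup>2 * - ln (prob (Hole M \<zeta> a (1 - \<delta>)))"
    using prob_Hole_upper_rate by blast
  assume e: "e < 4 * \<beta>\<^sup>2"
  have "\<forall>\<^sub>F \<eta> in at_right 0. e < 4 * \<beta>\<^sup>2 - \<kappa> * \<eta>"
    by (rule order_tendstoD(1)[OF _ e]) (auto intro!: tendsto_eq_intros)
  moreover have "\<forall>\<^sub>F \<eta> in at_right 0. 0 < \<eta> \<and> \<eta> < (1 :: real)"
    using eventually_at_right_real[of 0 1] by (auto elim: eventually_mono)
  ultimately have "\<forall>\<^sub>F \<eta> in at_right 0. e < 4 * \<beta>\<^sup>2 - \<kappa> * \<eta> \<and> 0 < \<eta> \<and> \<eta> < 1"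
    by eventually_elim simp
  then obtain \<eta> where \<eta>: "e < 4 * \<beta>\<^sup>2 - \<kappa> * \<eta>" "0 < \<eta>" "\<eta> < 1"
    using eventually_happens'[of "at_right (0::real)"] by auto
  show "\<forall>\<^sub>F \<delta> in at_right 0. e < 4 * \<delta> / (ln (1 / \<delta>))\<^sup>2 * - ln (prob (Hole M \<zeta> a (1 - \<delta>)))"
    using \<kappa>[OF \<eta>(2,3)] prob_Hole_lower_rate[OF \<eta>(2)]
    by eventually_elim (use \<eta>(1) in linarith)
next
  fix e :: real assume e: "4 * \<beta>\<^sup>2 < e"
  have "\<forall>\<^sub>F \<eta> in at_right 0. (2 * \<beta> + 2 * \<eta>)\<^sup>2 + \<eta> < e"
    by (rule order_tendstoD(2)[OF _ e]) (auto intro!: tendsto_eq_intros simp: power_mult_distrib)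
  moreover have "\<forall>\<^sub>F \<eta> in at_right 0. 0 < (\<eta> :: real)"
    by (rule eventually_at_right_less)
  ultimately have "\<forall>\<^sub>F \<eta> in at_right 0. (2 * \<beta> + 2 * \<eta>)\<^sup>2 + \<eta> < e \<and> 0 < \<eta>"
    by eventually_elim simp
  then obtain \<eta> where \<eta>: "(2 * \<beta> + 2 * \<eta>)\<^sup>2 + \<eta> < e" "0 < \<eta>"
    using eventually_happens'[of "at_right (0::real)"] by auto
  show "\<forall>\<^sub>F \<delta> in at_right 0. 4 * \<delta> / (ln (1 / \<delta>))\<^sup>2 * - ln (prob (Hole M \<zeta> a (1 - \<delta>))) < e"
    using prob_Hole_lower_rate[OF \<eta>(2)]
    by eventually_elim (use \<eta>(1) in linarith)
qed

end

theorem mainTheorem4: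
  fixes M :: "'w measure"
    and \<zeta> :: "nat \<Rightarrow> 'w \<Rightarrow> complex"
    and a :: "nat \<Rightarrow> real"
    and L c\<^sub>1 C\<^sub>1 :: real
  assumes "prob_space M"
    and "prob_space.indep_vars M (\<lambda>_. borel) \<zeta> UNIV"
    and "\<And>n. std_complex_gaussian M (\<zeta> n)"
    and "L > 1"
    and "\<And>n. a n > 0"
    and "a 0 = 1"
    and "0 < c\<^sub>1" and "c\<^sub>1 \<le> C\<^sub>1"
    and "\<And>n. n \<ge> 1 \<Longrightarrow> c\<^sub>1 * real n powr (1/2 * (L - 1)) \<le> a n"
    and "\<And>n. n \<ge> 1 \<Longrightarrow> a n \<le> C\<^sub>1 * real n powr (1/2 * (L - 1))"
  shows "\<exists>\<epsilon> :: real \<Rightarrow> real. (\<epsilon> \<longlongrightarrow> 0) (at_left 1) \<and>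
     (\<forall>r\<in>{0<..<1}. - ln (measure M (Hole M \<zeta> a r)) =
        ((L - 1)\<^sup>2 + \<epsilon> r) / 4 * (1 / (1 - r)) * (ln (1 / (1 - r)))\<^sup>2)"
proof -
  interpret prob_space M by fact
  interpret hyperbolic_series M \<zeta> a "1/2 * (L - 1)" c\<^sub>1 C\<^sub>1
    by unfold_locales (use assms in auto)
  define X where "X \<delta> = 4 * \<delta> / (ln (1 / \<delta>))\<^sup>2 * - ln (prob (Hole M \<zeta> a (1 - \<delta>)))" for \<delta>
  have "4 * (1/2 * (L - 1))\<^sup>2 = (L - 1)\<^sup>2" by (simp add: power2_eq_square field_simps)
  then have X: "(X \<longlongrightarrow> (L - 1)\<^sup>2) (at_right 0)"
    using tendsto_hole_rate by (simp add: X_def[abs_def])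
  have "filterlim (\<lambda>r. 1 - r) (at_right 0) (at_left (1::real))"
    by real_asymp
  from filterlim_compose[OF X this] have "((\<lambda>r. X (1 - r)) \<longlongrightarrow> (L - 1)\<^sup>2) (at_left 1)" .
  then have "((\<lambda>r. X (1 - r) - (L - 1)\<^sup>2) \<longlongrightarrow> (L - 1)\<^sup>2 - (L - 1)\<^sup>2) (at_left 1)"
    by (intro tendsto_diff tendsto_const)
  then have "((\<lambda>r. X (1 - r) - (L - 1)\<^sup>2) \<longlongrightarrow> 0) (at_left 1)" by simp
  \<comment> \<open>Undoing the normalisation only divides by positive factors, so the identity is
    exact for every \<open>r\<close> between 0 and 1; the asymptotic content lies entirely in the
    limit.\<close>
  moreover have "- ln (measure M (Hole M \<zeta> a r)) =
      ((L - 1)\<^sup>2 + (X (1 - r) - (L - 1)\<^sup>2)) / 4 * (1 / (1 - r)) * (ln (1 / (1 - r)))\<^sup>2"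
    if r: "r \<in> {0<..<1}" for r
  proof -
    have "ln (1 / (1 - r)) > 0" using r by (intro ln_gt_zero) auto
    then show ?thesis using r by (simp add: X_def)
  qed
  ultimately show ?thesis by (intro exI[of _ "\<lambda>r. X (1 - r) - (L - 1)\<^sup>2"]) blast
qed

end
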